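(* Let $k$ be a field of characteristic $0$, let $\mathfrak g$ be a finite dimensional Lie bialgebra over $k$, let $F_h[\mathfrak g]$ be a quantum formal series Hopf algebra such that $F_h[\mathfrak g]/hF_h[\mathfrak g]$ is isomorphic to $F[\mathfrak g]=U(\mathfrak g)^*$ as a topological Poisson Hopf algebra, and let $U_h(\mathfrak g^* )=F_h[\mathfrak g]^{\vee}$ be the quantization of $U(\mathfrak g^* )$ constructed from $F_h[\mathfrak g]$ by the quantum duality principle. Let $\bar x_1,\dots,\bar x_n\in F[\mathfrak g]$ be such that $F[\mathfrak g]\simeq k[[\bar x_1,\dots,\bar x_n]]$. Choose $x_1,\dots,x_n\in F_h[\mathfrak g]$ with $x_i=\bar x_i \bmod h$ and $\epsilon_h(x_i)=0$, and put $\check x_i=h^{-1}x_i$, so that $U_h(\mathfrak g^* )\simeq k[\check x_1,\dots,\check x_n][[h]]$ as topological $k[[h]]$-modules. Let $(\epsilon_1,\dots,\epsilon_n)$ be the basis of $\mathfrak g^*$ given by the classes of $\check x_1,\dots,\check x_n$ modulo $hF_h[\mathfrak g]^\vee$, and let $C_{i,j}^a$ be the structure constants of $\mathfrak g^*$ with respect to this basis. Then one can construct a resolution of the trivial $F_h[\mathfrak g]$-module $k[[h]]$ $$K^h_\bullet=\left(F_h[\mathfrak g]\otimes\wedge^\bullet\mathfrak g^*,\ \partial_q^h\right)$$ of the form $$\begin{aligned}\partial_q^h(1\otimes\epsilon_{p_1}\wedge\dots\wedge\epsilon_{p_q})=&\sum_{i=1}^q(-1)^{i-1}x_{p_i}\otimes\epsilon_{p_1}\wedge\dots\wedge\widehat{\epsilon_{p_i}}\wedge\dots\wedge\epsilon_{p_q}\\&+\sum_{r<s}\sum_a(-1)^{r+s}hC_{p_r,p_s}^a\,1\otimes\epsilon_a\wedge\epsilon_{p_1}\wedge\dots\wedge\widehat{\epsilon_{p_r}}\wedge\dots\wedge\widehat{\epsilon_{p_s}}\wedge\dots\wedge\epsilon_{p_q}\\&+\sum_{t_1,\dots,t_{q-1}}h\,\alpha_{p_1,\dots,p_q}^{t_1,\dots,t_{q-1}}\otimes\epsilon_{t_1}\wedge\dots\wedge\epsilon_{t_{q-1}}\end{aligned}$$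 with $\alpha_{p_1,\dots,p_q}^{t_1,\dots,t_{q-1}}\in I=\epsilon_h^{-1}(hk[[h]])$, having the following property. Set $$\check\alpha_{p_1,\dots,p_q}^{t_1,\dots,t_{q-1}}(\check x_1,\dots,\check x_n)=\alpha_{p_1,\dots,p_q}^{t_1,\dots,t_{q-1}}(x_1,\dots,x_n);$$ then $\check\alpha_{p_1,\dots,p_q}^{t_1,\dots,t_{q-1}}\in hk[\check x_1,\dots,\check x_n][[h]]$, and if $\check\partial_q^h:U_h(\mathfrak g^* )\otimes\wedge^q\mathfrak g^*\to U_h(\mathfrak g^* )\otimes\wedge^{q-1}\mathfrak g^*$ is the morphism of $U_h(\mathfrak g^* )$-modules defined by $$\begin{aligned}\check\partial_q^h(1\otimes\epsilon_{p_1}\wedge\dots\wedge\epsilon_{p_q})=&\sum_{i=1}^q(-1)^{i-1}\check x_{p_i}\otimes\epsilon_{p_1}\wedge\dots\wedge\widehat{\epsilon_{p_i}}\wedge\dots\wedge\epsilon_{p_q}\\&+\sum_{r<s}\sum_a(-1)^{r+s}C_{p_r,p_s}^a\,1\otimes\epsilon_a\wedge\epsilon_{p_1}\wedge\dots\wedge\widehat{\epsilon_{p_r}}\wedge\dots\wedge\widehat{\epsilon_{p_s}}\wedge\dots\wedge\epsilon_{p_q}\\&+\sum_{t_1,\dots,t_{q-1}}\check\alpha_{p_1,\dots,p_q}^{t_1,\dots,t_{q-1}}\otimes\epsilon_{t_1}\wedge\dots\wedge\epsilon_{t_{q-1}},\end{aligned}$$ then $\check K_h^\bullet=\left(U_h(\mathfrak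 g^* )\otimes\wedge^\bullet\mathfrak g^*,\check\partial_q^h\right)$ is a resolution of the trivial $U_h(\mathfrak g^* )$-module $k[[h]]$.
   Context: For a finite dimensional Lie bialgebra $\mathfrak g$, $F[\mathfrak g]=U(\mathfrak g)^*$ is the full linear dual, an algebra of formal power series and a topological Poisson Hopf algebra (with tensor products suitably completed). A quantum formal series Hopf algebra (QFSHA) is a topological Hopf algebra $B_h$ over $k[[h]]$ (topologically free, with completed tensor products) such that $B_h/hB_h$ is isomorphic to $U(\mathfrak g)^*$ as a topological Poisson Hopf algebra for some finite dimensional Lie bialgebra $\mathfrak g$. Write $F_h=F_h[\mathfrak g]$, $\epsilon_h$ its counit, $I=\epsilon_h^{-1}(hk[[h]])$. Let $F_h^\times=\sum_{m\ge0}h^{-m}I^m$ be the $k[[h]]$-subalgebra of $k((h))\otimes_{k[[h]]}F_h$ generated by $h^{-1}I$; $F_h^\vee$ is the $h$-adic completion of $F_h^\times$, a topological Hopf algebra which is a quantization of the co-Poisson Hopf algebra $U(\mathfrak g^* )$ ($F_h^\vee/hF_h^\vee\simeq U(\mathfrak g^* )$); the $k$-span of the classes of the $\check x_i$ modulo $hF_h^\vee$ is a Lie algebra isomorphic to $\mathfrak g^*$. With $x_1,\dots,x_n$ as in the claim, $F_h\simeq k[[x_1,\dots,x_n,h]]$ as topological $k[[h]]$-modules (elements are written as series in ordered monomials $x_1^{i_1}\cdots x_n^{i_n}$), and for $\alpha\in F_h$, $\check\alpha$ denotes the series obtained by substituting $x_j=h\check x_j$, i.e. the same element viewed in $F_h^\vee$.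 The trivial module over $F_h$ or $F_h^\vee$ is $k[[h]]$ with action given by the counit. *)

theory Defs
  imports
    "HOL-Analysis.Analysis"
    "HOL-Computational_Algebra.Formal_Laurent_Series"
    "HOL-Library.Function_Algebras"
    "HOL-Library.Multiset"
begin

section \<open>Finite dimensional Lie bialgebras\<close>

abbreviation functional :: "('k::field \<Rightarrow> 'g::ab_group_add \<Rightarrow> 'g) \<Rightarrow> ('g \<Rightarrow> 'k) \<Rightarrow> bool" where
  "functional sg \<xi> \<equiv> Vector_Spaces.linear sg (*) \<xi>"

text \<open>The cobracket \<^term>\<open>\<delta> :: 'g \<Rightarrow> ('g \<Rightarrow> 'k) \<Rightarrow> ('g \<Rightarrow> 'k) \<Rightarrow> 'k\<close> is given by the values
  \<open>\<delta> x \<xi> \<eta> = \<langle>\<delta>(x), \<xi> \<otimes> \<eta>\<rangle>\<close> on linear forms: for finite dimensional \<open>\<gg>\<close> this is the same as an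
  element \<open>\<delta>(x)\<close> of \<open>\<gg> \<otimes> \<gg> = (\<gg>\<^sup>* \<otimes> \<gg>\<^sup>*)\<^sup>*\<close>. Its transpose is the bracket of \<open>\<gg>\<^sup>*\<close>.\<close>

definition dual_bracket ::
    "('g \<Rightarrow> ('g \<Rightarrow> 'k) \<Rightarrow> ('g \<Rightarrow> 'k) \<Rightarrow> 'k) \<Rightarrow> ('g \<Rightarrow> 'k) \<Rightarrow> ('g \<Rightarrow> 'k) \<Rightarrow> 'g \<Rightarrow> 'k" where
  "dual_bracket \<delta> \<xi> \<eta> = (\<lambda>x. \<delta> x \<xi> \<eta>)"

locale lie_bialgebra = vector_space sg
  for sg :: "'k::field_char_0 \<Rightarrow> 'g::ab_group_add \<Rightarrow> 'g" +
  fixes br :: "'g \<Rightarrow> 'g \<Rightarrow> 'g"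
    and \<delta> :: "'g \<Rightarrow> ('g \<Rightarrow> 'k) \<Rightarrow> ('g \<Rightarrow> 'k) \<Rightarrow> 'k"
  assumes finite_dimensional: "\<exists>B. finite B \<and> span B = UNIV"
    and br_linear_right: "Vector_Spaces.linear sg sg (br x)"
    and br_linear_left: "Vector_Spaces.linear sg sg (\<lambda>x. br x y)"
    and br_alternating: "br x x = 0"
    and br_jacobi: "br x (br y z) + br y (br z x) + br z (br x y) = 0"
    and cobr_linear: "functional sg \<xi> \<Longrightarrow> functional sg \<eta> \<Longrightarrow> functional sg (\<lambda>x. \<delta> x \<xi> \<eta>)"
    and cobr_add_left: "functional sg \<xi> \<Longrightarrow> functional sg \<xi>' \<Longrightarrow> functional sg \<eta> \<Longrightarrow>
           \<delta> x (\<lambda>y. \<xi> y + \<xi>' y) \<eta> = \<delta> x \<xi> \<eta> + \<delta> x \<xi>' \<eta>"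
    and cobr_scale_left: "functional sg \<xi> \<Longrightarrow> functional sg \<eta> \<Longrightarrow>
           \<delta> x (\<lambda>y. c * \<xi> y) \<eta> = c * \<delta> x \<xi> \<eta>"
    and cobr_add_right: "functional sg \<xi> \<Longrightarrow> functional sg \<eta> \<Longrightarrow> functional sg \<eta>' \<Longrightarrow>
           \<delta> x \<xi> (\<lambda>y. \<eta> y + \<eta>' y) = \<delta> x \<xi> \<eta> + \<delta> x \<xi> \<eta>'"
    and cobr_scale_right: "functional sg \<xi> \<Longrightarrow> functional sg \<eta> \<Longrightarrow>
           \<delta> x \<xi> (\<lambda>y. c * \<eta> y) = c * \<delta> x \<xi> \<eta>"
    and cobr_alternating: "functional sg \<xi> \<Longrightarrow> \<delta> x \<xi> \<xi> = 0"
    and cojacobi: "functional sg \<xi> \<Longrightarrow> functional sg \<eta> \<Longrightarrow> functional sg \<zeta> \<Longrightarrow>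
           dual_bracket \<delta> \<xi> (dual_bracket \<delta> \<eta> \<zeta>) x + dual_bracket \<delta> \<eta> (dual_bracket \<delta> \<zeta> \<xi>) x
             + dual_bracket \<delta> \<zeta> (dual_bracket \<delta> \<xi> \<eta>) x = 0"
    and cocycle: "functional sg \<xi> \<Longrightarrow> functional sg \<eta> \<Longrightarrow>
           \<delta> (br x y) \<xi> \<eta> = \<delta> y (\<lambda>z. \<xi> (br x z)) \<eta> + \<delta> y \<xi> (\<lambda>z. \<eta> (br x z))
             - \<delta> x (\<lambda>z. \<xi> (br y z)) \<eta> - \<delta> x \<xi> (\<lambda>z. \<eta> (br y z))"


section \<open>The topological Poisson Hopf algebra \<open>F[\<gg>] = U(\<gg>)\<^sup>*\<close>\<close>

text \<open>\<open>U(\<gg>)\<close> is the tensor algebra \<open>T(\<gg>)\<close> modulo the two-sided ideal generated by the elements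
  \<open>x y - y x - [x,y]\<close>. A linear form on \<open>T(\<gg>)\<close> is a family of multilinear forms, i.e. a function on
  words (the word \<open>[x\<^sub>1,\<dots>,x\<^sub>m]\<close> stands for the product \<open>x\<^sub>1\<cdots>x\<^sub>m\<close>) linear in each letter; it is a
  linear form on \<open>U(\<gg>)\<close> iff it kills \<open>u (x y - y x - [x,y]) v\<close> for all words \<open>u\<close>, \<open>v\<close>.
  Linear forms on \<open>U(\<gg>) \<otimes> U(\<gg>)\<close>, the elements of the completed tensor square of \<open>U(\<gg>)\<^sup>*\<close>, are
  likewise functions on pairs of words.\<close>

definition enveloping_dual ::
    "('k::field \<Rightarrow> 'g::ab_group_add \<Rightarrow> 'g) \<Rightarrow> ('g \<Rightarrow> 'g \<Rightarrow> 'g) \<Rightarrow> ('g list \<Rightarrow> 'k) set" where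
  "enveloping_dual sg br =
     {f. (\<forall>u v. functional sg (\<lambda>x. f (u @ [x] @ v))) \<and>
         (\<forall>u v x y. f (u @ [x, y] @ v) - f (u @ [y, x] @ v) = f (u @ [br x y] @ v))}"

text \<open>Pointwise convergence, with \<open>k\<close> discrete.\<close>

definition pointwise_topology :: "('a \<Rightarrow> 'k) topology" where
  "pointwise_topology = product_topology (\<lambda>_. discrete_topology UNIV) UNIV"

definition dual_topology ::
    "('k::field \<Rightarrow> 'g::ab_group_add \<Rightarrow> 'g) \<Rightarrow> ('g \<Rightarrow> 'g \<Rightarrow> 'g) \<Rightarrow> ('g list \<Rightarrow> 'k) topology" where
  "dual_topology sg br = subtopology pointwise_topology (enveloping_dual sg br)"

text \<open>Transpose of the coproduct
  \<open>x\<^sub>1\<cdots>x\<^sub>m \<mapsto> \<Prod>\<^sub>i (x\<^sub>i \<otimes> 1 + 1 \<otimes> x\<^sub>i) = \<Sum>\<^sub>S x\<^sub>S \<otimes> x\<^sub>-\<^sub>S\<close> of \<open>U(\<gg>)\<close>.\<close>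

definition dual_mult :: "('g list \<Rightarrow> 'k::field) \<Rightarrow> ('g list \<Rightarrow> 'k) \<Rightarrow> 'g list \<Rightarrow> 'k" where
  "dual_mult f g = (\<lambda>w. \<Sum>S\<in>Pow {..<length w}. f (nths w S) * g (nths w (- S)))"

definition dual_one :: "'g list \<Rightarrow> 'k::field" where
  "dual_one = (\<lambda>w. if w = [] then 1 else 0)"

definition dual_counit :: "('g list \<Rightarrow> 'k) \<Rightarrow> 'k" where
  "dual_counit f = f []"

definition dual_coproduct :: "('g list \<Rightarrow> 'k) \<Rightarrow> 'g list \<times> 'g list \<Rightarrow> 'k" where
  "dual_coproduct f = (\<lambda>(u, v). f (u @ v))"

definition dual_antipode :: "('g list \<Rightarrow> 'k::field) \<Rightarrow> 'g list \<Rightarrow> 'k" where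
  "dual_antipode f = (\<lambda>w. (- 1) ^ length w * f (rev w))"

text \<open>Transpose of the co-Poisson bracket of \<open>U(\<gg>)\<close>, the extension of the cobracket with
  \<open>\<delta>(ab) = \<delta>(a) \<Delta>(b) + \<Delta>(a) \<delta>(b)\<close>, so that
  \<open>\<delta>(x\<^sub>1\<cdots>x\<^sub>m) = \<Sum>\<^sub>i \<Delta>(x\<^sub>1\<cdots>x\<^sub>i\<^sub>-\<^sub>1) \<delta>(x\<^sub>i) \<Delta>(x\<^sub>i\<^sub>+\<^sub>1\<cdots>x\<^sub>m)\<close>; the set \<open>S\<close> collects the letters other
  than \<open>x\<^sub>i\<close> that go to the first tensor factor.\<close>

definition dual_poisson ::
    "('g \<Rightarrow> ('g \<Rightarrow> 'k) \<Rightarrow> ('g \<Rightarrow> 'k) \<Rightarrow> 'k::field) \<Rightarrow>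
     ('g list \<Rightarrow> 'k) \<Rightarrow> ('g list \<Rightarrow> 'k) \<Rightarrow> 'g list \<Rightarrow> 'k" where
  "dual_poisson \<delta> f g = (\<lambda>w. \<Sum>i<length w. \<Sum>S\<in>Pow ({..<length w} - {i}).
      \<delta> (w ! i) (\<lambda>y. f (nths (w[i := y]) (insert i S))) (\<lambda>z. g (nths (w[i := z]) (- S))))"

text \<open>The algebra \<open>k[[X\<^sub>0,\<dots>,X\<^sub>n\<^sub>-\<^sub>1]]\<close>: coefficient functions on monomials, a monomial being the
  multiset of its variables.\<close>

definition mps_carrier :: "nat \<Rightarrow> (nat multiset \<Rightarrow> 'k::field) set" where
  "mps_carrier n = {f. \<forall>A. \<not> set_mset A \<subseteq> {..<n} \<longrightarrow> f A = 0}"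

definition mps_mult ::
    "(nat multiset \<Rightarrow> 'k::field) \<Rightarrow> (nat multiset \<Rightarrow> 'k) \<Rightarrow> nat multiset \<Rightarrow> 'k" where
  "mps_mult f g = (\<lambda>A. \<Sum>B | B \<subseteq># A. f B * g (A - B))"

definition mps_monom :: "nat multiset \<Rightarrow> nat multiset \<Rightarrow> 'k::field" where
  "mps_monom A = (\<lambda>B. if B = A then 1 else 0)"

text \<open>\<open>F[\<gg>] \<simeq> k[[\<xi>\<^sub>0,\<dots>,\<xi>\<^sub>n\<^sub>-\<^sub>1]]\<close> as topological algebras, the variables being the given elements.\<close>

definition formal_coordinates ::
    "('k::field \<Rightarrow> 'g::ab_group_add \<Rightarrow> 'g) \<Rightarrow> ('g \<Rightarrow> 'g \<Rightarrow> 'g) \<Rightarrow> nat \<Rightarrow>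
     (nat \<Rightarrow> 'g list \<Rightarrow> 'k) \<Rightarrow> bool" where
  "formal_coordinates sg br n \<xi> \<longleftrightarrow>
     (\<exists>\<Phi>. homeomorphic_map (subtopology pointwise_topology (mps_carrier n)) (dual_topology sg br) \<Phi> \<and>
       (\<forall>f\<in>mps_carrier n. \<forall>g\<in>mps_carrier n.
          \<Phi> (f + g) = \<Phi> f + \<Phi> g \<and> \<Phi> (mps_mult f g) = dual_mult (\<Phi> f) (\<Phi> g)) \<and>
       (\<forall>c. \<forall>f\<in>mps_carrier n. \<Phi> (\<lambda>A. c * f A) = (\<lambda>w. c * \<Phi> f w)) \<and>
       \<Phi> (mps_monom {#}) = dual_one \<and>
       (\<forall>i<n. \<Phi> (mps_monom {#i#}) = \<xi> i))"


section \<open>Topological Hopf algebras over \<open>k[[h]]\<close>\<close>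

text \<open>The variable \<open>h\<close> is \<^const>\<open>fps_X\<close>, and \<^typ>\<open>'k fps\<close> carries its \<open>h\<close>-adic topology.\<close>

definition algebra_over :: "('c::comm_ring_1 \<Rightarrow> 'a::ring_1 \<Rightarrow> 'a) \<Rightarrow> bool" where
  "algebra_over sc \<longleftrightarrow> module sc \<and>
     (\<forall>c a b. sc c (a * b) = sc c a * b \<and> sc c (a * b) = a * sc c b)"

definition pscale :: "'c::comm_ring_1 \<Rightarrow> ('i \<Rightarrow> 'c) \<Rightarrow> 'i \<Rightarrow> 'c" where
  "pscale c t = (\<lambda>i. c * t i)"

text \<open>Topologically free modules are those isomorphic to some product \<open>k[[h]]\<^sup>E\<close> with the product
  topology, and the completed tensor product of \<open>k[[h]]\<^sup>E\<close> and \<open>k[[h]]\<^sup>G\<close> is \<open>k[[h]]\<^sup>E\<^sup>\<times>\<^sup>G\<close>. The module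
  underlying \<open>k[[x\<^sub>1,\<dots>,x\<^sub>n,h]]\<close> is of this kind, with \<open>E\<close> the set of monomials in the \<open>x\<^sub>i\<close>.\<close>

definition top_free ::
    "('k::field_char_0 fps \<Rightarrow> 'f::{ring_1,topological_space} \<Rightarrow> 'f) \<Rightarrow> ('f \<Rightarrow> 'e \<Rightarrow> 'k fps) \<Rightarrow> bool" where
  "top_free sc \<phi> \<longleftrightarrow> module_hom sc pscale \<phi> \<and> homeomorphic_map euclidean euclidean \<phi>"

definition tens :: "('i \<Rightarrow> 'c::comm_ring_1) \<Rightarrow> ('j \<Rightarrow> 'c) \<Rightarrow> 'i \<times> 'j \<Rightarrow> 'c" where
  "tens s t = (\<lambda>(i, j). s i * t j)"

text \<open>\<open>B\<close> is the continuous linear map on the completed tensor square with \<open>B (a \<otimes> b) = \<beta> a b\<close>;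
  it is unique because finite sums of tensors \<open>a \<otimes> b\<close> are dense.\<close>

definition induced_on_tensors ::
    "('k::field_char_0 fps \<Rightarrow> 'x::{ab_group_add,topological_space} \<Rightarrow> 'x) \<Rightarrow>
     ('f \<Rightarrow> 'e \<Rightarrow> 'k fps) \<Rightarrow> ('f \<Rightarrow> 'f \<Rightarrow> 'x) \<Rightarrow> (('e \<times> 'e \<Rightarrow> 'k fps) \<Rightarrow> 'x) \<Rightarrow> bool" where
  "induced_on_tensors s \<phi> \<beta> B \<longleftrightarrow>
     module_hom pscale s B \<and> continuous_on UNIV B \<and> (\<forall>a b. B (tens (\<phi> a) (\<phi> b)) = \<beta> a b)"

locale top_hopf_algebra =
  fixes sc :: "'k::field_char_0 fps \<Rightarrow> 'f::{ring_1,topological_space} \<Rightarrow> 'f"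
    and \<phi> :: "'f \<Rightarrow> 'e \<Rightarrow> 'k fps"
    and \<Delta> :: "'f \<Rightarrow> 'e \<times> 'e \<Rightarrow> 'k fps"
    and \<epsilon> :: "'f \<Rightarrow> 'k fps"
    and S :: "'f \<Rightarrow> 'f"
  assumes algebra: "algebra_over sc"
    and topologically_free: "top_free sc \<phi>"
    and mult_continuous: "\<exists>M. induced_on_tensors sc \<phi> (*) M"
    and comult_linear: "module_hom sc pscale \<Delta>"
    and comult_continuous: "continuous_on UNIV \<Delta>"
    and comult_one: "\<Delta> 1 = tens (\<phi> 1) (\<phi> 1)"
    and comult_mult:
      "\<exists>M. module_hom pscale pscale M \<and> continuous_on UNIV M \<and>
         (\<forall>a b c d. M (tens (tens (\<phi> a) (\<phi> b)) (tens (\<phi> c) (\<phi> d))) = tens (\<phi> (a * c)) (\<phi> (b * d))) \<and>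
         (\<forall>a b. \<Delta> (a * b) = M (tens (\<Delta> a) (\<Delta> b)))"
    and coassoc:
      "\<exists>D1 D2. induced_on_tensors pscale \<phi> (\<lambda>a b. tens (\<Delta> a) (\<phi> b)) D1 \<and>
         induced_on_tensors pscale \<phi> (\<lambda>a b. tens (\<phi> a) (\<Delta> b)) D2 \<and>
         (\<forall>a i j l. D1 (\<Delta> a) ((i, j), l) = D2 (\<Delta> a) (i, (j, l)))"
    and counit_linear: "module_hom sc (*) \<epsilon>"
    and counit_continuous: "continuous_on UNIV \<epsilon>"
    and counit_one: "\<epsilon> 1 = 1"
    and counit_mult: "\<epsilon> (a * b) = \<epsilon> a * \<epsilon> b"
    and counit:
      "\<exists>L R. induced_on_tensors sc \<phi> (\<lambda>a b. sc (\<epsilon> a) b) L \<and>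
         induced_on_tensors sc \<phi> (\<lambda>a b. sc (\<epsilon> b) a) R \<and> (\<forall>a. L (\<Delta> a) = a \<and> R (\<Delta> a) = a)"
    and antipode_linear: "module_hom sc sc S"
    and antipode_continuous: "continuous_on UNIV S"
    and antipode:
      "\<exists>L R. induced_on_tensors sc \<phi> (\<lambda>a b. S a * b) L \<and>
         induced_on_tensors sc \<phi> (\<lambda>a b. a * S b) R \<and>
         (\<forall>a. L (\<Delta> a) = sc (\<epsilon> a) 1 \<and> R (\<Delta> a) = sc (\<epsilon> a) 1)"


section \<open>Quantum formal series Hopf algebras\<close>

text \<open>The isomorphism of topological Poisson Hopf algebras \<open>F\<^sub>h / h F\<^sub>h \<simeq> F[\<gg>]\<close> is given as the map
  \<open>\<pi> : F\<^sub>h \<rightarrow> F[\<gg>]\<close> with kernel \<open>h F\<^sub>h\<close> that induces it; the Poisson bracket of \<open>F\<^sub>h / h F\<^sub>h\<close> is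
  \<open>{a mod h, b mod h} = h\<^sup>-\<^sup>1 [a, b] mod h\<close>, which makes sense since \<open>F\<^sub>h / h F\<^sub>h\<close> is commutative.\<close>

locale qfsha =
  lie_bialgebra sg br \<delta> + top_hopf_algebra sc \<phi> \<Delta> \<epsilon> S
  for sg :: "'k::field_char_0 \<Rightarrow> 'g::ab_group_add \<Rightarrow> 'g"
    and br :: "'g \<Rightarrow> 'g \<Rightarrow> 'g"
    and \<delta> :: "'g \<Rightarrow> ('g \<Rightarrow> 'k) \<Rightarrow> ('g \<Rightarrow> 'k) \<Rightarrow> 'k"
    and sc :: "'k fps \<Rightarrow> 'f::{ring_1,topological_space} \<Rightarrow> 'f"
    and \<phi> :: "'f \<Rightarrow> 'e \<Rightarrow> 'k fps"
    and \<Delta> :: "'f \<Rightarrow> 'e \<times> 'e \<Rightarrow> 'k fps"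
    and \<epsilon> :: "'f \<Rightarrow> 'k fps"
    and S :: "'f \<Rightarrow> 'f" +
  fixes \<pi> :: "'f \<Rightarrow> 'g list \<Rightarrow> 'k"
  assumes proj_quotient_map: "quotient_map euclidean (dual_topology sg br) \<pi>"
    and proj_kernel: "\<pi> a = 0 \<longleftrightarrow> (\<exists>b. a = sc fps_X b)"
    and proj_add: "\<pi> (a + b) = \<pi> a + \<pi> b"
    and proj_scale: "\<pi> (sc c a) = (\<lambda>w. fps_nth c 0 * \<pi> a w)"
    and proj_mult: "\<pi> (a * b) = dual_mult (\<pi> a) (\<pi> b)"
    and proj_one: "\<pi> 1 = dual_one"
    and proj_counit: "fps_nth (\<epsilon> a) 0 = dual_counit (\<pi> a)"
    and proj_coproduct:
      "\<exists>\<pi>2. continuous_map euclidean pointwise_topology \<pi>2 \<and>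
         (\<forall>s t. \<pi>2 (s + t) = \<pi>2 s + \<pi>2 t) \<and>
         (\<forall>c t. \<pi>2 (pscale c t) = (\<lambda>w. fps_nth c 0 * \<pi>2 t w)) \<and>
         (\<forall>a b. \<pi>2 (tens (\<phi> a) (\<phi> b)) = tens (\<pi> a) (\<pi> b)) \<and>
         (\<forall>a. \<pi>2 (\<Delta> a) = dual_coproduct (\<pi> a))"
    and proj_antipode: "\<pi> (S a) = dual_antipode (\<pi> a)"
    and proj_poisson: "a * b - b * a = sc fps_X d \<Longrightarrow> \<pi> d = dual_poisson \<delta> (\<pi> a) (\<pi> b)"

definition counit_ideal :: "('f \<Rightarrow> 'k::field fps) \<Rightarrow> 'f set" where
  "counit_ideal \<epsilon> = {a. fps_X dvd \<epsilon> a}"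


section \<open>The dual quantization \<open>F\<^sub>h\<^sup>\<or>\<close>\<close>

inductive_set generated_subalgebra :: "('c \<Rightarrow> 'a::ring_1 \<Rightarrow> 'a) \<Rightarrow> 'a set \<Rightarrow> 'a set"
  for sc :: "'c \<Rightarrow> 'a \<Rightarrow> 'a" and G :: "'a set" where
  "a \<in> G \<Longrightarrow> a \<in> generated_subalgebra sc G"
| "1 \<in> generated_subalgebra sc G"
| "a \<in> generated_subalgebra sc G \<Longrightarrow> b \<in> generated_subalgebra sc G \<Longrightarrow> a + b \<in> generated_subalgebra sc G"
| "a \<in> generated_subalgebra sc G \<Longrightarrow> b \<in> generated_subalgebra sc G \<Longrightarrow> a * b \<in> generated_subalgebra sc G"
| "a \<in> generated_subalgebra sc G \<Longrightarrow> sc c a \<in> generated_subalgebra sc G"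

text \<open>\<open>k((h)) \<otimes> F\<close> is the localization of \<open>F\<close> at the powers of \<open>h\<close>.\<close>

definition laurent_extension ::
    "('k::field_char_0 fps \<Rightarrow> 'f::ring_1 \<Rightarrow> 'f) \<Rightarrow> ('k fls \<Rightarrow> 'l::ring_1 \<Rightarrow> 'l) \<Rightarrow> ('f \<Rightarrow> 'l) \<Rightarrow> bool" where
  "laurent_extension sc scL \<iota> \<longleftrightarrow>
     algebra_over scL \<and>
     \<iota> 1 = 1 \<and> (\<forall>a b. \<iota> (a + b) = \<iota> a + \<iota> b \<and> \<iota> (a * b) = \<iota> a * \<iota> b) \<and>
     (\<forall>c a. \<iota> (sc c a) = scL (fps_to_fls c) (\<iota> a)) \<and>
     (\<forall>a. \<iota> a = 0 \<longleftrightarrow> (\<exists>m. sc (fps_X ^ m) a = 0)) \<and>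
     (\<forall>l. \<exists>m a. l = scL (fls_X_inv ^ m) (\<iota> a))"

definition F_times ::
    "('k::field_char_0 fls \<Rightarrow> 'l::ring_1 \<Rightarrow> 'l) \<Rightarrow> ('f \<Rightarrow> 'l) \<Rightarrow> ('f \<Rightarrow> 'k fps) \<Rightarrow> 'l set" where
  "F_times scL \<iota> \<epsilon> =
     generated_subalgebra (\<lambda>c. scL (fps_to_fls c)) ((\<lambda>a. scL fls_X_inv (\<iota> a)) ` counit_ideal \<epsilon>)"

text \<open>\<open>U\<close>, with \<open>j : A \<rightarrow> U\<close>, is the \<open>h\<close>-adic completion of the algebra \<open>A\<close>: it is \<open>h\<close>-adically
  separated and complete and \<open>j\<close> induces isomorphisms \<open>A / h\<^sup>N A \<simeq> U / h\<^sup>N U\<close>.\<close>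

definition h_adic_completion ::
    "('k::field_char_0 fps \<Rightarrow> 'l::ring_1 \<Rightarrow> 'l) \<Rightarrow> 'l set \<Rightarrow> ('k fps \<Rightarrow> 'u::ring_1 \<Rightarrow> 'u) \<Rightarrow>
     ('l \<Rightarrow> 'u) \<Rightarrow> bool" where
  "h_adic_completion scA A scU j \<longleftrightarrow>
     algebra_over scU \<and>
     j 1 = 1 \<and> (\<forall>a\<in>A. \<forall>b\<in>A. j (a + b) = j a + j b \<and> j (a * b) = j a * j b) \<and>
     (\<forall>c. \<forall>a\<in>A. j (scA c a) = scU c (j a)) \<and>
     (\<forall>u. (\<forall>N. u \<in> range (scU (fps_X ^ N))) \<longrightarrow> u = 0) \<and>
     (\<forall>s. (\<forall>N. s (Suc N) - s N \<in> range (scU (fps_X ^ N))) \<longrightarrow>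
        (\<exists>u. \<forall>N. u - s N \<in> range (scU (fps_X ^ N)))) \<and>
     (\<forall>N u. \<exists>a\<in>A. u - j a \<in> range (scU (fps_X ^ N))) \<and>
     (\<forall>N. \<forall>a\<in>A. j a \<in> range (scU (fps_X ^ N)) \<longleftrightarrow> a \<in> scA (fps_X ^ N) ` A)"

text \<open>\<open>F\<^sub>h\<^sup>\<or>\<close> and its counit \<open>\<epsilon>U\<close>, the unique extension of \<open>\<epsilon>\<close> to an algebra morphism.\<close>

locale quantum_dual =
  fixes sc :: "'k::field_char_0 fps \<Rightarrow> 'f::ring_1 \<Rightarrow> 'f"
    and \<epsilon> :: "'f \<Rightarrow> 'k fps"
    and scL :: "'k fls \<Rightarrow> 'l::ring_1 \<Rightarrow> 'l"
    and \<iota> :: "'f \<Rightarrow> 'l"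
    and scU :: "'k fps \<Rightarrow> 'u::ring_1 \<Rightarrow> 'u"
    and j :: "'l \<Rightarrow> 'u"
    and \<epsilon>U :: "'u \<Rightarrow> 'k fps"
  assumes laurent: "laurent_extension sc scL \<iota>"
    and completion: "h_adic_completion (\<lambda>c. scL (fps_to_fls c)) (F_times scL \<iota> \<epsilon>) scU j"
    and dual_counit_linear: "module_hom scU (*) \<epsilon>U"
    and dual_counit_one: "\<epsilon>U 1 = 1"
    and dual_counit_mult: "\<epsilon>U (u * v) = \<epsilon>U u * \<epsilon>U v"
    and dual_counit_extends: "\<epsilon>U (j (\<iota> a)) = \<epsilon> a"

text \<open>\<open>C\<close> gives the structure constants of the Lie algebra \<open>\<gg>\<^sup>*\<close> realized as the \<open>k\<close>-span of the
  classes of \<open>y\<^sub>0,\<dots>,y\<^sub>n\<^sub>-\<^sub>1\<close> modulo \<open>h\<close>, the bracket being the commutator, in the basis formed by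
  these classes.\<close>

definition structure_constants_mod_h ::
    "('k::field_char_0 fps \<Rightarrow> 'u::ring_1 \<Rightarrow> 'u) \<Rightarrow> nat \<Rightarrow> (nat \<Rightarrow> 'u) \<Rightarrow>
     (nat \<Rightarrow> nat \<Rightarrow> nat \<Rightarrow> 'k) \<Rightarrow> bool" where
  "structure_constants_mod_h scU n y C \<longleftrightarrow>
     (\<forall>i<n. \<forall>l<n. (y i * y l - y l * y i) - (\<Sum>a<n. scU (fps_const (C i l a)) (y a)) \<in> range (scU fps_X))"

text \<open>\<open>k[y\<^sub>0,\<dots>,y\<^sub>n\<^sub>-\<^sub>1]\<close> inside a noncommutative algebra, by ordered monomials, and
  \<open>k[y\<^sub>0,\<dots>,y\<^sub>n\<^sub>-\<^sub>1][[h]]\<close>, the sums of convergent series \<open>\<Sum>\<^sub>N h\<^sup>N P\<^sub>N\<close>.\<close>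

definition ordered_polys ::
    "('k::field_char_0 fps \<Rightarrow> 'u::ring_1 \<Rightarrow> 'u) \<Rightarrow> nat \<Rightarrow> (nat \<Rightarrow> 'u) \<Rightarrow> 'u set" where
  "ordered_polys scU n y =
     {\<Sum>m\<in>M. scU (fps_const (c m)) (prod_list (map (\<lambda>i. y i ^ m i) [0..<n])) | M c. finite (M :: (nat \<Rightarrow> nat) set)}"

definition ordered_poly_series ::
    "('k::field_char_0 fps \<Rightarrow> 'u::ring_1 \<Rightarrow> 'u) \<Rightarrow> nat \<Rightarrow> (nat \<Rightarrow> 'u) \<Rightarrow> 'u set" where
  "ordered_poly_series scU n y =
     {u. \<exists>P. (\<forall>N. P N \<in> ordered_polys scU n y) \<and>
        (\<forall>M. u - (\<Sum>N<M. scU (fps_X ^ N) (P N)) \<in> range (scU (fps_X ^ M)))}"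


section \<open>Complexes of the form \<open>A \<otimes> \<and>\<^sup>\<bullet> \<gg>\<^sup>*\<close> and resolutions\<close>

text \<open>Given a basis \<open>\<epsilon>\<^sub>0,\<dots>,\<epsilon>\<^sub>n\<^sub>-\<^sub>1\<close> of \<open>\<gg>\<^sup>*\<close>, the left module \<open>A \<otimes> \<and>\<^sup>q \<gg>\<^sup>*\<close> is free on the
  \<open>\<epsilon>\<^sub>p\<^sub>1 \<and> \<dots> \<and> \<epsilon>\<^sub>p\<^sub>q\<close> with \<open>p\<^sub>1 < \<dots> < p\<^sub>q\<close>; its elements are coordinate functions on the
  \<open>q\<close>-element subsets of \<open>{0,\<dots>,n-1}\<close>.\<close>

definition ext_module :: "nat \<Rightarrow> nat \<Rightarrow> (nat set \<Rightarrow> 'a::ring_1) set" where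
  "ext_module n q = {v. \<forall>P. v P \<noteq> 0 \<longrightarrow> P \<subseteq> {..<n} \<and> card P = q}"

definition act :: "'a::ring_1 \<Rightarrow> (nat set \<Rightarrow> 'a) \<Rightarrow> nat set \<Rightarrow> 'a" where
  "act a v = (\<lambda>P. a * v P)"

text \<open>The element \<open>a \<otimes> \<epsilon>\<^sub>p\<^sub>1 \<and> \<dots> \<and> \<epsilon>\<^sub>p\<^sub>q\<close> for an arbitrary sequence of indices.\<close>

definition inversions :: "nat list \<Rightarrow> (nat \<times> nat) set" where
  "inversions p = {(r, s). r < s \<and> s < length p \<and> p ! r > p ! s}"

definition wedge :: "'a::ring_1 \<Rightarrow> nat list \<Rightarrow> nat set \<Rightarrow> 'a" where
  "wedge a p = (\<lambda>P. if distinct p \<and> P = set p then (- 1) ^ card (inversions p) * a else 0)"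

definition words :: "nat \<Rightarrow> nat \<Rightarrow> nat list set" where
  "words n q = {p. set p \<subseteq> {..<n} \<and> length p = q}"

text \<open>The right hand side of a deformed Chevalley-Eilenberg differential at \<open>1 \<otimes> \<epsilon>\<^sub>p\<^sub>1 \<and> \<dots> \<and> \<epsilon>\<^sub>p\<^sub>q\<close>,
  with structure coefficients \<open>c\<close> and correction terms \<open>\<beta>\<close>. Positions are counted from \<open>0\<close>, which turns \<open>(-1)\<^sup>i\<^sup>-\<^sup>1\<close> into \<open>(-1)\<^sup>i\<close> and does not
  change \<open>(-1)\<^sup>r\<^sup>+\<^sup>s\<close>; \<^term>\<open>nths p (- {i})\<close> omits position \<open>i\<close>.\<close>

definition koszul_formula ::
    "nat \<Rightarrow> (nat \<Rightarrow> 'a::ring_1) \<Rightarrow> (nat \<Rightarrow> nat \<Rightarrow> nat \<Rightarrow> 'a) \<Rightarrow> (nat list \<Rightarrow> nat list \<Rightarrow> 'a) \<Rightarrow>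
     nat list \<Rightarrow> nat set \<Rightarrow> 'a" where
  "koszul_formula n y c \<beta> p =
     (\<Sum>i<length p. wedge ((- 1) ^ i * y (p ! i)) (nths p (- {i})))
   + (\<Sum>s<length p. \<Sum>r<s. \<Sum>a<n.
        wedge ((- 1) ^ (r + s) * c (p ! r) (p ! s) a) (a # nths p (- {r, s})))
   + (\<Sum>t\<in>words n (length p - 1). wedge (\<beta> p t) t)"

text \<open>\<open>\<dots> \<rightarrow> A \<otimes> \<and>\<^sup>1 \<gg>\<^sup>* \<rightarrow> A \<otimes> \<and>\<^sup>0 \<gg>\<^sup>* \<rightarrow> k[[h]] \<rightarrow> 0\<close> is an exact sequence of left \<open>A\<close>-modules, where
  \<open>A\<close> acts on \<open>k[[h]]\<close> through its counit \<open>e\<close>. The map \<^term>\<open>d q\<close> goes from degree \<open>q\<close> to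
  degree \<open>q - 1\<close>.\<close>

definition resolution_of_trivial_module ::
    "nat \<Rightarrow> ('a::ring_1 \<Rightarrow> 'k::field fps) \<Rightarrow>
     (nat \<Rightarrow> (nat set \<Rightarrow> 'a) \<Rightarrow> nat set \<Rightarrow> 'a) \<Rightarrow> bool" where
  "resolution_of_trivial_module n e d \<longleftrightarrow>
     (\<forall>q. d (Suc q) ` ext_module n (Suc q) \<subseteq> ext_module n q \<and>
       (\<forall>v\<in>ext_module n (Suc q). \<forall>w\<in>ext_module n (Suc q).
          d (Suc q) (v + w) = d (Suc q) v + d (Suc q) w) \<and>
       (\<forall>a. \<forall>v\<in>ext_module n (Suc q). d (Suc q) (act a v) = act a (d (Suc q) v))) \<and>
     (\<forall>q. {v \<in> ext_module n (Suc q). d (Suc q) v = 0} = d (Suc (Suc q)) ` ext_module n (Suc (Suc q))) \<and>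
     (\<exists>aug. (\<forall>v\<in>ext_module n 0. \<forall>w\<in>ext_module n 0. aug (v + w) = aug v + aug w) \<and>
       (\<forall>a. \<forall>v\<in>ext_module n 0. aug (act a v) = e a * aug v) \<and>
       {v \<in> ext_module n 0. aug v = 0} = d 1 ` ext_module n 1 \<and>
       aug ` ext_module n 0 = UNIV)"

end

theory Submission
  imports Defs
begin

text \<open>Both differentials have the same matrix. A matrix entry \<open>m\<close> over \<open>F\<^sub>h\<close> lies in the augmentation ideal
  \<open>I\<close>, and the corresponding entry over the dual is \<open>h\<^sup>-\<^sup>1 m\<close>. So one complex over \<open>F\<^sub>h\<close> suffices, provided
  that its exactness is strict: a cycle with entries in \<open>I\<^sup>r\<close> bounds a chain with entries in \<open>I\<^sup>r\<^sup>-\<^sup>1\<close>.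
  Strictness follows from the Koszul complex over \<open>F\<^sub>h / h F\<^sub>h = k[[x\<^sub>1,\<dots>,x\<^sub>n]]\<close>, which has a homogeneous
  contracting homotopy, together with \<open>I\<^sup>r\<^sup>+\<^sup>1 \<inter> h F\<^sub>h = h I\<^sup>r\<close> and \<open>h\<close>-adic completeness. It also yields the
  corrections \<open>\<alpha>\<close>, degree by degree: applying the differential to the uncorrected Chevalley-Eilenberg
  value gives \<open>h R\<close> with \<open>R\<close> a cycle with entries in \<open>I\<^sup>2\<close>, so that \<open>R\<close> bounds a chain with entries in \<open>I\<close>.
  Every element of \<open>\<Union>\<^sub>m h\<^sup>-\<^sup>m I\<^sup>m\<close> is \<open>h\<^sup>-\<^sup>m b\<close> with \<open>b \<in> I\<^sup>m\<close>, hence the complex over this algebra is exact as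
  well, and exactness passes to the completion.\<close>

section \<open>Exterior algebra operators\<close>

text \<open>The corrections have to lie in \<open>I\<close>, since only then do they become
  multiples of \<open>h\<close> in the dual. Strict exactness costs one level, because the homotopy
  trades a variable for an exterior generator; so \<open>R\<close> must be in \<open>I^2\<close>,
  and the bound \<open>I\<close> would not do. What the dual modulo \<open>h\<close> says about
  commutators is exactly what this requires: \<open>h^-1 [x_i, x_l]\<close> equals the linear form
  given by the structure constants modulo \<open>I^2\<close>. The Koszul part and the bracket part
  cancel these linear forms and leave terms in \<open>I^2\<close>. The one further term of
  \<open>R\<close> is \<open>h\<close> times the square of the bracket operator, a chain with
  entries in \<open>k\<close> and so known a priori only to give a term in \<open>I\<close>; the
  cycle condition on \<open>R\<close> forces it to vanish. The lost level is matched by the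
  differential, all of whose entries are in \<open>I\<close>: a cycle \<open>h^-m b\<close> over the
  dual, with \<open>b\<close> in \<open>I^m\<close>, has a primitive with denominator
  \<open>h^(m-1)\<close>, which is again an element of the dual.\<close>

definition npar :: "nat \<Rightarrow> nat set \<Rightarrow> bool" where
  "npar i P \<longleftrightarrow> odd (card {p \<in> P. p < i})"

definition wedge_op :: "nat \<Rightarrow> (nat set \<Rightarrow> 'a::ring_1) \<Rightarrow> nat set \<Rightarrow> 'a" where
  "wedge_op i v = (\<lambda>P. if i \<in> P then (if npar i P then - v (P - {i}) else v (P - {i})) else 0)"

definition contract :: "nat \<Rightarrow> (nat set \<Rightarrow> 'a::ring_1) \<Rightarrow> nat set \<Rightarrow> 'a" where
  "contract i v = (\<lambda>P. if i \<notin> P then (if npar i P then - v (insert i P) else v (insert i P)) else 0)"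

text \<open>Maps of left modules multiply coefficients from the right, hence a separate operation
  besides \<open>act\<close>.\<close>

definition rmul :: "(nat set \<Rightarrow> 'a::ring_1) \<Rightarrow> 'a \<Rightarrow> nat set \<Rightarrow> 'a" where
  "rmul v x = (\<lambda>P. v P * x)"

lemma npar_insert: "l \<notin> P \<Longrightarrow> npar i (insert l P) \<longleftrightarrow> (npar i P \<noteq> (l < i))"
proof -
  assume l: "l \<notin> P"
  have "{p \<in> insert l P. p < i} = (if l < i then insert l {p \<in> P. p < i} else {p \<in> P. p < i})"
    by auto
  moreover have "finite {p \<in> P. p < i}" by (rule finite_subset[of _ "{..<i}"]) auto
  ultimately show ?thesis using l by (auto simp: npar_def)
qed

lemma npar_insert_self [simp]: "npar i (insert i P) = npar i P"
  unfolding npar_def by (rule arg_cong[of _ _ "\<lambda>A. odd (card A)"]) auto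

lemma npar_remove: "l \<in> P \<Longrightarrow> npar i (P - {l}) \<longleftrightarrow> (npar i P \<noteq> (l < i))"
  using npar_insert[of l "P - {l}" i] by (simp add: insert_absorb) blast

lemma npar_empty [simp]: "\<not> npar i {}"
  by (simp add: npar_def)

lemma npar_Min: "(\<And>p. p \<in> P \<Longrightarrow> i \<le> p) \<Longrightarrow> \<not> npar i P"
proof -
  assume "\<And>p. p \<in> P \<Longrightarrow> i \<le> p"
  then have "{p \<in> P. p < i} = {}" by fastforce
  then show ?thesis unfolding npar_def by (metis card.empty even_zero)
qed

lemma contract_contract: "contract i (contract l v) = - contract l (contract i v)"
  by (rule ext) (auto simp: contract_def npar_insert insert_commute)

lemma contract_self [simp]: "contract i (contract i v) = 0"
  by (rule ext) (auto simp: contract_def)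

lemma wedge_op_wedge_op: "wedge_op i (wedge_op l v) = - wedge_op l (wedge_op i v)"
proof (rule ext)
  fix P
  have "P - {i} - {l} = P - {l} - {i}" by auto
  then show "wedge_op i (wedge_op l v) P = (- wedge_op l (wedge_op i v)) P"
    by (auto simp: wedge_op_def npar_remove)
qed

text \<open>Together with \<open>contract_contract\<close> and \<open>wedge_op_wedge_op\<close>
  these are the Clifford relations; the signs in the Koszul and bracket operators are computed from
  them and not from inversion counts.\<close>

lemma contract_wedge_op:
  "contract i (wedge_op l v) = (if i = l then v else 0) - wedge_op l (contract i v)"
proof (rule ext)
  fix P
  have "i \<noteq> l \<Longrightarrow> insert i P - {l} = insert i (P - {l})" by auto
  moreover have "insert i (P - {i}) = P" if "i \<in> P" using that by auto
  ultimately show "contract i (wedge_op l v) P = ((if i = l then v else 0) - wedge_op l (contract i v)) P"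
    by (auto simp: wedge_op_def contract_def npar_remove npar_insert insert_absorb)
qed

lemma sum_fun_apply: "(\<Sum>i\<in>A. f i) x = (\<Sum>i\<in>A. f i x)" for f :: "_ \<Rightarrow> _ \<Rightarrow> _::comm_monoid_add"
  by (induction A rule: infinite_finite_induct) auto

lemma contract_add: "contract i (v + w) = contract i v + contract i w"
  and contract_uminus: "contract i (- v) = - contract i v"
  and contract_diff: "contract i (v - w) = contract i v - contract i w"
  and contract_zero [simp]: "contract i 0 = 0"
  and contract_rmul: "contract i (rmul v a) = rmul (contract i v) a"
  and contract_act: "contract i (act a v) = act a (contract i v)"
  by (auto simp: contract_def rmul_def act_def fun_eq_iff)

lemma wedge_op_add: "wedge_op i (v + w) = wedge_op i v + wedge_op i w"
  and wedge_op_uminus: "wedge_op i (- v) = - wedge_op i v"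
  and wedge_op_diff: "wedge_op i (v - w) = wedge_op i v - wedge_op i w"
  and wedge_op_zero [simp]: "wedge_op i 0 = 0"
  and wedge_op_rmul: "wedge_op i (rmul v a) = rmul (wedge_op i v) a"
  and wedge_op_act: "wedge_op i (act a v) = act a (wedge_op i v)"
  by (auto simp: wedge_op_def rmul_def act_def fun_eq_iff)

lemma rmul_add: "rmul (v + w) a = rmul v a + rmul w a"
  and rmul_zero [simp]: "rmul 0 a = 0"
  and rmul_rmul: "rmul (rmul v a) b = rmul v (a * b)"
  and rmul_act: "rmul (act c v) a = act c (rmul v a)"
  and rmul_add_right: "rmul v (a + b) = rmul v a + rmul v b"
  and rmul_diff_right: "rmul v (a - b) = rmul v a - rmul v b"
  and rmul_uminus_right: "rmul v (- a) = - rmul v a"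
  and rmul_zero_right [simp]: "rmul v 0 = 0"
  by (auto simp: rmul_def act_def fun_eq_iff algebra_simps)

lemma contract_sum: "contract i (\<Sum>k\<in>A. v k) = (\<Sum>k\<in>A. contract i (v k))"
  by (induction A rule: infinite_finite_induct)
    (simp_all only: sum.infinite sum.empty sum.insert not_False_eq_True contract_zero contract_add)

lemma wedge_op_sum: "wedge_op i (\<Sum>k\<in>A. v k) = (\<Sum>k\<in>A. wedge_op i (v k))"
  by (induction A rule: infinite_finite_induct)
    (simp_all only: sum.infinite sum.empty sum.insert not_False_eq_True wedge_op_zero wedge_op_add)

lemma rmul_sum: "rmul (\<Sum>k\<in>A. v k) a = (\<Sum>k\<in>A. rmul (v k) a)"
  by (induction A rule: infinite_finite_induct)
    (simp_all only: sum.infinite sum.empty sum.insert not_False_eq_True rmul_zero rmul_add)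

lemma rmul_sum_right: "rmul v (\<Sum>k\<in>A. a k) = (\<Sum>k\<in>A. rmul v (a k))"
  by (induction A rule: infinite_finite_induct)
    (simp_all only: sum.infinite sum.empty sum.insert not_False_eq_True rmul_zero_right rmul_add_right)

lemma act_add: "act a (v + w) = act a v + act a w"
  and act_uminus: "act a (- v) = - act a v"
  and act_zero [simp]: "act a 0 = 0"
  and act_one [simp]: "act 1 v = v"
  and act_act: "act a (act b v) = act (a * b) v"
  by (auto simp: act_def fun_eq_iff algebra_simps)

lemma act_sum: "act a (\<Sum>k\<in>A. v k) = (\<Sum>k\<in>A. act a (v k))"
  by (induction A rule: infinite_finite_induct)
    (simp_all only: sum.infinite sum.empty sum.insert not_False_eq_True act_zero act_add)

section \<open>Signs of words\<close>

lemma inversions_Cons: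
  "inversions (i # p) = (\<lambda>s. (0, Suc s)) ` {s. s < length p \<and> p ! s < i} \<union>
     (\<lambda>(r, s). (Suc r, Suc s)) ` inversions p" (is "_ = ?A \<union> ?B")
proof (intro set_eqI iffI)
  fix z assume "z \<in> inversions (i # p)"
  then obtain r s where z: "z = (r, s)" "r < s" "s < Suc (length p)" "(i # p) ! r > (i # p) ! s"
    by (auto simp: inversions_def)
  then obtain s' where s: "s = Suc s'" by (cases s) auto
  show "z \<in> ?A \<union> ?B"
  proof (cases r)
    case 0
    then show ?thesis using z s by auto
  next
    case (Suc r')
    then have "(r', s') \<in> inversions p" using z s by (auto simp: inversions_def)
    then show ?thesis using z s Suc by force
  qed
qed (auto simp: inversions_def)

lemma finite_inversions [simp]: "finite (inversions p)"
  by (rule finite_subset[of _ "{..<length p} \<times> {..<length p}"]) (auto simp: inversions_def)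

lemma wedge_Nil: "wedge a [] = (\<lambda>P. if P = {} then a else 0)"
  by (auto simp: wedge_def inversions_def fun_eq_iff)

text \<open>Inversions that involve the first position count the letters of \<open>p\<close> below
  \<open>i\<close>, whose parity is recorded by \<open>npar i\<close>. The rule opens formulas on
  words to induction on the word.\<close>

lemma wedge_Cons: "wedge a (i # p) = wedge_op i (wedge a p)"
proof (cases "distinct p")
  case False
  then show ?thesis by (auto simp: wedge_def wedge_op_def fun_eq_iff)
next
  case True
  have b: "bij_betw (\<lambda>s. p ! s) {s. s < length p \<and> p ! s < i} {q \<in> set p. q < i}"
    unfolding bij_betw_def using True
    by (auto simp: inj_on_def nth_eq_iff_index_eq in_set_conv_nth image_iff)
  have "card ((\<lambda>(r, s). (Suc r, Suc s)) ` inversions p) = card (inversions p)"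
    by (rule card_image) (auto simp: inj_on_def)
  moreover have "card ((\<lambda>s. (0::nat, Suc s)) ` {s. s < length p \<and> p ! s < i}) = card {s. s < length p \<and> p ! s < i}"
    by (rule card_image) (auto simp: inj_on_def)
  moreover have "card (inversions (i # p)) = card ((\<lambda>s. (0::nat, Suc s)) ` {s. s < length p \<and> p ! s < i})
      + card ((\<lambda>(r, s). (Suc r, Suc s)) ` inversions p)"
    unfolding inversions_Cons by (rule card_Un_disjoint) auto
  ultimately have "card (inversions (i # p)) = card {s. s < length p \<and> p ! s < i} + card (inversions p)"
    by simp
  then have c: "card (inversions (i # p)) = card {q \<in> set p. q < i} + card (inversions p)"
    using bij_betw_same_card[OF b] by simp
  have "npar i (insert i (set p)) \<longleftrightarrow> odd (card {q \<in> set p. q < i})"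
    unfolding npar_def by (rule arg_cong[of _ _ "\<lambda>A. odd (card A)"]) auto
  then have d: "npar i (set p) \<longleftrightarrow> odd (card {q \<in> set p. q < i})"
    by (simp only: npar_insert_self)
  define m where "m = card {q \<in> set p. q < i}"
  define k where "k = card (inversions p)"
  show ?thesis
  proof (rule ext)
    fix P
    show "wedge a (i # p) P = wedge_op i (wedge a p) P"
    proof (cases "i \<notin> set p \<and> P = insert i (set p)")
      case True
      then have r: "insert i (set p) - {i} = set p" by auto
      show ?thesis using True \<open>distinct p\<close> c d r
        unfolding m_def[symmetric] k_def[symmetric]
        by (cases "even m") (simp_all add: wedge_def wedge_op_def power_add m_def k_def)
    next
      case False
      then have "\<not> (i \<in> P \<and> P - {i} = set p)" by auto
      then show ?thesis using False by (auto simp: wedge_def wedge_op_def)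
    qed
  qed
qed

lemma wedge_rmul: "wedge a p = rmul (wedge 1 p) a"
  by (auto simp: wedge_def rmul_def fun_eq_iff)

lemma wedge_uminus: "wedge (- a) p = - wedge a p"
  by (auto simp: wedge_def fun_eq_iff)

lemma wedge_zero [simp]: "wedge 0 p = 0"
  by (auto simp: wedge_def fun_eq_iff)

section \<open>The leading terms of the differential as operators\<close>

lemma nths_remove_0: "nths (i # p) (- {0}) = p"
proof -
  have "{j. Suc j \<in> - {0}} = UNIV" by auto
  then show ?thesis by (simp add: nths_Cons nths_all)
qed

lemma nths_remove_Suc: "nths (i # p) (- {Suc r}) = i # nths p (- {r})"
proof -
  have "{j. Suc j \<in> - {Suc r}} = - {r}" by auto
  then show ?thesis by (simp add: nths_Cons)
qed

lemma nths_remove_0_Suc: "nths (i # p) (- {0, Suc s}) = nths p (- {s})"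
proof -
  have "{j. Suc j \<in> - {0, Suc s}} = - {s}" by auto
  then show ?thesis by (simp add: nths_Cons)
qed

lemma nths_remove_Suc_Suc: "nths (i # p) (- {Suc r, Suc s}) = i # nths p (- {r, s})"
proof -
  have "{j. Suc j \<in> - {Suc r, Suc s}} = - {r, s}" by auto
  then show ?thesis by (simp add: nths_Cons)
qed

definition koszul_op :: "nat \<Rightarrow> (nat \<Rightarrow> 'a::ring_1) \<Rightarrow> (nat set \<Rightarrow> 'a) \<Rightarrow> nat set \<Rightarrow> 'a" where
  "koszul_op n y v = (\<Sum>i<n. contract i (rmul v (y i)))"

text \<open>The Chevalley-Eilenberg term. Removing \<open>l\<close> before \<open>i\<close> gives -1
  on \<open>wedge 1 [i, l]\<close> for \<open>i < l\<close>, which is the sign of the formula. The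
  sum runs over ordered pairs of indices, while the formula runs over pairs of positions;
  antisymmetry of \<open>c\<close> reconciles the two.\<close>

definition bracket_op ::
    "nat \<Rightarrow> (nat \<Rightarrow> nat \<Rightarrow> nat \<Rightarrow> 'a::ring_1) \<Rightarrow> (nat set \<Rightarrow> 'a) \<Rightarrow> nat set \<Rightarrow> 'a" where
  "bracket_op n c v =
     (\<Sum>l<n. \<Sum>i<l. \<Sum>a<n. wedge_op a (contract i (contract l (rmul v (c i l a)))))"

lemma koszul_op_add: "koszul_op n y (v + w) = koszul_op n y v + koszul_op n y w"
  by (simp add: koszul_op_def rmul_add contract_add sum.distrib)
lemma koszul_op_act: "koszul_op n y (act a v) = act a (koszul_op n y v)"
  by (simp add: koszul_op_def rmul_act contract_act act_sum)
lemma bracket_op_add: "bracket_op n c (v + w) = bracket_op n c v + bracket_op n c w"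
  by (simp add: bracket_op_def rmul_add contract_add wedge_op_add sum.distrib)
lemma bracket_op_act: "bracket_op n c (act a v) = act a (bracket_op n c v)"
  by (simp add: bracket_op_def rmul_act contract_act wedge_op_act act_sum)

lemma contract_vac: "contract i (\<lambda>P. if P = {} then a else 0) = 0"
  by (auto simp: contract_def fun_eq_iff)

text \<open>The relation \<open>contract_wedge_op\<close>, summed: the first letter is either
  removed or passed over with a sign.\<close>

lemma koszul_op_wedge_op:
  assumes "i < n"
  shows "koszul_op n y (wedge_op i v) = rmul v (y i) - wedge_op i (koszul_op n y v)"
proof -
  have "koszul_op n y (wedge_op i v)
      = (\<Sum>l<n. (if l = i then rmul v (y l) else 0) - wedge_op i (contract l (rmul v (y l))))"
    unfolding koszul_op_def
    by (intro sum.cong refl) (auto simp: wedge_op_rmul[symmetric] contract_wedge_op)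
  also have "\<dots> = rmul v (y i) - wedge_op i (koszul_op n y v)"
    using assms by (simp add: sum_subtractf koszul_op_def wedge_op_sum)
  finally show ?thesis .
qed

lemma koszul_op_wedge:
  assumes "set p \<subseteq> {..<n}"
  shows "koszul_op n y (wedge 1 p) = (\<Sum>i<length p. wedge ((- 1) ^ i * y (p ! i)) (nths p (- {i})))"
  using assms
proof (induction p)
  case Nil
  show ?case by (simp add: koszul_op_def contract_rmul wedge_Nil contract_vac)
next
  case (Cons i p)
  have "(\<Sum>k<length (i # p). wedge ((- 1) ^ k * y ((i # p) ! k)) (nths (i # p) (- {k})))
      = wedge (y i) p + (\<Sum>k<length p. wedge_op i (wedge (- ((- 1) ^ k * y (p ! k))) (nths p (- {k}))))"
    by (simp add: sum.lessThan_Suc_shift nths_remove_0 nths_remove_Suc wedge_Cons del: sum.lessThan_Suc)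
  also have "\<dots> = wedge (y i) p - wedge_op i (koszul_op n y (wedge 1 p))"
    using Cons by (simp add: wedge_uminus wedge_op_uminus sum_negf wedge_op_sum)
  also have "\<dots> = koszul_op n y (wedge 1 (i # p))"
    using Cons.prems by (simp add: wedge_Cons koszul_op_wedge_op wedge_rmul[symmetric])
  finally show ?case ..
qed

text \<open>Either the leading letter \<open>i\<close> is one of the two contracted letters, or it
  passes both contractions without a sign and \<open>wedge_op a\<close> with one. Pairs below and
  above \<open>i\<close> combine into a single sum by antisymmetry, and \<open>c i i a = 0\<close>
  supplies the diagonal; in a ring with 2-torsion the second condition does not follow from the
  first.\<close>

lemma bracket_op_wedge_op:
  assumes i: "i < n" and alt: "\<And>i l a. i < n \<Longrightarrow> l < n \<Longrightarrow> a < n \<Longrightarrow> c i l a = - c l i a"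
    and alt0: "\<And>i a. i < n \<Longrightarrow> a < n \<Longrightarrow> c i i a = 0"
  shows "bracket_op n c (wedge_op i v) =
     - (\<Sum>l<n. \<Sum>a<n. wedge_op a (contract l (rmul v (c i l a)))) - wedge_op i (bracket_op n c v)"
proof -
  let ?w = "\<lambda>j l a u. wedge_op a (contract j (rmul v (c u l a)))"
  have gg: "contract j (contract l (wedge_op i w)) =
      (if l = i then contract j w else 0) - (if j = i then contract l w else 0)
        + wedge_op i (contract j (contract l w))" for j l and w :: "nat set \<Rightarrow> 'a"
    by (auto simp: contract_wedge_op contract_diff)
  have *: "bracket_op n c (wedge_op i v) =
     (\<Sum>l<n. \<Sum>j<l. \<Sum>a<n.
        (if l = i then wedge_op a (contract j (rmul v (c j i a))) else 0)
        - (if j = i then wedge_op a (contract l (rmul v (c i l a))) else 0)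
        - wedge_op i (wedge_op a (contract j (contract l (rmul v (c j l a))))))"
    unfolding bracket_op_def
    by (intro sum.cong refl)
      (auto simp: wedge_op_rmul[symmetric] gg wedge_op_add wedge_op_diff wedge_op_uminus wedge_op_wedge_op[of _ i])
  have s1: "(\<Sum>l<n. \<Sum>j<l. \<Sum>a<n. (if l = i then wedge_op a (contract j (rmul v (c j i a))) else 0))
     = (\<Sum>l<i. \<Sum>a<n. - wedge_op a (contract l (rmul v (c i l a))))"
  proof -
    have "(\<Sum>l<n. \<Sum>j<l. \<Sum>a<n. (if l = i then wedge_op a (contract j (rmul v (c j i a))) else 0))
      = (\<Sum>l<n. if l = i then (\<Sum>j<l. \<Sum>a<n. wedge_op a (contract j (rmul v (c j i a)))) else 0)"
      by (intro sum.cong refl) auto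
    also have "\<dots> = (\<Sum>j<i. \<Sum>a<n. wedge_op a (contract j (rmul v (c j i a))))"
      using i by simp
    also have "\<dots> = (\<Sum>l<i. \<Sum>a<n. - wedge_op a (contract l (rmul v (c i l a))))"
    proof (intro sum.cong refl)
      fix j a assume "j \<in> {..<i}" "a \<in> {..<n}"
      then have "c j i a = - c i j a" using alt[of j i a] i by auto
      then show "wedge_op a (contract j (rmul v (c j i a))) = - wedge_op a (contract j (rmul v (c i j a)))"
        by (simp add: rmul_uminus_right contract_uminus wedge_op_uminus)
    qed
    finally show ?thesis .
  qed
  have s2: "(\<Sum>l<n. \<Sum>j<l. \<Sum>a<n. (if j = i then wedge_op a (contract l (rmul v (c i l a))) else 0))
     = (\<Sum>l\<in>{i<..<n}. \<Sum>a<n. wedge_op a (contract l (rmul v (c i l a))))"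
  proof -
    have "(\<Sum>l<n. \<Sum>j<l. \<Sum>a<n. (if j = i then wedge_op a (contract l (rmul v (c i l a))) else 0))
      = (\<Sum>l<n. \<Sum>j<l. (if j = i then \<Sum>a<n. wedge_op a (contract l (rmul v (c i l a))) else 0))"
      by (intro sum.cong refl) auto
    also have "\<dots> = (\<Sum>l<n. if i < l then \<Sum>a<n. wedge_op a (contract l (rmul v (c i l a))) else 0)"
      by (intro sum.cong refl) auto
    also have "\<dots> = (\<Sum>l\<in>{l\<in>{..<n}. i < l}. \<Sum>a<n. wedge_op a (contract l (rmul v (c i l a))))"
      by (rule sum.inter_filter[symmetric]) simp
    also have "{l\<in>{..<n}. i < l} = {i<..<n}" by auto
    finally show ?thesis .
  qed
  define f where "f l = (\<Sum>a<n. wedge_op a (contract l (rmul v (c i l a))))" for l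
  have "{..<n} = {..<i} \<union> {i} \<union> {i<..<n}" using i by auto
  then have "sum f {..<n} = sum f ({..<i} \<union> {i} \<union> {i<..<n})" by (rule arg_cong)
  also have "\<dots> = sum f {..<i} + f i + sum f {i<..<n}"
  proof -
    have "sum f ({..<i} \<union> {i} \<union> {i<..<n}) = sum f ({..<i} \<union> {i}) + sum f {i<..<n}"
      by (rule sum.union_disjoint) auto
    also have "sum f ({..<i} \<union> {i}) = sum f {..<i} + sum f {i}"
      by (rule sum.union_disjoint) auto
    also have "sum f {i} = f i" by simp
    finally show ?thesis .
  qed
  also have "f i = 0"
    using alt0[OF i] by (simp add: f_def)
  finally have "sum f {..<n} = sum f {..<i} + sum f {i<..<n}"
    by (simp only: add_0_right)
  note s3 = this[unfolded f_def]
  show ?thesis unfolding * s3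
    by (simp only: sum_subtractf s1 s2)
      (simp only: sum_negf bracket_op_def wedge_op_sum minus_add_distrib diff_conv_add_uminus)
qed

lemma bracket_op_wedge:
  assumes p: "set p \<subseteq> {..<n}"
    and alt: "\<And>i l a. i < n \<Longrightarrow> l < n \<Longrightarrow> a < n \<Longrightarrow> c i l a = - c l i a"
    and alt0: "\<And>i a. i < n \<Longrightarrow> a < n \<Longrightarrow> c i i a = 0"
  shows "bracket_op n c (wedge 1 p) = (\<Sum>s<length p. \<Sum>r<s. \<Sum>a<n.
        wedge ((- 1) ^ (r + s) * c (p ! r) (p ! s) a) (a # nths p (- {r, s})))"
  using p
proof (induction p)
  case Nil
  show ?case by (simp add: bracket_op_def contract_rmul wedge_Nil contract_vac)
next
  case (Cons i p)
  have i: "i < n" using Cons by auto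
  \<comment> \<open>For fixed \<open>a\<close> the single contractions form a Koszul operator with
    coefficients \<open>c i l a\<close>, so \<open>koszul_op_wedge\<close> applies.\<close>
  have k: "(\<Sum>l<n. \<Sum>a<n. wedge_op a (contract l (rmul (wedge 1 p) (c i l a)))) =
     (\<Sum>s<length p. \<Sum>a<n. wedge ((- 1) ^ s * c i (p ! s) a) (a # nths p (- {s})))"
  proof -
    have "(\<Sum>l<n. \<Sum>a<n. wedge_op a (contract l (rmul (wedge 1 p) (c i l a)))) =
       (\<Sum>a<n. wedge_op a (koszul_op n (\<lambda>l. c i l a) (wedge 1 p)))"
      by (subst sum.swap) (simp add: koszul_op_def wedge_op_sum)
    also have "\<dots> = (\<Sum>a<n. \<Sum>s<length p. wedge ((- 1) ^ s * c i (p ! s) a) (a # nths p (- {s})))"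
      using Cons.prems by (simp only: koszul_op_wedge wedge_op_sum wedge_Cons list.set insert_subset)
    also have "\<dots> = (\<Sum>s<length p. \<Sum>a<n. wedge ((- 1) ^ s * c i (p ! s) a) (a # nths p (- {s})))"
      by (rule sum.swap)
    finally show ?thesis .
  qed
  have "(\<Sum>s<length (i # p). \<Sum>r<s. \<Sum>a<n.
        wedge ((- 1) ^ (r + s) * c ((i # p) ! r) ((i # p) ! s) a) (a # nths (i # p) (- {r, s})))
     = (\<Sum>s<length p. (\<Sum>a<n. wedge (- ((- 1) ^ s * c i (p ! s) a)) (a # nths p (- {s})))
         + (\<Sum>r<s. \<Sum>a<n. wedge ((- 1) ^ (r + s) * c (p ! r) (p ! s) a) (a # i # nths p (- {r, s}))))"
  proof -
    have sg: "(- 1) ^ Suc s * b = - ((- 1) ^ s * b)" "(- 1) ^ (Suc r + Suc s) * b = (- 1) ^ (r + s) * b"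
      for r s and b :: 'a
      by simp_all
    show ?thesis
      by (simp only: length_Cons sum.lessThan_Suc_shift nths_remove_0_Suc nths_remove_Suc_Suc
        nth_Cons_0 nth_Cons_Suc sg lessThan_0 sum.empty add_0_left)
  qed
  also have "\<dots> = - (\<Sum>s<length p. \<Sum>a<n. wedge ((- 1) ^ s * c i (p ! s) a) (a # nths p (- {s})))
       - wedge_op i (\<Sum>s<length p. \<Sum>r<s. \<Sum>a<n.
          wedge ((- 1) ^ (r + s) * c (p ! r) (p ! s) a) (a # nths p (- {r, s})))"
    by (simp only: wedge_uminus wedge_op_uminus sum_negf sum.distrib wedge_op_sum wedge_Cons
      wedge_op_wedge_op[of _ i] diff_conv_add_uminus)
  also have "\<dots> = bracket_op n c (wedge 1 (i # p))"
  proof -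
    have b: "bracket_op n c (wedge_op i (wedge 1 p)) =
      - (\<Sum>l<n. \<Sum>a<n. wedge_op a (contract l (rmul (wedge 1 p) (c i l a)))) - wedge_op i (bracket_op n c (wedge 1 p))"
      by (rule bracket_op_wedge_op[OF i]) (fact alt, fact alt0)
    have IH: "bracket_op n c (wedge 1 p) = (\<Sum>s<length p. \<Sum>r<s. \<Sum>a<n.
        wedge ((- 1) ^ (r + s) * c (p ! r) (p ! s) a) (a # nths p (- {r, s})))"
      by (rule Cons.IH) (use Cons.prems in auto)
    show ?thesis
      unfolding wedge_Cons[of 1] b k IH ..
  qed
  finally show ?case by (rule sym)
qed

text \<open>Contractions anticommute, so the terms at \<open>(l, i)\<close> and
  \<open>(i, l)\<close> combine into a commutator and the diagonal vanishes. Over a noncommutative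
  ring the operator is a differential only up to these commutators.\<close>

lemma koszul_op_koszul_op:
  "koszul_op n y (koszul_op n y v) =
     (\<Sum>l<n. \<Sum>i<l. contract l (contract i (rmul v (y i * y l - y l * y i))))"
proof -
  let ?f = "\<lambda>l i. contract l (contract i (rmul v (y i * y l)))"
  have "koszul_op n y (koszul_op n y v) = (\<Sum>l<n. \<Sum>i<n. ?f l i)"
    by (simp add: koszul_op_def rmul_sum contract_sum contract_rmul rmul_rmul)
  also have "\<dots> = (\<Sum>l<n. (\<Sum>i<l. ?f l i) + (\<Sum>i\<in>{l<..<n}. ?f l i))"
  proof (intro sum.cong refl)
    fix l assume "l \<in> {..<n}"
    then have "{..<n} = {..<l} \<union> {l} \<union> {l<..<n}" by auto
    then have "(\<Sum>i<n. ?f l i) = (\<Sum>i\<in>{..<l} \<union> {l} \<union> {l<..<n}. ?f l i)" by simp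
    also have "\<dots> = (\<Sum>i<l. ?f l i) + (\<Sum>i\<in>{l<..<n}. ?f l i)"
      by (subst sum.union_disjoint) auto
    finally show "(\<Sum>i<n. ?f l i) = (\<Sum>i<l. ?f l i) + (\<Sum>i\<in>{l<..<n}. ?f l i)" .
  qed
  also have "\<dots> = (\<Sum>l<n. \<Sum>i<l. ?f l i) + (\<Sum>l<n. \<Sum>i\<in>{l<..<n}. ?f l i)"
    by (rule sum.distrib)
  also have "(\<Sum>l<n. \<Sum>i\<in>{l<..<n}. ?f l i) = (\<Sum>i<n. \<Sum>l<i. ?f l i)"
    unfolding sum.Sigma[OF finite_lessThan ballI[OF finite_lessThan]]
     sum.Sigma[OF finite_lessThan ballI[OF finite_greaterThanLessThan]]
    by (rule sum.reindex_bij_witness[of _ "\<lambda>(a,b). (b,a)" "\<lambda>(a,b). (b,a)"]) auto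
  also have "\<dots> = (\<Sum>l<n. \<Sum>i<l. - contract l (contract i (rmul v (y l * y i))))"
    by (intro sum.cong refl) (rule contract_contract)
  also have "(\<Sum>l<n. \<Sum>i<l. ?f l i) + (\<Sum>l<n. \<Sum>i<l. - contract l (contract i (rmul v (y l * y i))))
     = (\<Sum>l<n. \<Sum>i<l. contract l (contract i (rmul v (y i * y l - y l * y i))))"
    by (simp add: sum.distrib[symmetric] rmul_diff_right contract_diff)
  finally show ?thesis .
qed

text \<open>A contraction passes the two contractions of a bracket term without a sign and
  anticommutes with \<open>wedge_op a\<close> up to a Kronecker delta; only the terms with
  \<open>m = a\<close> survive.\<close>

lemma koszul_bracket_anticommutator:
  assumes "\<And>i l a m. i < n \<Longrightarrow> l < n \<Longrightarrow> a < n \<Longrightarrow> m < n \<Longrightarrow> y m * c i l a = c i l a * y m"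
  shows "koszul_op n y (bracket_op n c v) + bracket_op n c (koszul_op n y v) =
     (\<Sum>l<n. \<Sum>i<l. contract i (contract l (rmul v (\<Sum>a<n. c i l a * y a))))"
proof -
  let ?r = "\<lambda>m i l a. rmul v (c i l a * y m)"
  have 1: "koszul_op n y (bracket_op n c v) =
     (\<Sum>l<n. \<Sum>i<l. \<Sum>a<n. \<Sum>m<n. contract m (wedge_op a (contract i (contract l (?r m i l a)))))"
  proof -
    have "koszul_op n y (bracket_op n c v) =
      (\<Sum>m<n. \<Sum>l<n. \<Sum>i<l. \<Sum>a<n. contract m (wedge_op a (contract i (contract l (?r m i l a)))))"
      by (simp add: koszul_op_def bracket_op_def rmul_sum contract_sum wedge_op_rmul contract_rmul rmul_rmul)
    also have "\<dots> = (\<Sum>l<n. \<Sum>m<n. \<Sum>i<l. \<Sum>a<n. contract m (wedge_op a (contract i (contract l (?r m i l a)))))"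
      by (rule sum.swap)
    also have "\<dots> = (\<Sum>l<n. \<Sum>i<l. \<Sum>m<n. \<Sum>a<n. contract m (wedge_op a (contract i (contract l (?r m i l a)))))"
      by (rule sum.cong[OF refl], rule sum.swap)
    also have "\<dots> = (\<Sum>l<n. \<Sum>i<l. \<Sum>a<n. \<Sum>m<n. contract m (wedge_op a (contract i (contract l (?r m i l a)))))"
      by (rule sum.cong[OF refl], rule sum.cong[OF refl], rule sum.swap)
    finally show ?thesis .
  qed
  have 2: "bracket_op n c (koszul_op n y v) =
     (\<Sum>l<n. \<Sum>i<l. \<Sum>a<n. \<Sum>m<n. wedge_op a (contract i (contract l (contract m (?r m i l a)))))"
    unfolding bracket_op_def koszul_op_def
    using assms
    by (intro sum.cong refl) (simp add: rmul_sum contract_sum wedge_op_sum contract_rmul rmul_rmul)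
  have 3: "contract m (wedge_op a (contract i (contract l w))) + wedge_op a (contract i (contract l (contract m w)))
      = (if m = a then contract i (contract l w) else 0)" for m a i l and w :: "nat set \<Rightarrow> 'a"
  proof -
    have "contract i (contract l (contract m w)) = contract m (contract i (contract l w))"
      by (subst contract_contract[of l m], subst contract_uminus, subst contract_contract[of i m]) simp
    then show ?thesis by (simp add: contract_wedge_op)
  qed
  have "koszul_op n y (bracket_op n c v) + bracket_op n c (koszul_op n y v) =
     (\<Sum>l<n. \<Sum>i<l. \<Sum>a<n. \<Sum>m<n. if m = a then contract i (contract l (?r m i l a)) else 0)"
    unfolding 1 2 sum.distrib[symmetric] 3 ..
  also have "\<dots> = (\<Sum>l<n. \<Sum>i<l. contract i (contract l (rmul v (\<Sum>a<n. c i l a * y a))))"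
    by (intro sum.cong refl) (simp add: rmul_sum_right contract_sum)
  finally show ?thesis .
qed

section \<open>The Koszul complex of a power series algebra\<close>

definition mps_order_ge :: "nat \<Rightarrow> (nat multiset \<Rightarrow> 'k::zero) \<Rightarrow> bool" where
  "mps_order_ge r f \<longleftrightarrow> (\<forall>A. size A < r \<longrightarrow> f A = 0)"

definition mps_shift :: "nat \<Rightarrow> (nat multiset \<Rightarrow> 'k::zero) \<Rightarrow> nat multiset \<Rightarrow> 'k" where
  "mps_shift i f = (\<lambda>A. if i \<in># A then f (A - {#i#}) else 0)"

lemma finite_submultisets [simp]: "finite {B. B \<subseteq># (A :: 'b multiset)}"
proof -
  have "{B. B \<subseteq># A} \<subseteq> mset ` {xs. set xs \<subseteq> set_mset A \<and> length xs \<le> size A}"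
  proof
    fix B assume "B \<in> {B. B \<subseteq># A}"
    then have B: "B \<subseteq># A" by simp
    obtain xs where xs: "mset xs = B" using ex_mset by blast
    then have "set xs \<subseteq> set_mset A" "length xs \<le> size A"
      using B set_mset_mono[OF B] size_mset_mono[OF B] by (auto simp flip: set_mset_mset size_mset)
    then show "B \<in> mset ` {xs. set xs \<subseteq> set_mset A \<and> length xs \<le> size A}" using xs by blast
  qed
  then show ?thesis
    by (rule finite_subset) (intro finite_imageI finite_lists_length_le finite_set_mset)
qed

lemma mps_mult_monom: "mps_mult f (mps_monom {#i#}) = mps_shift i f"
proof
  fix A
  have "mps_mult f (mps_monom {#i#}) A = (\<Sum>B | B \<subseteq># A. if A - B = {#i#} then f B else 0)"
    unfolding mps_mult_def mps_monom_def by (intro sum.cong) auto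
  also have "\<dots> = (\<Sum>B | B \<subseteq># A. if B = A - {#i#} \<and> i \<in># A then f B else 0)"
  proof (intro sum.cong refl)
    fix B assume "B \<in> {B. B \<subseteq># A}"
    then have "A - B = {#i#} \<longleftrightarrow> B = A - {#i#} \<and> i \<in># A"
      by (metis Diff_eq_empty_iff_mset mem_Collect_eq add_diff_cancel_left' add_diff_cancel_right' insert_DiffM2
          subset_mset.add_diff_inverse union_single_eq_member add_mset_add_single)
    then show "(if A - B = {#i#} then f B else 0) = (if B = A - {#i#} \<and> i \<in># A then f B else 0)"
      by simp
  qed
  also have "\<dots> = mps_shift i f A"
    by (cases "i \<in># A") (simp_all add: mps_shift_def)
  finally show "mps_mult f (mps_monom {#i#}) A = mps_shift i f A" .
qed

lemma mps_mult_commute: "mps_mult f g = mps_mult g f"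
proof
  fix A
  show "mps_mult f g A = mps_mult g f A"
    unfolding mps_mult_def
    by (rule sum.reindex_bij_witness[of _ "\<lambda>B. A - B" "\<lambda>B. A - B"])
      (auto simp: mult.commute subset_mset.diff_diff_right)
qed

lemma mps_mult_order_ge:
  assumes "mps_order_ge r f" "mps_order_ge s g"
  shows "mps_order_ge (r + s) (mps_mult f g)"
  unfolding mps_order_ge_def
proof (intro allI impI)
  fix A :: "nat multiset" assume A: "size A < r + s"
  show "mps_mult f g A = 0"
    unfolding mps_mult_def
  proof (intro sum.neutral ballI)
    fix B assume "B \<in> {B. B \<subseteq># A}"
    then have B: "B \<subseteq># A" by simp
    have "size B < r \<or> size (A - B) < s"
      using A size_Diff_submset[OF B] size_mset_mono[OF B] by linarith
    then show "f B * g (A - B) = 0" using assms by (auto simp: mps_order_ge_def)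
  qed
qed

lemma mps_order_ge_add: "mps_order_ge r f \<Longrightarrow> mps_order_ge r g \<Longrightarrow> mps_order_ge r (f + g)"
  for f :: "_ \<Rightarrow> 'k::monoid_add"
  by (simp add: mps_order_ge_def)

lemma mps_carrier_add: "f \<in> mps_carrier n \<Longrightarrow> g \<in> mps_carrier n \<Longrightarrow> f + g \<in> mps_carrier n"
  by (auto simp: mps_carrier_def)

definition mps_koszul ::
    "nat \<Rightarrow> (nat set \<Rightarrow> nat multiset \<Rightarrow> 'k::field) \<Rightarrow> nat set \<Rightarrow> nat multiset \<Rightarrow> 'k" where
  "mps_koszul n v = (\<Sum>i<n. contract i (\<lambda>P. mps_shift i (v P)))"

text \<open>The complex splits by the multidegree \<open>P + A\<close>. On the part where \<open>m\<close> is the least index that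
  occurs, moving one \<open>m\<close> from the monomial to the front of the wedge is a contracting homotopy.\<close>

definition mps_homotopy ::
    "(nat set \<Rightarrow> nat multiset \<Rightarrow> 'k::field) \<Rightarrow> nat set \<Rightarrow> nat multiset \<Rightarrow> 'k" where
  "mps_homotopy v = (\<lambda>P A. let m = Min (P \<union> set_mset A) in
     if m \<in> P then v (P - {m}) (add_mset m A) else 0)"

lemma mps_koszul_apply:
  "mps_koszul n v P A = (\<Sum>i<n. if i \<notin> P \<and> i \<in># A then
     (if npar i P then - v (insert i P) (A - {#i#}) else v (insert i P) (A - {#i#})) else 0)"
  unfolding mps_koszul_def sum_fun_apply
  by (intro sum.cong refl) (auto simp: contract_def mps_shift_def)

text \<open>The Koszul operator moves indices between \<open>P\<close> and \<open>A\<close> and so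
  keeps the minimum \<open>m\<close>. If \<open>m\<close> is in \<open>P\<close>, the terms with
  \<open>i\<close> other than \<open>m\<close> cancel because removing \<open>m\<close> flips their
  sign; otherwise only \<open>i = m\<close> contributes.\<close>

lemma mps_homotopy:
  fixes v :: "nat set \<Rightarrow> nat multiset \<Rightarrow> 'k::field"
  assumes fin: "P \<union> set_mset A \<subseteq> {..<n}" and ne: "P \<union> set_mset A \<noteq> {}"
  shows "mps_koszul n (mps_homotopy v) P A + mps_homotopy (mps_koszul n v) P A = v P A"
proof -
  define U where "U = P \<union> set_mset A"
  define m where "m = Min U"
  have U: "finite U" "U \<noteq> {}" using fin ne finite_subset by (auto simp: U_def)
  have mU: "m \<in> U" unfolding m_def by (rule Min_in[OF U])
  then have mn: "m < n" using fin by (auto simp: U_def)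
  have mle: "m \<le> i" if "i \<in> U" for i unfolding m_def using U that by simp
  have nm: "\<not> npar m P" by (rule npar_Min) (use mle U_def in auto)
  have ins: "insert i P \<union> set_mset (A - {#i#}) = U" if "i \<in># A" for i
    using that unfolding U_def
    by (auto dest: in_diffD) (metis insert_DiffM insert_noteq_member)
  define sg where "sg i x = (if npar i P then - x else x)" for i and x :: 'k
  have hi: "mps_homotopy v (insert i P) (A - {#i#})
      = (if m \<in> insert i P then v (insert i P - {m}) (add_mset m (A - {#i#})) else 0)" if "i \<in># A" for i
    unfolding mps_homotopy_def Let_def ins[OF that] m_def[symmetric] ..
  have h1: "mps_koszul n (mps_homotopy v) P A = (\<Sum>i<n. if i \<notin> P \<and> i \<in># A then
     sg i (if m \<in> insert i P then v (insert i P - {m}) (add_mset m (A - {#i#})) else 0) else 0)"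
    unfolding mps_koszul_apply
    by (intro sum.cong refl) (simp only: sg_def hi cong: if_cong conj_cong)
  show ?thesis
  proof (cases "m \<in> P")
    case True
    have h2: "mps_homotopy (mps_koszul n v) P A = mps_koszul n v (P - {m}) (add_mset m A)"
      using True by (simp add: mps_homotopy_def Let_def U_def[symmetric] m_def[symmetric])
    have np: "npar i (P - {m}) \<longleftrightarrow> \<not> npar i P" if "i \<noteq> m" "i \<in># A" for i
      using mle[of i] that True by (auto simp: npar_remove U_def)
    have npm: "\<not> npar m (P - {m})" using True nm by (simp add: npar_remove)
    have "mps_koszul n (mps_homotopy v) P A + mps_homotopy (mps_koszul n v) P A
       = (\<Sum>i<n. if i = m then v P A else 0)"
      unfolding h1 h2 unfolding mps_koszul_apply sum.distrib[symmetric]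
    proof (intro sum.cong refl)
      fix i
      have r: "insert i P - {m} = insert i (P - {m})" if "i \<noteq> m" using that by auto
      have r': "add_mset m (A - {#i#}) = add_mset m A - {#i#}" if "i \<in># A" using that by simp
      show "(if i \<notin> P \<and> i \<in># A then
          sg i (if m \<in> insert i P then v (insert i P - {m}) (add_mset m (A - {#i#})) else 0) else 0) +
         (if i \<notin> P - {m} \<and> i \<in># add_mset m A then
          (if npar i (P - {m}) then - v (insert i (P - {m})) (add_mset m A - {#i#})
           else v (insert i (P - {m})) (add_mset m A - {#i#})) else 0)
        = (if i = m then v P A else 0)"
      proof (cases "i = m")
        case i: True
        then show ?thesis using True npm by (simp add: insert_absorb)
      next
        case False
        then show ?thesis using True np[OF False] r r' by (auto simp: sg_def)
      qed
    qed
    then show ?thesis using mn by simp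
  next
    case False
    have h2: "mps_homotopy (mps_koszul n v) P A = 0"
      using False by (simp add: mps_homotopy_def Let_def U_def[symmetric] m_def[symmetric])
    have mA: "m \<in># A" using mU False by (simp add: U_def)
    have "mps_koszul n (mps_homotopy v) P A = (\<Sum>i<n. if i = m then v P A else 0)"
      unfolding h1 by (intro sum.cong refl) (use False nm mA in \<open>auto simp: sg_def\<close>)
    then show ?thesis using mn h2 by simp
  qed
qed

text \<open>The homotopy evaluates \<open>v\<close> on a monomial with one more variable, so one
  order is lost. The empty multidegree has no least index; it carries the homology, and the
  condition for \<open>q = 0\<close> removes it.\<close>

lemma mps_koszul_exact:
  fixes v :: "nat set \<Rightarrow> nat multiset \<Rightarrow> 'k::field"
  assumes v: "v \<in> ext_module n q" and car: "\<And>P. v P \<in> mps_carrier n"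
    and cyc: "mps_koszul n v = 0" and aug: "q = 0 \<Longrightarrow> v {} {#} = 0"
    and ord: "\<And>P. mps_order_ge r (v P)"
  obtains w where "w \<in> ext_module n (Suc q)" "\<And>P. w P \<in> mps_carrier n"
    "\<And>P. mps_order_ge (r - 1) (w P)" "mps_koszul n w = v"
proof
  let ?w = "mps_homotopy v"
  show car': "?w P \<in> mps_carrier n" for P
  proof -
    have "?w P A = 0" if "\<not> set_mset A \<subseteq> {..<n}" for A
      using car[of "P - {Min (P \<union> set_mset A)}"] that by (auto simp: mps_homotopy_def Let_def mps_carrier_def)
    then show ?thesis by (simp add: mps_carrier_def)
  qed
  show "mps_order_ge (r - 1) (?w P)" for P
    using ord unfolding mps_order_ge_def by (auto simp: mps_homotopy_def Let_def)
  show w: "?w \<in> ext_module n (Suc q)"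
    unfolding ext_module_def
  proof (intro CollectI allI impI)
    fix P assume "?w P \<noteq> 0"
    then obtain A where A: "?w P A \<noteq> 0" by (auto simp: fun_eq_iff)
    define m where "m = Min (P \<union> set_mset A)"
    have m: "m \<in> P" "v (P - {m}) (add_mset m A) \<noteq> 0"
      using A by (auto simp: mps_homotopy_def Let_def m_def[symmetric] split: if_splits)
    then have "v (P - {m}) \<noteq> 0" by (auto simp: fun_eq_iff)
    then have P: "P - {m} \<subseteq> {..<n}" "card (P - {m}) = q" using v by (auto simp: ext_module_def)
    have "set_mset (add_mset m A) \<subseteq> {..<n}" using car[of "P - {m}"] m(2) unfolding mps_carrier_def by blast
    then have "m < n" by simp
    then have "P \<subseteq> {..<n}" using P by auto
    moreover from this have "finite P" using finite_subset by blast
    ultimately show "P \<subseteq> {..<n} \<and> card P = Suc q"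
      using P m by (metis card_Suc_Diff1)
  qed
  show "mps_koszul n ?w = v"
  proof (intro ext)
    fix P A
    consider "P \<union> set_mset A \<subseteq> {..<n}" "P \<union> set_mset A \<noteq> {}" | "P \<union> set_mset A = {}"
      | "\<not> P \<subseteq> {..<n}" | "\<not> set_mset A \<subseteq> {..<n}" by auto
    then show "mps_koszul n ?w P A = v P A"
    proof cases
      case 1
      have "mps_homotopy (0 :: nat set \<Rightarrow> nat multiset \<Rightarrow> 'k) P A = 0"
        by (simp add: mps_homotopy_def Let_def)
      then show ?thesis using mps_homotopy[OF 1, of v] cyc by simp
    next
      case 2
      then have e: "P = {}" "A = {#}" by auto
      have "v {} {#} = 0"
      proof (cases q)
        case 0 then show ?thesis by (rule aug)
      next
        case (Suc q')
        then have "v {} = 0" using v by (auto simp: ext_module_def)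
        then show ?thesis by simp
      qed
      then show ?thesis using e by (simp add: mps_koszul_apply)
    next
      case 3
      then have "v P = 0" and "?w (insert i P) = 0" for i
        using v w unfolding ext_module_def by blast+
      then have "v P A = 0" and "?w (insert i P) B = 0" for i B by (simp_all only: zero_fun_apply)
      moreover from this have "mps_koszul n ?w P A = 0"
        unfolding mps_koszul_apply by (intro sum.neutral ballI) simp
      ultimately show ?thesis by simp
    next
      case 4
      have "?w (insert i P) (A - {#i#}) = 0" if "i < n" "i \<in># A" for i
      proof -
        have "\<not> set_mset (A - {#i#}) \<subseteq> {..<n}"
          using 4 that by (metis insert_DiffM insert_subset lessThan_iff set_mset_add_mset_insert)
        then show ?thesis using car'[of "insert i P"] by (auto simp: mps_carrier_def)
      qed
      then have "mps_koszul n ?w P A = 0" unfolding mps_koszul_apply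
        by (intro sum.neutral ballI) auto
      then show ?thesis using car[of P] 4 by (auto simp: mps_carrier_def)
    qed
  qed
qed

section \<open>Complete algebras over power series\<close>

text \<open>A left linear map is right multiplication by a matrix; the row \<open>M P\<close> is the
  image of the basis vector at \<open>P\<close>.\<close>

definition mat_op :: "nat \<Rightarrow> (nat set \<Rightarrow> nat set \<Rightarrow> 'a::ring_1) \<Rightarrow> (nat set \<Rightarrow> 'a) \<Rightarrow> nat set \<Rightarrow> 'a" where
  "mat_op n M v = (\<lambda>T. \<Sum>P\<in>Pow {..<n}. v P * M P T)"

lemma mat_op_add: "mat_op n M (v + w) = mat_op n M v + mat_op n M w"
  by (auto simp: mat_op_def fun_eq_iff algebra_simps sum.distrib)
lemma mat_op_diff: "mat_op n M (v - w) = mat_op n M v - mat_op n M w"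
  by (auto simp: mat_op_def fun_eq_iff algebra_simps sum_subtractf)
lemma mat_op_zero [simp]: "mat_op n M 0 = 0"
  by (auto simp: mat_op_def fun_eq_iff)
lemma mat_op_act: "mat_op n M (act a v) = act a (mat_op n M v)"
  by (auto simp: mat_op_def act_def fun_eq_iff mult.assoc sum_distrib_left)

lemma ext_module_iff: "v \<in> ext_module n q \<longleftrightarrow> (\<forall>P. \<not> (P \<subseteq> {..<n} \<and> card P = q) \<longrightarrow> v P = 0)"
  by (auto simp: ext_module_def)

lemma ext_module_add: "v \<in> ext_module n q \<Longrightarrow> w \<in> ext_module n q \<Longrightarrow> v + w \<in> ext_module n q"
  by (simp add: ext_module_iff)
lemma ext_module_diff: "v \<in> ext_module n q \<Longrightarrow> w \<in> ext_module n q \<Longrightarrow> v - w \<in> ext_module n q"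
  by (simp add: ext_module_iff)
lemma ext_module_act: "v \<in> ext_module n q \<Longrightarrow> act a v \<in> ext_module n q"
  by (simp add: ext_module_iff act_def)
lemma ext_module_zero: "0 \<in> ext_module n q"
  by (simp add: ext_module_iff)

text \<open>Scalars act through central elements \<open>s c\<close>, which gives the quantum algebra
  and its dual a common interface. Completeness is stated for \<open>h\<close>-adic series, the form
  in which lifts are summed.\<close>

locale h_adic_algebra =
  fixes s :: "'k::field_char_0 fps \<Rightarrow> 'a::ring_1"
  assumes s_add: "s (c + d) = s c + s d"
    and s_mult: "s (c * d) = s c * s d"
    and s_one: "s 1 = 1"
    and s_commute: "s c * a = a * s c"
    and h_torsion_free: "s fps_X * a = 0 \<Longrightarrow> a = 0"
    and h_complete: "\<exists>u. \<forall>N. \<exists>r. u - (\<Sum>i<N. s fps_X ^ i * f i) = s fps_X ^ N * r"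
    and h_separated: "(\<And>N. \<exists>r. u = s fps_X ^ N * r) \<Longrightarrow> u = 0"
begin

abbreviation h :: 'a where "h \<equiv> s fps_X"

sublocale s: additive s by unfold_locales (rule s_add)
declare s.zero [simp]

lemma s_power: "s (c ^ m) = s c ^ m"
  by (induction m) (simp_all add: s_one s_mult)

lemma h_cancel: "h * a = h * b \<longleftrightarrow> a = b"
  using h_torsion_free[of "a - b"] by (auto simp: right_diff_distrib)
lemma h_power_cancel: "h ^ m * a = h ^ m * b \<longleftrightarrow> a = b"
  by (induction m) (simp_all add: mult.assoc h_cancel)

lemma h_power_commute: "h ^ m * a = a * h ^ m"
  using s_commute[of "fps_X ^ m" a] by (simp add: s_power)

lemma act_h_cancel: "act h v = act h w \<longleftrightarrow> v = w"
  by (simp add: act_def fun_eq_iff h_cancel)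

lemma act_h_ext_module: "act h v \<in> ext_module n q \<longleftrightarrow> v \<in> ext_module n q"
  using h_cancel[of _ 0] by (simp add: ext_module_iff act_def)

text \<open>If \<open>D\<close> hits every cycle up to a multiple \<open>h v'\<close> of another cycle \<open>v'\<close>, then iterating and summing the
  resulting \<open>h\<close>-adic series shows that it hits every cycle. The levels keep track of a filtration \<open>J\<close>.\<close>

lemma h_adic_lifting:
  fixes Z :: "nat \<Rightarrow> (nat set \<Rightarrow> 'a) set" and J :: "nat \<Rightarrow> 'a \<Rightarrow> bool"
  assumes step: "\<And>r v. v \<in> Z r \<Longrightarrow> \<exists>w v'. w \<in> ext_module n q \<and> (\<forall>P. J (r - 1) (w P)) \<and> v' \<in> Z (r - 1) \<and>
      v = mat_op n M w + act h v'"
    and J_zero: "\<And>a. J 0 a" and J_add: "\<And>r a b. J r a \<Longrightarrow> J r b \<Longrightarrow> J r (a + b)"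
    and J_h: "\<And>r a. J r a \<Longrightarrow> J (Suc r) (h * a)" and J_mono: "\<And>r a. J (Suc r) a \<Longrightarrow> J r a"
    and v: "v \<in> Z r"
  shows "\<exists>w\<in>ext_module n q. (\<forall>P. J (r - 1) (w P)) \<and> v = mat_op n M w"
proof -
  have "\<forall>x. \<exists>y. snd x \<in> Z (fst x) \<longrightarrow> fst y \<in> ext_module n q \<and> (\<forall>P. J (fst x - 1) (fst y P)) \<and>
      snd y \<in> Z (fst x - 1) \<and> snd x = mat_op n M (fst y) + act h (snd y)"
    using step by (simp add: split_paired_all)
  from choice[OF this] obtain F where F: "\<forall>x. snd x \<in> Z (fst x) \<longrightarrow> fst (F x) \<in> ext_module n q \<and>
      (\<forall>P. J (fst x - 1) (fst (F x) P)) \<and> snd (F x) \<in> Z (fst x - 1) \<and>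
      snd x = mat_op n M (fst (F x)) + act h (snd (F x))"
    ..
  define w v' where "w r u = fst (F (r, u))" and "v' r u = snd (F (r, u))" for r u
  have wv: "w r u \<in> ext_module n q \<and> (\<forall>P. J (r - 1) (w r u P)) \<and>
      v' r u \<in> Z (r - 1) \<and> u = mat_op n M (w r u) + act h (v' r u)" if "u \<in> Z r" for r u
    using F[rule_format, of "(r, u)"] that by (simp add: w_def v'_def)
  define c where "c = rec_nat v (\<lambda>i. v' (r - i))"
  have c0: "c 0 = v" and cS: "c (Suc i) = v' (r - i) (c i)" for i by (simp_all add: c_def)
  have cZ: "c i \<in> Z (r - i)" for i
  proof (induction i)
    case 0
    then show ?case using v by (simp add: c0)
  next
    case (Suc i)
    then show ?case using wv[of "c i" "r - i"] by (simp add: cS)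
  qed
  \<comment> \<open>The level drops at every step until it is 0; the factor \<open>h ^ i\<close> in
    the series makes up for the loss.\<close>
  define f where "f i = w (r - i) (c i)" for i
  have f: "f i \<in> ext_module n q" "J (r - i - 1) (f i P)" "c i = mat_op n M (f i) + act h (c (Suc i))" for i P
    using wv[OF cZ[of i]] by (auto simp: f_def cS)
  have part: "v = mat_op n M (\<Sum>i<N. act (h ^ i) (f i)) + act (h ^ N) (c N)" for N
  proof (induction N)
    case 0
    show ?case by (simp only: c0 lessThan_0 sum.empty mat_op_zero power_0 act_one add_0_left)
  next
    case (Suc N)
    have "act (h ^ N) (c N) = mat_op n M (act (h ^ N) (f N)) + act (h ^ Suc N) (c (Suc N))"
      by (subst f(3)) (simp add: act_add mat_op_act act_act h_power_commute)
    then have "v = mat_op n M (\<Sum>i<N. act (h ^ i) (f i)) + (mat_op n M (act (h ^ N) (f N)) + act (h ^ Suc N) (c (Suc N)))"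
      using Suc.IH by (simp only:)
    then show ?case by (simp only: sum.lessThan_Suc mat_op_add add.assoc)
  qed
  \<comment> \<open>Limits are taken entrywise, and 0 is chosen where all terms vanish so that the
    limit keeps the degree \<open>q\<close>.\<close>
  have "\<exists>u. (\<forall>N. \<exists>r. u - (\<Sum>i<N. h ^ i * f i P) = h ^ N * r) \<and> ((\<forall>i. f i P = 0) \<longrightarrow> u = 0)" for P
  proof (cases "\<forall>i. f i P = 0")
    case True
    then show ?thesis by (intro exI[of _ 0]) (auto intro!: exI[of _ 0])
  next
    case False
    then show ?thesis using h_complete[of "\<lambda>i. f i P"] by auto
  qed
  then have "\<forall>P. \<exists>u. (\<forall>N. \<exists>r. u - (\<Sum>i<N. h ^ i * f i P) = h ^ N * r) \<and> ((\<forall>i. f i P = 0) \<longrightarrow> u = 0)" ..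
  from choice[OF this] obtain u where u: "\<And>P N. \<exists>r. u P - (\<Sum>i<N. h ^ i * f i P) = h ^ N * r"
      and u0: "\<And>P. (\<forall>i. f i P = 0) \<Longrightarrow> u P = 0"
    by blast
  have "u \<in> ext_module n q"
    unfolding ext_module_def
  proof (intro CollectI allI impI)
    fix P assume "u P \<noteq> 0"
    then obtain i where "f i P \<noteq> 0" using u0 by blast
    then show "P \<subseteq> {..<n} \<and> card P = q" using f(1)[of i] by (auto simp: ext_module_def)
  qed
  moreover have "J (r - 1) (u P)" for P
  proof -
    have J_h_power: "J (m + l) (h ^ m * a)" if "J l a" for m l a
      using that by (induction m) (auto simp: mult.assoc intro: J_h)
    have Jm: "J l a" if "J m a" "l \<le> m" for l m a
      using that(2,1) by (induction m rule: dec_induct) (auto intro: J_mono)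
    have J0: "J m 0" for m
    proof (induction m)
      case (Suc m)
      then show ?case using J_h[OF Suc] by simp
    qed (rule J_zero)
    have Jsum: "J m (\<Sum>i\<in>A. g i)" if "\<And>i. i \<in> A \<Longrightarrow> J m (g i)" for m A and g :: "nat \<Rightarrow> 'a"
      using that by (induction A rule: infinite_finite_induct) (auto intro: J_add J0)
    obtain t where t: "u P - (\<Sum>i<r. h ^ i * f i P) = h ^ r * t" using u by blast
    have "u P = (\<Sum>i<r. h ^ i * f i P) + h ^ r * t" using t by (simp add: algebra_simps)
    moreover have "J (r - 1) (\<Sum>i<r. h ^ i * f i P)"
    proof (rule Jsum)
      fix i assume "i \<in> {..<r}"
      then have "i + (r - i - 1) = r - 1" by auto
      then show "J (r - 1) (h ^ i * f i P)" using J_h_power[OF f(2)[of i P], of i] by simp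
    qed
    moreover have "J (r - 1) (h ^ r * t)"
      by (rule Jm[OF J_h_power[OF J_zero, of r]]) simp
    ultimately show ?thesis using J_add by simp
  qed
  moreover have "v = mat_op n M u"
  proof (rule ext)
    fix T
    have "\<exists>r. v T - mat_op n M u T = h ^ N * r" for N
    proof -
      have "\<forall>P. \<exists>g. u P - (\<Sum>i<N. h ^ i * f i P) = h ^ N * g" using u by blast
      from choice[OF this] obtain g where g: "\<forall>P. u P - (\<Sum>i<N. h ^ i * f i P) = h ^ N * g P" ..
      have "u = (\<Sum>i<N. act (h ^ i) (f i)) + act (h ^ N) g"
      proof
        fix P
        show "u P = ((\<Sum>i<N. act (h ^ i) (f i)) + act (h ^ N) g) P"
          using g[rule_format, of P] by (simp add: sum_fun_apply act_def algebra_simps)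
      qed
      then have "mat_op n M u = mat_op n M (\<Sum>i<N. act (h ^ i) (f i)) + act (h ^ N) (mat_op n M g)"
        by (simp only: mat_op_add mat_op_act)
      then have "v T - mat_op n M u T = h ^ N * (c N T - mat_op n M g T)"
        using fun_cong[OF part[of N], of T] by (simp add: act_def right_diff_distrib)
      then show ?thesis by blast
    qed
    then have "v T - mat_op n M u T = 0" by (rule h_separated)
    then show "v T = mat_op n M u T" by simp
  qed
  ultimately show ?thesis by blast
qed

end

section \<open>The augmentation filtration\<close>

text \<open>\<open>\<psi>\<close> is reduction modulo \<open>h\<close>, read in the coordinates \<open>x\<^sub>i\<close>.\<close>

locale quantum_series = h_adic_algebra s
  for s :: "'k::field_char_0 fps \<Rightarrow> 'a::ring_1" +
  fixes \<epsilon> :: "'a \<Rightarrow> 'k fps"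
    and \<psi> :: "'a \<Rightarrow> nat multiset \<Rightarrow> 'k"
    and n :: nat
    and x :: "nat \<Rightarrow> 'a"
  assumes eps_add: "\<epsilon> (a + b) = \<epsilon> a + \<epsilon> b"
    and eps_mult: "\<epsilon> (a * b) = \<epsilon> a * \<epsilon> b"
    and eps_s: "\<epsilon> (s c) = c"
    and psi_carrier: "\<psi> a \<in> mps_carrier n"
    and psi_add: "\<psi> (a + b) = \<psi> a + \<psi> b"
    and psi_mult: "\<psi> (a * b) = mps_mult (\<psi> a) (\<psi> b)"
    and psi_s: "\<psi> (s c) = (\<lambda>A. if A = {#} then fps_nth c 0 else 0)"
    and psi_surj: "f \<in> mps_carrier n \<Longrightarrow> \<exists>a. \<psi> a = f"
    and psi_ker: "\<psi> a = 0 \<Longrightarrow> \<exists>b. a = s fps_X * b"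
    and psi_x: "i < n \<Longrightarrow> \<psi> (x i) = mps_monom {#i#}"
    and eps_x: "i < n \<Longrightarrow> \<epsilon> (x i) = 0"
begin

sublocale eps: additive \<epsilon> by unfold_locales (rule eps_add)
sublocale psi: additive \<psi> by unfold_locales (rule psi_add)
declare eps.zero [simp] psi.zero [simp]

lemma psi_h: "\<psi> h = 0"
  by (simp add: psi_s fun_eq_iff)
lemma psi_h_mult: "\<psi> (h * a) = 0"
  by (simp add: psi_mult psi_h mps_mult_def fun_eq_iff)
lemma psi_mult_x: "i < n \<Longrightarrow> \<psi> (a * x i) = mps_shift i (\<psi> a)"
  by (simp add: psi_mult psi_x mps_mult_monom)

lemma psi_koszul_op: "(\<lambda>T. \<psi> (koszul_op n x v T)) = mps_koszul n (\<lambda>P. \<psi> (v P))"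
proof -
  have "\<psi> (contract i (rmul v (x i)) T) = contract i (\<lambda>P. mps_shift i (\<psi> (v P))) T" if "i < n" for i T
    using that by (simp add: contract_def rmul_def psi.minus psi_mult_x)
  then have "(\<Sum>i<n. \<psi> (contract i (rmul v (x i)) T)) = (\<Sum>i<n. contract i (\<lambda>P. mps_shift i (\<psi> (v P))) T)" for T
    by (intro sum.cong) auto
  then show ?thesis
    by (intro ext) (simp only: koszul_op_def mps_koszul_def sum_fun_apply psi.sum)
qed

text \<open>Exactness of the Koszul complex in degree 0, applied to \<open>f\<close> as a chain
  supported on the empty set.\<close>

lemma order_decomposition:
  fixes f :: "nat multiset \<Rightarrow> 'k"
  assumes f: "f \<in> mps_carrier n" "mps_order_ge (Suc r) f"
  obtains g where "\<And>i. g i \<in> mps_carrier n" "\<And>i. mps_order_ge r (g i)" "f = (\<Sum>i<n. mps_shift i (g i))"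
proof -
  define v where "v = (\<lambda>P :: nat set. if P = {} then f else 0)"
  have 0: "mps_koszul n v = 0"
  proof (intro ext)
    fix P A
    have "mps_koszul n v P A = 0"
      unfolding mps_koszul_apply by (intro sum.neutral ballI) (simp add: v_def)
    then show "mps_koszul n v P A = (0 :: nat set \<Rightarrow> nat multiset \<Rightarrow> 'k) P A" by simp
  qed
  have v: "v \<in> ext_module n 0"
    by (simp add: ext_module_iff v_def)
  have car: "v P \<in> mps_carrier n" and ord: "mps_order_ge (Suc r) (v P)" for P
    using f by (auto simp: v_def mps_carrier_def mps_order_ge_def)
  have aug: "v {} {#} = 0" using f by (simp add: v_def mps_order_ge_def)
  obtain w where w: "\<And>P. w P \<in> mps_carrier n" "\<And>P. mps_order_ge (Suc r - 1) (w P)" "mps_koszul n w = v"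
    using mps_koszul_exact[OF v car 0 aug ord] by metis
  have "f = (\<Sum>i<n. mps_shift i (w {i}))"
  proof
    fix A
    have "f A = mps_koszul n w {} A" by (simp add: w v_def)
    also have "\<dots> = (\<Sum>i<n. mps_shift i (w {i}) A)"
      unfolding mps_koszul_apply by (intro sum.cong) (auto simp: mps_shift_def)
    finally show "f A = (\<Sum>i<n. mps_shift i (w {i})) A" by (simp only: sum_fun_apply)
  qed
  then show ?thesis using that[of "\<lambda>i. w {i}"] w by simp
qed

section \<open>Powers of the augmentation ideal\<close>

abbreviation aug :: "'a \<Rightarrow> bool" where "aug a \<equiv> fps_nth (\<epsilon> a) 0 = 0"

text \<open>\<open>ipow r\<close> is membership in \<open>I^r\<close>, with \<open>I^0\<close> the
  whole algebra. The factor from \<open>I\<close> stands on the right, where the \<open>x i\<close>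
  stand in decompositions; the summand \<open>c\<close> in the last rule replaces finite
  sums.\<close>

inductive ipow :: "nat \<Rightarrow> 'a \<Rightarrow> bool" where
  ipow_0: "ipow 0 a"
| ipow_zero: "ipow (Suc r) 0"
| ipow_step: "ipow r a \<Longrightarrow> aug b \<Longrightarrow> ipow (Suc r) c \<Longrightarrow> ipow (Suc r) (a * b + c)"

lemma ipow_zero' [simp]: "ipow r 0"
  by (cases r) (auto intro: ipow_0 ipow_zero)

lemma ipow_mult_aug: "ipow r a \<Longrightarrow> aug b \<Longrightarrow> ipow (Suc r) (a * b)"
  using ipow_step[OF _ _ ipow_zero] by simp

lemma ipow_add: "ipow r a \<Longrightarrow> ipow r b \<Longrightarrow> ipow r (a + b)"
  by (induction rule: ipow.induct) (auto simp: add.assoc intro: ipow_0 ipow_step)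

lemma ipow_lmult: "ipow r a \<Longrightarrow> ipow r (c * a)"
proof (induction rule: ipow.induct)
  case (ipow_step r a b d)
  then show ?case
    using ipow.ipow_step[of r "c * a" b "c * d"] by (simp add: algebra_simps)
qed (auto intro: ipow_0)

lemma ipow_rmult: "ipow r a \<Longrightarrow> ipow r (a * c)"
proof (induction rule: ipow.induct)
  case (ipow_step r a b d)
  then show ?case
    using ipow.ipow_step[of r a "b * c" "d * c"] by (simp add: algebra_simps eps_mult)
qed (auto intro: ipow_0)

lemma ipow_uminus: "ipow r a \<Longrightarrow> ipow r (- a)"
  using ipow_lmult[of r a "- 1"] by simp

lemma ipow_diff: "ipow r a \<Longrightarrow> ipow r b \<Longrightarrow> ipow r (a - b)"
  using ipow_add[of r a "- b"] ipow_uminus[of r b] by simp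

lemma ipow_sum: "(\<And>i. i \<in> A \<Longrightarrow> ipow r (f i)) \<Longrightarrow> ipow r (\<Sum>i\<in>A. f i)"
  by (induction A rule: infinite_finite_induct) (auto intro: ipow_add)

lemma ipow_mult: "ipow l b \<Longrightarrow> ipow r a \<Longrightarrow> ipow (r + l) (a * b)"
proof (induction arbitrary: a rule: ipow.induct)
  case (ipow_0 b)
  then show ?case by (simp add: ipow_rmult)
next
  case (ipow_step l b c d)
  then have "ipow (Suc (r + l)) (a * b * c + a * d)"
    by (intro ipow.ipow_step) auto
  then show ?case by (simp add: algebra_simps)
qed auto

lemma ipow_Suc_imp: "ipow (Suc r) a \<Longrightarrow> ipow r a"
proof (induction "Suc r" a rule: ipow.induct)
  case (ipow_step a b c)
  then show ?case by (auto intro: ipow_add ipow_rmult)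
qed auto

lemma ipow_1: "ipow (Suc 0) a \<longleftrightarrow> aug a"
proof
  show "ipow (Suc 0) a \<Longrightarrow> aug a"
    by (induction "Suc 0" a rule: ipow.induct) (auto simp: eps_add eps_mult)
  show "aug a \<Longrightarrow> ipow (Suc 0) a"
    using ipow_mult_aug[of 0 1 a] ipow_0 by simp
qed

lemma ipow_h: "ipow r a \<Longrightarrow> ipow (Suc r) (h * a)"
  using ipow_mult_aug[of r a h] by (simp add: s_commute[of _ a] eps_s)

lemma ipow_h_power: "ipow r a \<Longrightarrow> ipow (m + r) (h ^ m * a)"
  by (induction m) (auto simp: mult.assoc intro: ipow_h)

lemma aug_x: "i < n \<Longrightarrow> aug (x i)"
  by (simp add: eps_x)

text \<open>The decomposition of \<open>f\<close> by order lifts termwise, since the variable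
  \<open>X_i\<close> lifts to \<open>x i\<close> in \<open>I\<close>.\<close>

lemma ipow_lift:
  "f \<in> mps_carrier n \<Longrightarrow> mps_order_ge r f \<Longrightarrow> \<exists>a. ipow r a \<and> \<psi> a = f"
proof (induction r arbitrary: f)
  case 0
  then show ?case using psi_surj ipow_0 by blast
next
  case (Suc r)
  obtain g where g: "\<And>i. g i \<in> mps_carrier n" "\<And>i. mps_order_ge r (g i)" "f = (\<Sum>i<n. mps_shift i (g i))"
    using order_decomposition[OF Suc.prems] by metis
  have "\<forall>i. \<exists>a. ipow r a \<and> \<psi> a = g i" using Suc.IH g by blast
  from choice[OF this] obtain a where a: "\<forall>i. ipow r (a i) \<and> \<psi> (a i) = g i" ..
  have "\<psi> (\<Sum>i<n. a i * x i) = f"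
    unfolding psi.sum g(3) by (intro sum.cong refl) (use a in \<open>simp add: psi_mult_x\<close>)
  moreover have "ipow (Suc r) (\<Sum>i<n. a i * x i)"
    by (intro ipow_sum ipow_mult_aug) (use a aug_x in auto)
  ultimately show ?case by blast
qed

text \<open>Compatibility of \<open>\<psi>\<close> with the counit comes from
  \<open>\<epsilon> (x i) = 0\<close>: once the constant term is subtracted, the reduction has a
  lift in \<open>I\<close>, and two lifts differ by a multiple of \<open>h\<close>, which the counit
  sends to 0 modulo \<open>h\<close>.\<close>

lemma psi_const: "\<psi> a {#} = fps_nth (\<epsilon> a) 0"
proof -
  define a' where "a' = a - s (fps_const (\<psi> a {#}))"
  have "mps_order_ge (Suc 0) (\<psi> a')"
    by (simp add: mps_order_ge_def a'_def psi.diff psi_s)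
  from ipow_lift[OF psi_carrier this] obtain b where b: "ipow (Suc 0) b" "\<psi> b = \<psi> a'" by blast
  have "\<psi> (a' - b) = 0" by (simp add: psi.diff b)
  then obtain c where c: "a' - b = h * c" using psi_ker by blast
  have "aug b" using b ipow_1 by blast
  moreover have "aug (a' - b)" by (simp add: c eps_mult eps_s)
  ultimately have "aug a'" by (simp add: eps.diff)
  then show ?thesis by (simp add: a'_def eps.diff eps_s)
qed

lemma ipow_psi_order: "ipow r a \<Longrightarrow> mps_order_ge r (\<psi> a)"
proof (induction rule: ipow.induct)
  case (ipow_step r a b c)
  have "mps_order_ge (Suc 0) (\<psi> b)"
    using ipow_step by (simp add: mps_order_ge_def psi_const)
  then have "mps_order_ge (Suc r) (mps_mult (\<psi> a) (\<psi> b))"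
    using mps_mult_order_ge[OF ipow_step.IH(1), of "Suc 0" "\<psi> b"] by simp
  then show ?case
    unfolding psi_add psi_mult by (rule mps_order_ge_add[OF _ ipow_step.IH(2)])
qed (auto simp: mps_order_ge_def)

lemma aug_decomposition:
  assumes "aug a"
  obtains g c where "a = (\<Sum>i<n. g i * x i) + h * c"
proof -
  have "mps_order_ge (Suc 0) (\<psi> a)"
    using assms by (simp add: mps_order_ge_def psi_const)
  then obtain g where g: "\<And>i. g i \<in> mps_carrier n" "\<psi> a = (\<Sum>i<n. mps_shift i (g i))"
    using order_decomposition[OF psi_carrier] by metis
  have "\<forall>i. \<exists>b. \<psi> b = g i" using psi_surj g by blast
  from choice[OF this] obtain b where b: "\<forall>i. \<psi> (b i) = g i" ..
  have "\<psi> (\<Sum>i<n. b i * x i) = \<psi> a"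
    unfolding psi.sum g(2) by (intro sum.cong refl) (use b in \<open>simp add: psi_mult_x\<close>)
  then have "\<psi> (a - (\<Sum>i<n. b i * x i)) = 0" by (simp add: psi.diff)
  then obtain c where "a - (\<Sum>i<n. b i * x i) = h * c" using psi_ker by blast
  then show ?thesis using that[of b c] by (simp add: algebra_simps)
qed

lemma ipow_decomposition:
  assumes "ipow (Suc r) b"
  shows "\<exists>g c. (\<forall>i. ipow r (g i)) \<and> ipow r c \<and> b = (\<Sum>i<n. g i * x i) + h * c"
  using assms
proof (induction "Suc r" b rule: ipow.induct)
  case ipow_zero
  then show ?case by (intro exI[of _ "\<lambda>_. 0"] exI[of _ 0]) simp
next
  case (ipow_step a b d)
  obtain g' c' where g': "\<forall>i. ipow r (g' i)" "ipow r c'" "d = (\<Sum>i<n. g' i * x i) + h * c'"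
    using ipow_step by blast
  obtain g c where g: "b = (\<Sum>i<n. g i * x i) + h * c" using aug_decomposition ipow_step by metis
  have "a * b + d = (\<Sum>i<n. (a * g i + g' i) * x i) + h * (a * c + c')"
  proof -
    have "a * (h * c) = h * (a * c)" by (metis mult.assoc s_commute)
    then show ?thesis
      unfolding g g' by (simp add: algebra_simps sum.distrib sum_distrib_left)
  qed
  moreover have "ipow r (a * g i + g' i)" "ipow r (a * c + c')" for i
    using g' ipow_step.hyps by (auto intro: ipow_add ipow_rmult)
  ultimately show ?case
    by (intro exI[of _ "\<lambda>i. a * g i + g' i"] exI[of _ "a * c + c'"]) simp
qed

lemma psi_commutator: "\<psi> (a * b - b * a) = 0"
  by (simp add: psi.diff psi_mult mps_mult_commute)

text \<open>The algebra is commutative modulo \<open>h\<close>, and the counit kills commutators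
  because its values commute; cancelling \<open>h\<close> in \<open>k[[h]]\<close> puts the quotient
  into \<open>I\<close>.\<close>

lemma commutator:
  obtains z where "a * b - b * a = h * z" "aug z"
proof -
  obtain z where z: "a * b - b * a = h * z" using psi_ker[OF psi_commutator] by blast
  have "\<epsilon> (h * z) = 0" unfolding z[symmetric] by (simp add: eps.diff eps_mult mult.commute)
  then have "\<epsilon> z = 0" by (simp add: eps_mult eps_s)
  then show ?thesis using that[OF z] by simp
qed

section \<open>The Koszul operator over the quantum algebra\<close>

abbreviation vpow :: "nat \<Rightarrow> (nat set \<Rightarrow> 'a) \<Rightarrow> bool" where "vpow r v \<equiv> \<forall>P. ipow r (v P)"

lemma vpow_contract: "vpow r v \<Longrightarrow> vpow r (contract i v)"
  by (auto simp: contract_def intro: ipow_uminus)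
lemma vpow_add: "vpow r v \<Longrightarrow> vpow r w \<Longrightarrow> vpow r (v + w)"
  by (auto intro: ipow_add)
lemma vpow_diff: "vpow r v \<Longrightarrow> vpow r w \<Longrightarrow> vpow r (v - w)"
  by (auto intro: ipow_diff)
lemma vpow_sum: "(\<And>i. i \<in> A \<Longrightarrow> vpow r (f i)) \<Longrightarrow> vpow r (\<Sum>i\<in>A. f i)"
  by (auto simp: sum_fun_apply intro: ipow_sum)
lemma vpow_rmul: "vpow r v \<Longrightarrow> ipow l a \<Longrightarrow> vpow (r + l) (rmul v a)"
  by (auto simp: rmul_def intro: ipow_mult)
lemma vpow_act_h: "vpow r v \<Longrightarrow> vpow (Suc r) (act h v)"
  by (auto simp: act_def intro: ipow_h)
lemma vpow_koszul_op: "vpow r v \<Longrightarrow> vpow (Suc r) (koszul_op n x v)"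
  unfolding koszul_op_def
  by (intro vpow_sum vpow_contract vpow_rmul[where l = "Suc 0", simplified]) (simp_all add: ipow_1 aug_x)

text \<open>Each commutator of the \<open>x i\<close> contributes a factor \<open>h\<close> and an
  element of \<open>I\<close>, so the square divided by \<open>h\<close> still gains one
  level.\<close>

lemma koszul_op_square:
  assumes "vpow r v"
  obtains u where "koszul_op n x (koszul_op n x v) = act h u" "vpow (Suc r) u"
proof -
  have "\<forall>p. \<exists>z. x (fst p) * x (snd p) - x (snd p) * x (fst p) = h * z \<and> aug z"
    using commutator by metis
  from choice[OF this] obtain z where "\<forall>p. x (fst p) * x (snd p) - x (snd p) * x (fst p) = h * z p \<and> aug (z p)" ..
  then have z: "x i * x l - x l * x i = h * z (i, l)" "aug (z (i, l))" for i l by force+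
  have "rmul w (h * c) = act h (rmul w c)" for w :: "nat set \<Rightarrow> 'a" and c
    unfolding rmul_def act_def by (intro ext) (metis mult.assoc s_commute)
  then have "koszul_op n x (koszul_op n x v) = act h (\<Sum>l<n. \<Sum>i<l. contract l (contract i (rmul v (z (i, l)))))"
    by (simp only: koszul_op_koszul_op z contract_act act_sum)
  moreover have "vpow (Suc r) (\<Sum>l<n. \<Sum>i<l. contract l (contract i (rmul v (z (i, l)))))"
    by (intro vpow_sum vpow_contract vpow_rmul[where l = "Suc 0", simplified]) (use assms z ipow_1 in auto)
  ultimately show ?thesis using that by blast
qed

lemma lift_vector:
  assumes "w \<in> ext_module n q" "\<And>P. w P \<in> mps_carrier n" "\<And>P. mps_order_ge r (w P)"
  obtains u where "u \<in> ext_module n q" "vpow r u" "(\<lambda>P. \<psi> (u P)) = w"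
proof -
  \<comment> \<open>Zero entries are lifted to 0, so that the lift keeps its degree.\<close>
  have "\<exists>a. ipow r a \<and> \<psi> a = w P \<and> (w P = 0 \<longrightarrow> a = 0)" for P
  proof (cases "w P = 0")
    case True
    then show ?thesis by (intro exI[of _ 0]) simp
  next
    case False
    then show ?thesis using ipow_lift[OF assms(2,3)] by blast
  qed
  then have "\<forall>P. \<exists>a. ipow r a \<and> \<psi> a = w P \<and> (w P = 0 \<longrightarrow> a = 0)" ..
  from choice[OF this] obtain u where u: "\<forall>P. ipow r (u P) \<and> \<psi> (u P) = w P \<and> (w P = 0 \<longrightarrow> u P = 0)" ..
  then have "u \<in> ext_module n q" using assms(1) unfolding ext_module_iff by simp
  then show ?thesis using that u by auto
qed

text \<open>An element of \<open>I\<^sup>r\<^sup>+\<^sup>1\<close> is \<open>\<Sum>\<^sub>i G\<^sub>i x\<^sub>i + h c\<close>; if it vanishes modulo \<open>h\<close> then \<open>(G\<^sub>i)\<close> is a Koszul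
  \<open>1\<close>-cycle modulo \<open>h\<close>, hence a boundary, and the Koszul differential squares to a multiple of \<open>h\<close>.\<close>

lemma ipow_divide_h:
  assumes "ipow (Suc r) b" "\<psi> b = 0"
  shows "\<exists>c. b = h * c \<and> ipow r c"
  using assms
proof (induction r arbitrary: b)
  case 0
  then show ?case using psi_ker ipow_0 by blast
next
  case (Suc r)
  obtain g c where g: "\<forall>i. ipow (Suc r) (g i)" "ipow (Suc r) c" "b = (\<Sum>i<n. g i * x i) + h * c"
    using ipow_decomposition[OF Suc.prems(1)] by blast
  \<comment> \<open>The coefficients \<open>g i\<close> become the entries of a 1-chain whose Koszul
    boundary is the sum of the \<open>g i * x i\<close>.\<close>
  define G where "G = (\<lambda>P. if \<exists>i<n. P = {i} then g (the_elem P) else 0)"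
  have G1: "G {i} = g i" if "i < n" for i using that by (auto simp: G_def)
  have G0: "G (insert i T) = 0" if "i \<notin> T" "T \<noteq> {}" for i T
    using that unfolding G_def by (auto simp: insert_eq_iff doubleton_eq_iff)
  have KG: "koszul_op n x G = (\<lambda>T. if T = {} then \<Sum>i<n. g i * x i else 0)"
  proof
    fix T
    have "koszul_op n x G T = (\<Sum>i<n. contract i (rmul G (x i)) T)"
      by (simp add: koszul_op_def sum_fun_apply)
    also have "\<dots> = (\<Sum>i<n. if T = {} then g i * x i else 0)"
      by (intro sum.cong refl) (auto simp: contract_def rmul_def G1 G0)
    finally show "koszul_op n x G T = (if T = {} then \<Sum>i<n. g i * x i else 0)" by simp
  qed
  have Gext: "G \<in> ext_module n 1"
    unfolding ext_module_iff G_def by auto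
  have Gpow: "vpow (Suc r) G" using g by (simp add: G_def)
  have "\<psi> (\<Sum>i<n. g i * x i) = 0"
    using Suc.prems(2) unfolding g(3) psi_add psi_h_mult by (simp only: add_0_right)
  then have "(\<lambda>T. \<psi> (koszul_op n x G T)) = 0"
    unfolding KG by (intro ext) simp
  then have cyc: "mps_koszul n (\<lambda>P. \<psi> (G P)) = 0" unfolding psi_koszul_op .
  have ext: "(\<lambda>P. \<psi> (G P)) \<in> ext_module n 1"
    using Gext by (simp add: ext_module_iff)
  have ord: "mps_order_ge (Suc r) (\<psi> (G P))" for P using Gpow ipow_psi_order by blast
  obtain w where w: "w \<in> ext_module n (Suc 1)" "\<And>P. w P \<in> mps_carrier n"
     "\<And>P. mps_order_ge (Suc r - 1) (w P)" "mps_koszul n w = (\<lambda>P. \<psi> (G P))"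
    by (rule mps_koszul_exact[OF ext psi_carrier cyc _ ord]) auto
  obtain W where W: "W \<in> ext_module n (Suc 1)" "vpow r W" "(\<lambda>P. \<psi> (W P)) = w"
    using lift_vector[OF w(1-3)] by auto
  have "\<psi> (koszul_op n x W P) = \<psi> (G P)" for P
    using psi_koszul_op[of W] W(3) w(4) by (simp add: fun_eq_iff)
  then have "\<psi> ((G - koszul_op n x W) P) = 0" for P by (simp add: psi.diff)
  \<comment> \<open>The entries of this difference vanish modulo \<open>h\<close> and lie in
    \<open>I^(r+1)\<close>, so the induction hypothesis divides them by \<open>h\<close> at level
    \<open>r\<close>; the outer Koszul operator then restores the lost level.\<close>
  moreover have "vpow (Suc r) (G - koszul_op n x W)"
    using vpow_diff Gpow vpow_koszul_op[OF W(2)] by blast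
  ultimately have "\<forall>P. \<exists>c. (G - koszul_op n x W) P = h * c \<and> ipow r c" using Suc.IH by blast
  from choice[OF this] obtain K where K: "\<forall>P. (G - koszul_op n x W) P = h * K P \<and> ipow r (K P)" ..
  then have "G = koszul_op n x W + act h K" by (auto simp: fun_eq_iff act_def algebra_simps)
  then have KG2: "koszul_op n x G = koszul_op n x (koszul_op n x W) + act h (koszul_op n x K)"
    by (simp only: koszul_op_add koszul_op_act)
  obtain u where u: "koszul_op n x (koszul_op n x W) = act h u" "vpow (Suc r) u"
    using koszul_op_square[OF W(2)] by blast
  have "(\<Sum>i<n. g i * x i) = h * (u {} + koszul_op n x K {})"
    using fun_cong[OF KG2, of "{}"] by (simp add: KG u act_def algebra_simps)
  then have "b = h * (u {} + koszul_op n x K {} + c)" by (simp add: g(3) algebra_simps)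
  moreover have "ipow (Suc r) (u {} + koszul_op n x K {} + c)"
    using u vpow_koszul_op K g by (intro ipow_add) blast+
  ultimately show ?case by blast
qed

lemma ipow_h_iff: "ipow (Suc r) (h * a) \<longleftrightarrow> ipow r a"
  using ipow_divide_h[of r "h * a"] ipow_h by (auto simp: psi_h_mult h_cancel)

lemma ipow_h_power_iff: "ipow (m + r) (h ^ m * a) \<longleftrightarrow> ipow r a"
  by (induction m) (auto simp: mult.assoc ipow_h_iff)

end

section \<open>The deformed Chevalley-Eilenberg resolution\<close>

definition unit_vec :: "nat set \<Rightarrow> nat set \<Rightarrow> 'a::ring_1" where
  "unit_vec P = (\<lambda>Q. if Q = P then 1 else 0)"

lemma unit_vec_ext: "P \<subseteq> {..<n} \<Longrightarrow> card P = q \<Longrightarrow> unit_vec P \<in> ext_module n q"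
  by (simp add: unit_vec_def ext_module_iff)

lemma ext_module_outside:
  "v \<in> ext_module n q \<Longrightarrow> \<not> (P \<subseteq> {..<n} \<and> card P = q) \<Longrightarrow> v P = 0"
  unfolding ext_module_iff by (erule allE, erule mp)

lemma mat_op_unit_vec: "P \<subseteq> {..<n} \<Longrightarrow> mat_op n M (unit_vec P) = M P"
proof
  fix T assume "P \<subseteq> {..<n}"
  have "mat_op n M (unit_vec P) T = (\<Sum>Q\<in>Pow {..<n}. if Q = P then M Q T else 0)"
    unfolding mat_op_def unit_vec_def by (intro sum.cong) auto
  then show "mat_op n M (unit_vec P) T = M P T" using \<open>P \<subseteq> {..<n}\<close> by simp
qed

lemma ext_module_expand:
  assumes "v \<in> ext_module n q"
  shows "v = (\<Sum>P\<in>Pow {..<n}. act (v P) (unit_vec P))"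
proof
  fix T
  have "(\<Sum>P\<in>Pow {..<n}. act (v P) (unit_vec P)) T = (\<Sum>P\<in>Pow {..<n}. if P = T then v P else 0)"
    unfolding sum_fun_apply act_def unit_vec_def by (intro sum.cong) auto
  then show "v T = (\<Sum>P\<in>Pow {..<n}. act (v P) (unit_vec P)) T"
    using assms by (auto simp: ext_module_iff)
qed

lemma linear_op_mat_op:
  fixes L :: "(nat set \<Rightarrow> 'a::ring_1) \<Rightarrow> nat set \<Rightarrow> 'a"
  assumes add: "\<And>v w. L (v + w) = L v + L w" and act: "\<And>a v. L (act a v) = act a (L v)"
    and v: "v \<in> ext_module n q"
  shows "L v = mat_op n (\<lambda>P. L (unit_vec P)) v"
proof -
  have "act 0 w = 0" for w :: "nat set \<Rightarrow> 'a" by (simp add: act_def fun_eq_iff)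
  then have "L 0 = 0" using act[of 0 0] by (simp only:)
  then have L_sum: "L (\<Sum>P\<in>A. f P) = (\<Sum>P\<in>A. L (f P))" for A and f :: "nat set \<Rightarrow> _"
    by (induction A rule: infinite_finite_induct)
      (simp_all only: sum.infinite sum.empty sum.insert add not_False_eq_True)
  have "L v = (\<Sum>P\<in>Pow {..<n}. act (v P) (L (unit_vec P)))"
    by (subst ext_module_expand[OF v]) (simp only: L_sum act)
  then show ?thesis by (simp add: mat_op_def fun_eq_iff sum_fun_apply act_def)
qed

lemma mat_op_mat_op:
  assumes "\<And>P. P \<subseteq> {..<n} \<Longrightarrow> card P = q \<Longrightarrow> mat_op n M (N P) = 0" "v \<in> ext_module n q"
  shows "mat_op n M (mat_op n N v) = 0"
proof -
  have "mat_op n M (mat_op n N v) = mat_op n (\<lambda>P. mat_op n M (mat_op n N (unit_vec P))) v"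
    by (rule linear_op_mat_op[OF _ _ assms(2)]) (simp_all only: mat_op_add mat_op_act)
  also have "\<dots> = 0"
  proof
    fix T
    have "v P * mat_op n M (mat_op n N (unit_vec P)) T = 0" if "P \<subseteq> {..<n}" for P
    proof (cases "card P = q")
      case True
      then show ?thesis using assms(1)[OF that] by (simp add: mat_op_unit_vec[OF that])
    next
      case False
      then show ?thesis using assms(2) by (simp add: ext_module_iff)
    qed
    then show "mat_op n (\<lambda>P. mat_op n M (mat_op n N (unit_vec P))) v T = (0 :: nat set \<Rightarrow> 'a) T"
      unfolding mat_op_def[of n "\<lambda>P. mat_op n M (mat_op n N (unit_vec P))"] zero_fun_apply
      by (intro sum.neutral ballI) blast
  qed
  finally show ?thesis .
qed

text \<open>The augmentation is \<open>e\<close> applied to the entry at the empty set. In degree 0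
  the vanishing of the counit takes the place of the cycle condition, so that one hypothesis covers
  exactness at every spot.\<close>

lemma resolution_of_trivial_moduleI:
  fixes M :: "nat set \<Rightarrow> nat set \<Rightarrow> 'a::ring_1" and e :: "'a \<Rightarrow> 'k::field fps"
  assumes add: "\<And>a b. e (a + b) = e a + e b" and mult: "\<And>a b. e (a * b) = e a * e b"
    and surj: "\<And>c. \<exists>a. e a = c"
    and degree: "\<And>q v. v \<in> ext_module n (Suc q) \<Longrightarrow> mat_op n M v \<in> ext_module n q"
    and square: "\<And>q v. v \<in> ext_module n q \<Longrightarrow> mat_op n M (mat_op n M v) = 0"
    and aug: "\<And>v. v \<in> ext_module n (Suc 0) \<Longrightarrow> e (mat_op n M v {}) = 0"
    and exact: "\<And>q v. v \<in> ext_module n q \<Longrightarrow> (q > 0 \<Longrightarrow> mat_op n M v = 0) \<Longrightarrow>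
        (q = 0 \<Longrightarrow> e (v {}) = 0) \<Longrightarrow> \<exists>w\<in>ext_module n (Suc q). v = mat_op n M w"
  shows "resolution_of_trivial_module n e (\<lambda>q. mat_op n M)"
  unfolding resolution_of_trivial_module_def
proof (intro conjI allI)
  fix q
  show "mat_op n M ` ext_module n (Suc q) \<subseteq> ext_module n q" using degree by blast
  show "{v \<in> ext_module n (Suc q). mat_op n M v = 0} = mat_op n M ` ext_module n (Suc (Suc q))"
  proof (intro equalityI subsetI)
    fix v assume "v \<in> {v \<in> ext_module n (Suc q). mat_op n M v = 0}"
    then show "v \<in> mat_op n M ` ext_module n (Suc (Suc q))" using exact[of v "Suc q"] by auto
  next
    fix v assume "v \<in> mat_op n M ` ext_module n (Suc (Suc q))"
    then show "v \<in> {v \<in> ext_module n (Suc q). mat_op n M v = 0}" using degree square by auto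
  qed
next
  define ag where "ag v = e (v {})" for v :: "nat set \<Rightarrow> 'a"
  have "{v \<in> ext_module n 0. ag v = 0} = mat_op n M ` ext_module n 1"
  proof (intro equalityI subsetI)
    fix v assume "v \<in> {v \<in> ext_module n 0. ag v = 0}"
    then show "v \<in> mat_op n M ` ext_module n 1" using exact[of v 0] by (auto simp: ag_def)
  next
    fix v assume "v \<in> mat_op n M ` ext_module n 1"
    then show "v \<in> {v \<in> ext_module n 0. ag v = 0}" using degree[of _ 0] aug by (auto simp: ag_def)
  qed
  moreover have "ag ` ext_module n 0 = UNIV"
  proof (intro equalityI subsetI UNIV_I)
    fix c
    obtain a where "e a = c" using surj by blast
    then have "ag (act a (unit_vec {})) = c" by (simp add: ag_def act_def unit_vec_def)
    moreover have "act a (unit_vec {}) \<in> ext_module n 0" by (intro ext_module_act unit_vec_ext) auto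
    ultimately show "c \<in> ag ` ext_module n 0" by force
  qed
  ultimately show "\<exists>aug. (\<forall>v\<in>ext_module n 0. \<forall>w\<in>ext_module n 0. aug (v + w) = aug v + aug w) \<and>
     (\<forall>a. \<forall>v\<in>ext_module n 0. aug (act a v) = e a * aug v) \<and>
     {v \<in> ext_module n 0. aug v = 0} = mat_op n M ` ext_module n 1 \<and> aug ` ext_module n 0 = UNIV"
    by (intro exI[of _ ag]) (simp add: ag_def add act_def mult)
qed (intro ballI mat_op_add mat_op_act)+

lemma mat_op_ext_module:
  assumes M: "\<And>P T. P \<subseteq> {..<n} \<Longrightarrow> M P T \<noteq> 0 \<Longrightarrow> T \<subseteq> {..<n} \<and> card P = Suc (card T)"
    and v: "v \<in> ext_module n (Suc q)"
  shows "mat_op n M v \<in> ext_module n q"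
  unfolding ext_module_iff mat_op_def
proof (intro allI impI sum.neutral ballI)
  fix T P assume "\<not> (T \<subseteq> {..<n} \<and> card T = q)" "P \<in> Pow {..<n}"
  then show "v P * M P T = 0"
    using M[of P T] v by (cases "M P T = 0") (auto simp: ext_module_iff)
qed

section \<open>Degrees of the operators\<close>

lemma contract_ext_module:
  assumes "v \<in> ext_module n (Suc q)" shows "contract i v \<in> ext_module n q"
  unfolding ext_module_iff
proof (intro allI impI)
  fix T assume T: "\<not> (T \<subseteq> {..<n} \<and> card T = q)"
  have "v (insert i T) = 0" if "i \<notin> T"
  proof -
    have "\<not> (insert i T \<subseteq> {..<n} \<and> card (insert i T) = Suc q)"
      using T that by (metis card_insert_disjoint finite_lessThan finite_subset insert_subset nat.inject)
    then show ?thesis by (rule ext_module_outside[OF assms])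
  qed
  then show "contract i v T = 0" by (simp add: contract_def)
qed

lemma contract_ext_module_0:
  assumes "v \<in> ext_module n 0" shows "contract i v = 0"
proof
  fix T
  have "\<not> (insert i T \<subseteq> {..<n} \<and> card (insert i T) = 0)"
    by (metis card_0_eq empty_not_insert finite_lessThan finite_subset)
  then have "v (insert i T) = 0" by (rule ext_module_outside[OF assms])
  then show "contract i v T = (0 :: nat set \<Rightarrow> 'a) T" by (simp add: contract_def)
qed

lemma wedge_op_ext_module:
  assumes "v \<in> ext_module n q" "i < n" shows "wedge_op i v \<in> ext_module n (Suc q)"
  unfolding ext_module_iff
proof (intro allI impI)
  fix T assume T: "\<not> (T \<subseteq> {..<n} \<and> card T = Suc q)"
  have "v (T - {i}) = 0" if "i \<in> T"
  proof -
    have "T - {i} \<subseteq> {..<n} \<Longrightarrow> finite T" by (metis finite_Diff2 finite_insert finite.emptyI finite_lessThan finite_subset)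
    then have "\<not> (T - {i} \<subseteq> {..<n} \<and> card (T - {i}) = q)"
      using T that assms(2) by (metis card_Suc_Diff1 insert_Diff insert_subset lessThan_iff)
    then show ?thesis by (rule ext_module_outside[OF assms(1)])
  qed
  then show "wedge_op i v T = 0" by (simp add: wedge_op_def)
qed

lemma rmul_ext_module: "v \<in> ext_module n q \<Longrightarrow> rmul v a \<in> ext_module n q"
  by (simp add: ext_module_iff rmul_def)

lemma ext_module_sum: "(\<And>i. i \<in> A \<Longrightarrow> f i \<in> ext_module n q) \<Longrightarrow> (\<Sum>i\<in>A. f i) \<in> ext_module n q"
  by (simp add: ext_module_iff sum_fun_apply)

lemma koszul_op_ext_module: "v \<in> ext_module n (Suc q) \<Longrightarrow> koszul_op n y v \<in> ext_module n q"
  unfolding koszul_op_def by (intro ext_module_sum contract_ext_module rmul_ext_module)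

lemma koszul_op_ext_module_0: "v \<in> ext_module n 0 \<Longrightarrow> koszul_op n y v = 0"
  unfolding koszul_op_def by (intro sum.neutral ballI contract_ext_module_0 rmul_ext_module)

lemma bracket_op_ext_module_1:
  assumes "v \<in> ext_module n (Suc 0)" shows "bracket_op n c v = 0"
proof -
  have "contract i (contract l (rmul v a)) = 0" for i l a
    by (intro contract_ext_module_0[of _ n] contract_ext_module rmul_ext_module assms)
  then show ?thesis unfolding bracket_op_def by (intro sum.neutral ballI) simp
qed

lemma bracket_op_ext_module_0:
  assumes "v \<in> ext_module n 0" shows "bracket_op n c v = 0"
proof -
  have "contract l (rmul v a) = 0" for l a
    by (intro contract_ext_module_0[of _ n] rmul_ext_module assms)
  then show ?thesis unfolding bracket_op_def by (intro sum.neutral ballI) simp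
qed

lemma bracket_op_ext_module: "v \<in> ext_module n (Suc q) \<Longrightarrow> bracket_op n c v \<in> ext_module n q"
proof (cases q)
  case 0
  then show "v \<in> ext_module n (Suc q) \<Longrightarrow> ?thesis"
    using bracket_op_ext_module_1[of v n c] ext_module_zero by metis
next
  case (Suc q')
  then show "v \<in> ext_module n (Suc q) \<Longrightarrow> ?thesis"
    unfolding bracket_op_def
    by (auto intro!: ext_module_sum wedge_op_ext_module contract_ext_module rmul_ext_module)
qed

lemma bracket_op_empty: "bracket_op n c v {} = 0"
  unfolding bracket_op_def sum_fun_apply by (intro sum.neutral ballI) (simp add: wedge_op_def)

text \<open>The structure constants enter through the linear part of \<open>h^-1 [x_i, x_l]\<close>,
  read modulo \<open>I^2\<close>.\<close>

locale quantum_lie = quantum_series s \<epsilon> \<psi> n x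
  for s :: "'k::field_char_0 fps \<Rightarrow> 'a::ring_1" and \<epsilon> \<psi> n x +
  fixes C :: "nat \<Rightarrow> nat \<Rightarrow> nat \<Rightarrow> 'k"
  assumes bracket: "i < n \<Longrightarrow> l < n \<Longrightarrow>
     \<exists>w. x i * x l - x l * x i = h * ((\<Sum>a<n. s (fps_const (C i l a)) * x a) + w) \<and> ipow (Suc (Suc 0)) w"
begin

abbreviation cc :: "nat \<Rightarrow> nat \<Rightarrow> nat \<Rightarrow> 'a" where "cc i l a \<equiv> s (fps_const (C i l a))"

definition rest :: "nat \<Rightarrow> nat \<Rightarrow> 'a" where
  "rest i l = (SOME w. x i * x l - x l * x i = h * ((\<Sum>a<n. cc i l a * x a) + w) \<and> ipow (Suc (Suc 0)) w)"

lemma rest: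
  assumes "i < n" "l < n"
  shows "x i * x l - x l * x i = h * ((\<Sum>a<n. cc i l a * x a) + rest i l)" "ipow (Suc (Suc 0)) (rest i l)"
  using someI_ex[OF bracket[OF assms]] by (simp_all add: rest_def)

text \<open>Modulo \<open>h\<close> an element of \<open>I^2\<close> has no linear terms, while the
  coefficient of \<open>X_b\<close> in the sum is \<open>c b\<close>.\<close>

lemma x_independent:
  assumes "ipow (Suc (Suc 0)) (\<Sum>a<n. s (fps_const (c a)) * x a)" "b < n"
  shows "c b = 0"
proof -
  have "\<psi> (\<Sum>a<n. s (fps_const (c a)) * x a) {#b#} = 0"
    using ipow_psi_order[OF assms(1)] by (simp add: mps_order_ge_def)
  moreover have "\<psi> (\<Sum>a<n. s (fps_const (c a)) * x a) {#b#} = (\<Sum>a<n. if a = b then c a else 0)"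
    unfolding psi.sum sum_fun_apply
    by (intro sum.cong refl) (auto simp: psi_mult_x mps_shift_def psi_s)
  ultimately show ?thesis using assms(2) by simp
qed

lemma C_alternating: assumes "i < n" "a < n" shows "C i i a = 0"
proof -
  have "(\<Sum>a<n. cc i i a * x a) + rest i i = 0"
    using rest(1)[of i i] h_torsion_free assms by simp
  then have "(\<Sum>a<n. cc i i a * x a) = - rest i i" by (simp add: eq_neg_iff_add_eq_0)
  then show ?thesis using x_independent[of "C i i"] assms rest(2) ipow_uminus by metis
qed

text \<open>Commutators are antisymmetric, so the linear parts for the two orders add up to an
  element of \<open>I^2\<close>.\<close>

lemma C_antisym: assumes "i < n" "l < n" "a < n" shows "C i l a = - C l i a"
proof -
  have "h * (((\<Sum>a<n. cc i l a * x a) + rest i l) + ((\<Sum>a<n. cc l i a * x a) + rest l i)) = 0"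
    unfolding distrib_left[of h "_ + rest i l"] rest(1)[OF assms(1,2), symmetric] rest(1)[OF assms(2,1), symmetric]
    by simp
  then have "((\<Sum>a<n. cc i l a * x a) + rest i l) + ((\<Sum>a<n. cc l i a * x a) + rest l i) = 0"
    by (rule h_torsion_free)
  then have "((\<Sum>a<n. cc i l a * x a) + (\<Sum>a<n. cc l i a * x a)) + (rest i l + rest l i) = 0"
    by (simp only: ac_simps)
  moreover have "(\<Sum>a<n. cc i l a * x a) + (\<Sum>a<n. cc l i a * x a)
      = (\<Sum>a<n. s (fps_const (C i l a + C l i a)) * x a)"
    by (simp add: sum.distrib[symmetric] distrib_right s_add flip: fps_const_add)
  ultimately have "(\<Sum>a<n. s (fps_const (C i l a + C l i a)) * x a) = - (rest i l + rest l i)"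
    by (simp only: eq_neg_iff_add_eq_0)
  moreover have "ipow (Suc (Suc 0)) (- (rest i l + rest l i))"
    using rest(2) assms by (intro ipow_uminus ipow_add)
  ultimately have "C i l a + C l i a = 0"
    using x_independent[of "\<lambda>a. C i l a + C l i a"] assms by metis
  then show ?thesis by (simp add: eq_neg_iff_add_eq_0)
qed

text \<open>Corrections are indexed by subsets here, one row for each basis vector;
  \<open>word_coeff\<close> makes the passage to words.\<close>

definition dmat :: "(nat set \<Rightarrow> nat set \<Rightarrow> 'a) \<Rightarrow> nat set \<Rightarrow> nat set \<Rightarrow> 'a" where
  "dmat \<alpha> P = koszul_op n x (unit_vec P) + act h (bracket_op n cc (unit_vec P)) + act h (\<alpha> P)"

abbreviation dop :: "(nat set \<Rightarrow> nat set \<Rightarrow> 'a) \<Rightarrow> (nat set \<Rightarrow> 'a) \<Rightarrow> nat set \<Rightarrow> 'a" where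
  "dop \<alpha> \<equiv> mat_op n (dmat \<alpha>)"

text \<open>Leaving degree 1 uncorrected makes its image consist of left combinations of the
  \<open>x i\<close>, on which the counit is exactly 0 and not merely 0 modulo
  \<open>h\<close>.\<close>

definition correction :: "(nat set \<Rightarrow> nat set \<Rightarrow> 'a) \<Rightarrow> bool" where
  "correction \<alpha> \<longleftrightarrow> (\<forall>P T. aug (\<alpha> P T)) \<and>
     (\<forall>P T. \<alpha> P T \<noteq> 0 \<longrightarrow> P \<subseteq> {..<n} \<and> T \<subseteq> {..<n} \<and> card P = Suc (card T)) \<and>
     (\<forall>P T. card P \<le> 1 \<longrightarrow> \<alpha> P T = 0)"

lemma correction_row: "correction \<alpha> \<Longrightarrow> card P = Suc q \<Longrightarrow> \<alpha> P \<in> ext_module n q"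
  unfolding correction_def ext_module_iff by (metis nat.inject)

lemma dop_eq:
  assumes "v \<in> ext_module n q"
  shows "dop \<alpha> v = koszul_op n x v + act h (bracket_op n cc v) + act h (mat_op n \<alpha> v)"
proof -
  have "koszul_op n x v = mat_op n (\<lambda>P. koszul_op n x (unit_vec P)) v"
    by (rule linear_op_mat_op[OF _ _ assms]) (simp_all only: koszul_op_add koszul_op_act)
  moreover have "bracket_op n cc v = mat_op n (\<lambda>P. bracket_op n cc (unit_vec P)) v"
    by (rule linear_op_mat_op[OF _ _ assms]) (simp_all only: bracket_op_add bracket_op_act)
  moreover have "dop \<alpha> v T = mat_op n (\<lambda>P. koszul_op n x (unit_vec P)) v T
     + (h * mat_op n (\<lambda>P. bracket_op n cc (unit_vec P)) v T + h * mat_op n \<alpha> v T)" for T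
  proof -
    have "b * (h * c) = h * (b * c)" for b c by (metis mult.assoc s_commute)
    then show ?thesis unfolding mat_op_def sum_distrib_left sum.distrib[symmetric]
      by (intro sum.cong refl) (simp add: dmat_def act_def distrib_left)
  qed
  ultimately show ?thesis by (simp add: fun_eq_iff act_def add.assoc)
qed

lemma dmat_ext_module:
  assumes "correction \<alpha>" "P \<subseteq> {..<n}" "card P = Suc q"
  shows "dmat \<alpha> P \<in> ext_module n q"
  unfolding dmat_def
  by (intro ext_module_add ext_module_act koszul_op_ext_module bracket_op_ext_module unit_vec_ext
      correction_row assms)

lemma dmat_empty: "correction \<alpha> \<Longrightarrow> dmat \<alpha> {} = 0"
proof -
  assume a: "correction \<alpha>"
  have "(unit_vec {} :: nat set \<Rightarrow> 'a) \<in> ext_module n 0" by (rule unit_vec_ext) auto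
  moreover have "\<alpha> {} = 0" using a by (auto simp: correction_def fun_eq_iff)
  ultimately show ?thesis
    unfolding dmat_def by (simp only: koszul_op_ext_module_0 bracket_op_ext_module_0 act_zero add_0_right)
qed

lemma dmat_degree:
  assumes \<alpha>: "correction \<alpha>" and P: "P \<subseteq> {..<n}" "dmat \<alpha> P T \<noteq> 0"
  shows "T \<subseteq> {..<n} \<and> card P = Suc (card T)"
proof -
  have "P \<noteq> {}" using dmat_empty[OF \<alpha>] P(2) by (metis zero_fun_apply)
  then obtain q where "card P = Suc q" using P by (metis card_0_eq finite_lessThan finite_subset not0_implies_Suc)
  then show ?thesis
    using ext_module_outside[OF dmat_ext_module[OF \<alpha> P(1)], of q T] P(2) by auto
qed

lemma dop_ext_module: "correction \<alpha> \<Longrightarrow> v \<in> ext_module n (Suc q) \<Longrightarrow> dop \<alpha> v \<in> ext_module n q"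
  by (rule mat_op_ext_module[OF dmat_degree])

lemma dop_ext_module_0:
  assumes \<alpha>: "correction \<alpha>" and v: "v \<in> ext_module n 0" shows "dop \<alpha> v = 0"
proof
  fix T
  have "dop \<alpha> v T = 0"
    unfolding mat_op_def
  proof (intro sum.neutral ballI)
    fix P assume "P \<in> Pow {..<n}"
    show "v P * dmat \<alpha> P T = 0"
    proof (cases "P = {}")
      case True
      then show ?thesis using dmat_empty[OF \<alpha>] by simp
    next
      case False
      then have "card P \<noteq> 0"
        using \<open>P \<in> Pow {..<n}\<close> by (metis PowD card_0_eq finite_lessThan finite_subset)
      then have "v P = 0" by (intro ext_module_outside[OF v]) simp
      then show ?thesis by simp
    qed
  qed
  then show "dop \<alpha> v T = (0 :: nat set \<Rightarrow> 'a) T" by simp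
qed

lemma vpow_mat_op: "vpow r v \<Longrightarrow> (\<And>P T. ipow l (M P T)) \<Longrightarrow> vpow (r + l) (mat_op n M v)"
  unfolding mat_op_def by (auto intro!: ipow_sum ipow_mult)

lemma vpow_dmat: "vpow (Suc 0) (dmat \<alpha> P)"
  unfolding dmat_def by (intro vpow_add vpow_koszul_op vpow_act_h) (simp_all add: ipow_0)

lemma vpow_dop: "vpow r v \<Longrightarrow> vpow (Suc r) (dop \<alpha> v)"
  using vpow_mat_op[of r v "Suc 0"] vpow_dmat by simp

lemma psi_dop:
  assumes "v \<in> ext_module n q"
  shows "(\<lambda>T. \<psi> (dop \<alpha> v T)) = mps_koszul n (\<lambda>P. \<psi> (v P))"
  unfolding dop_eq[OF assms] psi_koszul_op[symmetric] plus_fun_apply act_def psi_add psi_h_mult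
  by (intro ext) simp

lemma eps_koszul_op: "\<epsilon> (koszul_op n x v T) = 0"
proof -
  have "\<epsilon> (contract i (rmul v (x i)) T) = 0" if "i < n" for i
    using that by (simp add: contract_def rmul_def eps.minus eps_mult eps_x)
  then show ?thesis unfolding koszul_op_def sum_fun_apply eps.sum by (intro sum.neutral) auto
qed

lemma eps_dop:
  assumes \<alpha>: "correction \<alpha>" and v: "v \<in> ext_module n (Suc 0)"
  shows "\<epsilon> (dop \<alpha> v T) = 0"
proof -
  have "mat_op n \<alpha> v T = 0"
    unfolding mat_op_def
  proof (intro sum.neutral ballI)
    fix P
    show "v P * \<alpha> P T = 0"
      using \<alpha> v by (cases "card P = Suc 0") (auto simp: correction_def ext_module_iff)
  qed
  then have "dop \<alpha> v T = koszul_op n x v T"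
    unfolding dop_eq[OF v] bracket_op_ext_module_1[OF v] by (simp add: act_def)
  then show ?thesis by (simp only: eps_koszul_op)
qed

text \<open>The differential squares to zero on degree \<open>q\<close>; a separate condition for
  each degree because the corrections are built by induction on it.\<close>

definition closed_at :: "nat \<Rightarrow> (nat set \<Rightarrow> nat set \<Rightarrow> 'a) \<Rightarrow> bool" where
  "closed_at q \<alpha> \<longleftrightarrow> (\<forall>P. P \<subseteq> {..<n} \<longrightarrow> card P = q \<longrightarrow> dop \<alpha> (dmat \<alpha> P) = 0)"

lemma dop_dop:
  assumes "closed_at q \<alpha>" "v \<in> ext_module n q"
  shows "dop \<alpha> (dop \<alpha> v) = 0"
  by (rule mat_op_mat_op[OF _ assms(2)]) (use assms(1) in \<open>simp add: closed_at_def\<close>)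

text \<open>The condition in degree \<open>q + 1\<close> makes the remainder
  \<open>v - dop \<alpha> W\<close> a cycle again, hence also its quotient by \<open>h\<close>. Only
  this degree enters, so the lemma is available while the higher corrections are still to be
  constructed.\<close>

lemma strict_exactness:
  assumes \<alpha>: "correction \<alpha>" "closed_at (Suc q) \<alpha>"
    and v: "v \<in> ext_module n q" "dop \<alpha> v = 0" "q = 0 \<Longrightarrow> \<epsilon> (v {}) = 0" "vpow r v"
  shows "\<exists>w\<in>ext_module n (Suc q). vpow (r - 1) w \<and> v = dop \<alpha> w"
proof -
  define Z where "Z r = {v \<in> ext_module n q. dop \<alpha> v = 0 \<and> (q = 0 \<longrightarrow> \<epsilon> (v {}) = 0) \<and> vpow r v}" for r
  show ?thesis
  proof (rule h_adic_lifting[where Z = Z and J = ipow])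
    fix r v assume "v \<in> Z r"
    then have v: "v \<in> ext_module n q" "dop \<alpha> v = 0" "q = 0 \<Longrightarrow> \<epsilon> (v {}) = 0" "vpow r v"
      by (auto simp: Z_def)
    have psi_ext: "(\<lambda>P. \<psi> (v P)) \<in> ext_module n q" using v(1) by (simp add: ext_module_iff)
    have cyc: "mps_koszul n (\<lambda>P. \<psi> (v P)) = 0"
      unfolding psi_dop[OF v(1), of \<alpha>, symmetric] v(2) by (intro ext) simp
    have aug: "\<psi> (v {}) {#} = 0" if "q = 0" using v(3)[OF that] by (simp add: psi_const)
    have ord: "mps_order_ge r (\<psi> (v P))" for P using v(4) ipow_psi_order by blast
    obtain w where w: "w \<in> ext_module n (Suc q)" "\<And>P. w P \<in> mps_carrier n"
      "\<And>P. mps_order_ge (r - 1) (w P)" "mps_koszul n w = (\<lambda>P. \<psi> (v P))"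
      by (rule mps_koszul_exact[OF psi_ext psi_carrier cyc aug ord]) auto
    obtain W where W: "W \<in> ext_module n (Suc q)" "vpow (r - 1) W" "(\<lambda>P. \<psi> (W P)) = w"
      using lift_vector[OF w(1-3)] by auto
    define u where "u = v - dop \<alpha> W"
    have psi_u: "\<psi> (u P) = 0" for P
    proof -
      have "\<psi> (dop \<alpha> W P) = \<psi> (v P)"
        using fun_cong[OF psi_dop[OF W(1), of \<alpha>], of P] W(3) w(4) by (simp add: fun_eq_iff)
      then show ?thesis by (simp add: u_def psi.diff)
    qed
    \<comment> \<open>At \<open>r = 0\<close> divisibility by \<open>h\<close> suffices; for
      positive \<open>r\<close> the division costs one level by
      \<open>ipow_divide_h\<close>.\<close>
    have "\<exists>c. u P = h * c \<and> ipow (r - 1) c" for P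
    proof (cases r)
      case 0
      then show ?thesis using psi_ker[OF psi_u] ipow_0 by auto
    next
      case (Suc r')
      then have "vpow (Suc r') u"
        unfolding u_def using vpow_diff[OF v(4)] vpow_dop[OF W(2)] by simp
      then show ?thesis using ipow_divide_h[OF _ psi_u] Suc by simp
    qed
    then have "\<forall>P. \<exists>c. u P = h * c \<and> ipow (r - 1) c" ..
    from choice[OF this] obtain v' where v': "\<forall>P. u P = h * v' P \<and> ipow (r - 1) (v' P)" ..
    then have u: "u = act h v'" by (simp add: act_def fun_eq_iff)
    have "u \<in> ext_module n q" unfolding u_def by (intro ext_module_diff v dop_ext_module \<alpha> W)
    then have v'_ext: "v' \<in> ext_module n q" unfolding u act_h_ext_module .
    have "dop \<alpha> u = 0" unfolding u_def mat_op_diff v(2) dop_dop[OF \<alpha>(2) W(1)] by simp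
    then have "act h (dop \<alpha> v') = act h 0" unfolding u mat_op_act act_zero .
    then have v'_cyc: "dop \<alpha> v' = 0" unfolding act_h_cancel .
    have v'_aug: "\<epsilon> (v' {}) = 0" if "q = 0"
    proof -
      have "\<epsilon> (u {}) = 0"
        using v(3)[OF that] eps_dop[OF \<alpha>(1), of W "{}"] W(1) that by (simp add: u_def eps.diff)
      then show ?thesis by (simp add: u act_def eps_mult eps_s)
    qed
    have "v' \<in> Z (r - 1)" using v' v'_ext v'_cyc v'_aug by (auto simp: Z_def)
    moreover have "v = dop \<alpha> W + act h v'" using u by (simp add: u_def algebra_simps)
    ultimately show "\<exists>w v'. w \<in> ext_module n (Suc q) \<and> vpow (r - 1) w \<and> v' \<in> Z (r - 1) \<and> v = dop \<alpha> w + act h v'"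
      using W by blast
  next
    show "v \<in> Z r" using v by (simp add: Z_def)
  qed (auto intro: ipow_0 ipow_add ipow_h ipow_Suc_imp)
qed

end

section \<open>Construction of the corrections\<close>

context quantum_lie
begin

text \<open>Scalars from \<open>k\<close> and not from \<open>k[[h]]\<close>: a nonzero one does not
  vanish modulo \<open>h\<close>, which is what \<open>constant_cycle\<close> detects.\<close>

definition const_elem :: "'a \<Rightarrow> bool" where "const_elem a \<longleftrightarrow> (\<exists>c. a = s (fps_const c))"

lemma const_elem_zero: "const_elem 0"
  unfolding const_elem_def by (intro exI[of _ 0]) simp
lemma const_elem_one: "const_elem 1"
  unfolding const_elem_def by (intro exI[of _ 1]) (simp add: s_one)
lemma const_elem_add: "const_elem a \<Longrightarrow> const_elem b \<Longrightarrow> const_elem (a + b)"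
  unfolding const_elem_def by (metis fps_const_add s_add)
lemma const_elem_mult: "const_elem a \<Longrightarrow> const_elem b \<Longrightarrow> const_elem (a * b)"
  unfolding const_elem_def by (metis fps_const_mult s_mult)
lemma const_elem_uminus: "const_elem a \<Longrightarrow> const_elem (- a)"
  unfolding const_elem_def by (metis fps_const_neg s.minus)
lemma const_elem_sum: "(\<And>i. i \<in> A \<Longrightarrow> const_elem (f i)) \<Longrightarrow> const_elem (\<Sum>i\<in>A. f i)"
  by (induction A rule: infinite_finite_induct) (auto intro: const_elem_zero const_elem_add)

lemma const_elem_contract: "\<forall>T. const_elem (v T) \<Longrightarrow> \<forall>T. const_elem (contract i v T)"
  by (auto simp: contract_def intro: const_elem_zero const_elem_uminus)
lemma const_elem_wedge_op: "\<forall>T. const_elem (v T) \<Longrightarrow> \<forall>T. const_elem (wedge_op i v T)"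
  by (auto simp: wedge_op_def intro: const_elem_zero const_elem_uminus)
lemma const_elem_rmul: "\<forall>T. const_elem (v T) \<Longrightarrow> const_elem a \<Longrightarrow> \<forall>T. const_elem (rmul v a T)"
  by (auto simp: rmul_def intro: const_elem_mult)

lemma const_elem_bracket_op:
  assumes "\<forall>T. const_elem (v T)" shows "\<forall>T. const_elem (bracket_op n cc v T)"
proof -
  have c: "const_elem (cc i l a)" for i l a by (auto simp: const_elem_def)
  have "\<forall>T. const_elem (wedge_op a (contract i (contract l (rmul v (cc i l a)))) T)" for i l a
    by (intro const_elem_wedge_op const_elem_contract const_elem_rmul assms c)
  then show ?thesis unfolding bracket_op_def sum_fun_apply by (auto intro!: const_elem_sum)
qed

text \<open>The commutators of the \<open>x\<^sub>i\<close> cancel against the anticommutator of the Koszul and the bracket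
  operator.\<close>

lemma leading_square:
  assumes "e \<in> ext_module n q"
  obtains Q where "vpow (Suc (Suc 0)) Q"
    "koszul_op n x (koszul_op n x e) + act h (koszul_op n x (bracket_op n cc e) + bracket_op n cc (koszul_op n x e))
       = act h Q"
proof -
  let ?c = "\<lambda>l i b. contract l (contract i (rmul e b))"
  have rh: "rmul e (h * b) = act h (rmul e b)" for b
    unfolding rmul_def act_def by (intro ext) (metis mult.assoc s_commute)
  have "koszul_op n x (koszul_op n x e)
      = (\<Sum>l<n. \<Sum>i<l. act h (?c l i (\<Sum>a<n. cc i l a * x a) + ?c l i (rest i l)))"
    unfolding koszul_op_koszul_op
  proof (intro sum.cong refl)
    fix l i assume li: "l \<in> {..<n}" "i \<in> {..<l}"
    then have "i < n" "l < n" by auto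
    show "?c l i (x i * x l - x l * x i) = act h (?c l i (\<Sum>a<n. cc i l a * x a) + ?c l i (rest i l))"
      unfolding rest(1)[OF \<open>i < n\<close> \<open>l < n\<close>] rh contract_act rmul_add_right contract_add ..
  qed
  also have "\<dots> = act h ((\<Sum>l<n. \<Sum>i<l. ?c l i (\<Sum>a<n. cc i l a * x a)) + (\<Sum>l<n. \<Sum>i<l. ?c l i (rest i l)))"
    by (simp only: act_sum sum.distrib act_add)
  finally have 1: "koszul_op n x (koszul_op n x e) = \<dots>" .
  have "koszul_op n x (bracket_op n cc e) + bracket_op n cc (koszul_op n x e)
      = (\<Sum>l<n. \<Sum>i<l. ?c i l (\<Sum>a<n. cc i l a * x a))"
    by (rule koszul_bracket_anticommutator) (simp add: s_commute)
  also have "\<dots> = (\<Sum>l<n. \<Sum>i<l. - ?c l i (\<Sum>a<n. cc i l a * x a))"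
    by (intro sum.cong refl) (rule contract_contract)
  also have "\<dots> = - (\<Sum>l<n. \<Sum>i<l. ?c l i (\<Sum>a<n. cc i l a * x a))"
    by (simp only: sum_negf)
  finally have 2: "koszul_op n x (bracket_op n cc e) + bracket_op n cc (koszul_op n x e) = \<dots>" .
  show ?thesis
  proof
    show "vpow (Suc (Suc 0)) (\<Sum>l<n. \<Sum>i<l. ?c l i (rest i l))"
    proof (intro vpow_sum vpow_contract)
      fix l i assume "l \<in> {..<n}" "i \<in> {..<l}"
      then show "vpow (Suc (Suc 0)) (rmul e (rest i l))"
        using vpow_rmul[of 0 e "Suc (Suc 0)" "rest i l"] rest(2)[of i l] ipow_0 by simp
    qed
    show "koszul_op n x (koszul_op n x e) + act h (koszul_op n x (bracket_op n cc e) + bracket_op n cc (koszul_op n x e))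
       = act h (\<Sum>l<n. \<Sum>i<l. ?c l i (rest i l))"
      unfolding 1 2 act_add act_uminus by (simp only: add.assoc add.commute add.left_commute add.right_inverse add_0_right add_0_left)
  qed
qed

text \<open>Applied to the square of the bracket operator, this replaces the Jacobi identity for \<open>C\<close>.\<close>

lemma constant_cycle:
  assumes b: "b \<in> ext_module n q" "\<forall>T. const_elem (b T)" "b {} = 0"
    and ord: "vpow (Suc (Suc 0)) (dop \<alpha> b)"
  shows "b = 0"
proof
  fix P
  have "b P = 0" if "P \<subseteq> {..<n}" "i \<in> P" for i
  proof -
    define T where "T = P - {i}"
    have T: "P = insert i T" "i \<notin> T" "i < n" using that by (auto simp: T_def)
    obtain c where c: "b (insert i T) = s (fps_const c)" using b(2) by (auto simp: const_elem_def)
    \<comment> \<open>The coefficient of \<open>X_i\<close> in the boundary at \<open>T\<close> is,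
      up to sign, \<open>b (insert i T)\<close> modulo \<open>h\<close>; order at least 2 forces it
      to be 0.\<close>
    have "\<psi> (dop \<alpha> b T) {#i#} = 0"
      using ipow_psi_order[of "Suc (Suc 0)"] ord by (simp add: mps_order_ge_def)
    moreover have "\<psi> (dop \<alpha> b T) = mps_koszul n (\<lambda>P. \<psi> (b P)) T"
      by (rule fun_cong[OF psi_dop[OF b(1)]])
    moreover have "mps_koszul n (\<lambda>P. \<psi> (b P)) T {#i#} = (\<Sum>l<n. if l = i then (if npar i T then - c else c) else 0)"
      unfolding mps_koszul_apply
      by (intro sum.cong refl) (use T(2) in \<open>auto simp: c psi_s\<close>)
    ultimately have "c = 0" using T(3) by (simp split: if_splits)
    then show ?thesis using c T(1) by simp
  qed
  then show "b P = (0 :: nat set \<Rightarrow> 'a) P"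
    using b(3) ext_module_outside[OF b(1), of P] by (cases "P = {}") auto
qed

text \<open>The terms of \<open>dop \<alpha> L\<close> combine to \<open>h\<close> times
  \<open>Q' + h b\<close>. Here \<open>Q'\<close> has entries in \<open>I^2\<close>, by
  \<open>leading_square\<close> and because both the entries of \<open>L\<close> and the corrections
  applied to it are in \<open>I\<close>. Once \<open>b = 0\<close>, strict exactness provides the
  primitive \<open>w\<close> with entries in \<open>I\<close>.\<close>

lemma obstruction:
  assumes \<alpha>: "correction \<alpha>" "closed_at (Suc q) \<alpha>" "closed_at q \<alpha>"
    and P: "P \<subseteq> {..<n}" "card P = Suc (Suc q)" "\<alpha> P = 0"
  shows "\<exists>w\<in>ext_module n (Suc q). vpow (Suc 0) w \<and> dop \<alpha> (dmat \<alpha> P) = act h (dop \<alpha> w)"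
proof -
  define e where "e = (unit_vec P :: nat set \<Rightarrow> 'a)"
  have e: "e \<in> ext_module n (Suc (Suc q))" unfolding e_def by (rule unit_vec_ext[OF P(1,2)])
  define L where "L = dmat \<alpha> P"
  have L: "L \<in> ext_module n (Suc q)" unfolding L_def by (rule dmat_ext_module[OF \<alpha>(1) P(1,2)])
  have L_eq: "L = koszul_op n x e + act h (bracket_op n cc e)"
    unfolding L_def dmat_def e_def P(3) act_zero add_0_right ..
  obtain Q where Q: "vpow (Suc (Suc 0)) Q"
    "koszul_op n x (koszul_op n x e) + act h (koszul_op n x (bracket_op n cc e) + bracket_op n cc (koszul_op n x e)) = act h Q"
    using leading_square[OF e] by blast
  define b where "b = bracket_op n cc (bracket_op n cc e)"
  define Q' where "Q' = Q + mat_op n \<alpha> L"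
  have "vpow (Suc 0 + Suc 0) (mat_op n \<alpha> L)"
    using \<alpha>(1) vpow_dmat[of \<alpha> P] by (intro vpow_mat_op) (auto simp: L_def correction_def ipow_1)
  then have Q': "vpow (Suc (Suc 0)) Q'" using Q(1) unfolding Q'_def by (intro vpow_add) auto
  have R: "dop \<alpha> L = act h (Q' + act h b)"
  proof -
    have "dop \<alpha> L = (koszul_op n x (koszul_op n x e) +
        act h (koszul_op n x (bracket_op n cc e) + bracket_op n cc (koszul_op n x e)))
        + act h (act h b) + act h (mat_op n \<alpha> L)"
      unfolding dop_eq[OF L] unfolding L_eq b_def
      by (simp only: koszul_op_add koszul_op_act bracket_op_add bracket_op_act act_add ac_simps)
    from this[unfolded Q(2)] show ?thesis unfolding Q'_def act_add by (simp only: ac_simps)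
  qed
  define R' where "R' = Q' + act h b"
  have "act h R' \<in> ext_module n q" unfolding R'_def R[symmetric] by (rule dop_ext_module[OF \<alpha>(1) L])
  then have R'_ext: "R' \<in> ext_module n q" unfolding act_h_ext_module .
  have "dop \<alpha> (dop \<alpha> L) = 0" by (rule dop_dop[OF \<alpha>(2) L])
  then have "act h (dop \<alpha> R') = act h 0" unfolding R R'_def[symmetric] mat_op_act act_zero .
  then have R'_cyc: "dop \<alpha> R' = 0" unfolding act_h_cancel .
  have b_ext: "b \<in> ext_module n q"
    unfolding b_def by (intro bracket_op_ext_module e)
  \<comment> \<open>The cycle condition gives
    \<open>h * dop \<alpha> b T = - dop \<alpha> Q' T\<close>, which lies in \<open>I^3\<close>;
    cancelling \<open>h\<close> leaves \<open>I^2\<close>, the bound that a nonzero constant chain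
    cannot satisfy.\<close>
  have "b = 0"
  proof (rule constant_cycle[OF b_ext])
    have "\<forall>T. const_elem (e T)" by (auto simp: e_def unit_vec_def const_elem_zero const_elem_one)
    then show "\<forall>T. const_elem (b T)" unfolding b_def by (intro const_elem_bracket_op)
    show "b {} = 0" unfolding b_def by (rule bracket_op_empty)
    show "vpow (Suc (Suc 0)) (dop \<alpha> b)"
    proof
      fix T
      have "dop \<alpha> Q' + act h (dop \<alpha> b) = 0"
        using R'_cyc unfolding R'_def mat_op_add mat_op_act .
      then have "dop \<alpha> Q' T + h * dop \<alpha> b T = 0" unfolding act_def by (auto simp: fun_eq_iff)
      then have "h * dop \<alpha> b T = - dop \<alpha> Q' T" by (simp add: eq_neg_iff_add_eq_0 add.commute)
      moreover have "ipow (Suc (Suc (Suc 0))) (- dop \<alpha> Q' T)"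
        using vpow_dop[OF Q'] ipow_uminus by blast
      ultimately have "ipow (Suc (Suc (Suc 0))) (h * dop \<alpha> b T)" by (simp only:)
      then show "ipow (Suc (Suc 0)) (dop \<alpha> b T)" by (simp only: ipow_h_iff)
    qed
  qed
  then have R'_eq: "R' = Q'" unfolding R'_def by (simp only: act_zero add_0_right)
  \<comment> \<open>In degree 0 the counit takes over from the cycle condition; its vanishing passes
    from \<open>h R'\<close> to \<open>R'\<close> because \<open>h\<close> cancels in
    \<open>k[[h]]\<close>.\<close>
  have R'_eps: "\<epsilon> (R' {}) = 0" if "q = 0"
  proof -
    have "\<epsilon> (dop \<alpha> L {}) = 0" using eps_dop[OF \<alpha>(1)] L that by simp
    then have "\<epsilon> (h * R' {}) = 0" unfolding R R'_def[symmetric] by (simp only: act_def)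
    then show ?thesis by (simp add: eps_mult eps_s)
  qed
  have "vpow (Suc (Suc 0)) R'" unfolding R'_eq by (rule Q')
  from strict_exactness[OF \<alpha>(1,2) R'_ext R'_cyc R'_eps this]
  obtain w where w: "w \<in> ext_module n (Suc q)" "vpow (Suc (Suc 0) - 1) w" "R' = dop \<alpha> w"
    by blast
  show ?thesis
  proof (intro bexI conjI)
    show "vpow (Suc 0) w" using w(2) by simp
    show "dop \<alpha> (dmat \<alpha> P) = act h (dop \<alpha> w)"
      unfolding L_def[symmetric] w(3)[symmetric] R'_def by (rule R)
  qed (rule w)
qed

text \<open>The new row is \<open>- w P\<close>: it subtracts \<open>h w P\<close> from the boundary
  of \<open>P\<close> and so cancels the obstruction. Rows of other sizes stay the same, so the
  differential below degree \<open>q + 2\<close> and the squares already known to vanish do not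
  change.\<close>

lemma correction_step:
  assumes \<alpha>: "correction \<alpha>" "\<And>q'. q' \<le> Suc q \<Longrightarrow> closed_at q' \<alpha>" "\<And>P. card P > Suc q \<Longrightarrow> \<alpha> P = 0"
  shows "\<exists>\<alpha>'. correction \<alpha>' \<and> (\<forall>q'\<le>Suc (Suc q). closed_at q' \<alpha>') \<and> (\<forall>P. card P > Suc (Suc q) \<longrightarrow> \<alpha>' P = 0)"
proof -
  have "\<forall>P\<in>{P. P \<subseteq> {..<n} \<and> card P = Suc (Suc q)}. \<exists>w. w \<in> ext_module n (Suc q) \<and> vpow (Suc 0) w \<and>
      dop \<alpha> (dmat \<alpha> P) = act h (dop \<alpha> w)"
    using obstruction[OF \<alpha>(1) \<alpha>(2) \<alpha>(2), of q] \<alpha>(3) unfolding Bex_def by simp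
  from bchoice[OF this] obtain w
    where w: "\<And>P. P \<subseteq> {..<n} \<Longrightarrow> card P = Suc (Suc q) \<Longrightarrow> w P \<in> ext_module n (Suc q)"
      "\<And>P. P \<subseteq> {..<n} \<Longrightarrow> card P = Suc (Suc q) \<Longrightarrow> vpow (Suc 0) (w P)"
      "\<And>P. P \<subseteq> {..<n} \<Longrightarrow> card P = Suc (Suc q) \<Longrightarrow> dop \<alpha> (dmat \<alpha> P) = act h (dop \<alpha> (w P))"
    by blast
  define \<alpha>' where "\<alpha>' P = (if P \<subseteq> {..<n} \<and> card P = Suc (Suc q) then - w P else \<alpha> P)" for P
  have old: "\<alpha>' P = \<alpha> P" if "card P \<noteq> Suc (Suc q)" for P using that by (simp add: \<alpha>'_def)
  have new: "\<alpha>' P = - w P" if "P \<subseteq> {..<n}" "card P = Suc (Suc q)" for P using that by (simp add: \<alpha>'_def)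
  have dold: "dmat \<alpha>' P = dmat \<alpha> P" if "card P \<noteq> Suc (Suc q)" for P
    unfolding dmat_def old[OF that] ..
  have dop_old: "dop \<alpha>' v = dop \<alpha> v" if v: "v \<in> ext_module n l" "l \<noteq> Suc (Suc q)" for v l
  proof
    fix T
    show "dop \<alpha>' v T = dop \<alpha> v T"
      unfolding mat_op_def
    proof (intro sum.cong refl)
      fix P
      show "v P * dmat \<alpha>' P T = v P * dmat \<alpha> P T"
      proof (cases "card P = Suc (Suc q)")
        case True
        then have "v P = 0" using v(2) by (intro ext_module_outside[OF v(1)]) auto
        then show ?thesis by simp
      next
        case False
        show ?thesis unfolding dold[OF False] ..
      qed
    qed
  qed
  have corr: "correction \<alpha>'"
    unfolding correction_def
  proof (intro conjI allI impI)
    fix P T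
    show "aug (\<alpha>' P T)"
    proof (cases "P \<subseteq> {..<n} \<and> card P = Suc (Suc q)")
      case True
      then show ?thesis using w(2)[of P] by (simp add: new ipow_1 eps.minus)
    next
      case False
      then have "\<alpha>' P = \<alpha> P" unfolding \<alpha>'_def by (rule if_not_P)
      then show ?thesis using \<alpha>(1) by (simp add: correction_def)
    qed
    show "\<alpha>' P T = 0" if "card P \<le> 1"
    proof -
      have "\<alpha>' P = \<alpha> P" by (rule old) (use that in simp)
      then show ?thesis using \<alpha>(1) that by (simp add: correction_def)
    qed
    assume nz: "\<alpha>' P T \<noteq> 0"
    have "P \<subseteq> {..<n} \<and> T \<subseteq> {..<n} \<and> card P = Suc (card T)"
    proof (cases "P \<subseteq> {..<n} \<and> card P = Suc (Suc q)")
      case True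
      then have "w P T \<noteq> 0" using nz new[of P] by simp
      then have "T \<subseteq> {..<n} \<and> card T = Suc q" using ext_module_outside[OF w(1)[of P], of T] True by blast
      then show ?thesis using True by simp
    next
      case False
      then have "\<alpha>' P = \<alpha> P" unfolding \<alpha>'_def by (rule if_not_P)
      then have "\<alpha> P T \<noteq> 0" using nz by simp
      then show ?thesis using \<alpha>(1) unfolding correction_def by blast
    qed
    then show "P \<subseteq> {..<n}" "T \<subseteq> {..<n}" "card P = Suc (card T)" by auto
  qed
  have "closed_at q' \<alpha>'" if q': "q' \<le> Suc (Suc q)" for q'
    unfolding closed_at_def
  proof (intro allI impI)
    fix P assume P: "P \<subseteq> {..<n}" "card P = q'"
    show "dop \<alpha>' (dmat \<alpha>' P) = 0"
    proof (cases "q' = Suc (Suc q)")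
      case False
      then have "dmat \<alpha>' P = dmat \<alpha> P" using P by (intro dold) simp
      moreover have "dop \<alpha>' (dmat \<alpha> P) = dop \<alpha> (dmat \<alpha> P)"
      proof (cases q')
        case 0
        then have "P = {}" using P by (metis card_0_eq finite_lessThan finite_subset)
        then show ?thesis using dmat_empty[OF \<alpha>(1)] by (simp only: mat_op_zero)
      next
        case (Suc l)
        then show ?thesis using q' by (intro dop_old[OF dmat_ext_module[OF \<alpha>(1) P(1)], of l]) (simp_all add: P)
      qed
      moreover have "dop \<alpha> (dmat \<alpha> P) = 0"
        using \<alpha>(2)[of q'] False q' P unfolding closed_at_def by auto
      ultimately show ?thesis by (simp only:)
    next
      case True
      then have P': "card P = Suc (Suc q)" using P by simp
      have "\<alpha> P = 0" by (rule \<alpha>(3)) (simp add: P')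
      then have eq: "dmat \<alpha>' P = dmat \<alpha> P - act h (w P)"
        unfolding dmat_def new[OF P(1) P'] act_uminus by (simp only: act_zero add_0_right diff_conv_add_uminus)
      have ext: "dmat \<alpha> P - act h (w P) \<in> ext_module n (Suc q)"
        by (intro ext_module_diff ext_module_act w P P' dmat_ext_module[OF \<alpha>(1) P(1) P'])
      have "dop \<alpha>' (dmat \<alpha>' P) = dop \<alpha> (dmat \<alpha> P - act h (w P))"
        unfolding eq by (rule dop_old[OF ext]) simp
      also have "\<dots> = 0" unfolding mat_op_diff mat_op_act w(3)[OF P(1) P'] by (rule diff_self)
      finally show ?thesis .
    qed
  qed
  moreover have "\<alpha>' P = 0" if "card P > Suc (Suc q)" for P
    unfolding old[OF less_imp_neq[OF that, symmetric]] by (rule \<alpha>(3)) (use that in simp)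
  ultimately show ?thesis using corr by blast
qed

lemma correction_upto:
  "\<exists>\<alpha>. correction \<alpha> \<and> (\<forall>q'\<le>Suc q. closed_at q' \<alpha>) \<and> (\<forall>P. card P > Suc q \<longrightarrow> \<alpha> P = 0)"
proof (induction q)
  case 0
  have c: "correction (\<lambda>P. 0)" by (simp add: correction_def)
  have "closed_at q' (\<lambda>P. 0)" if "q' \<le> Suc 0" for q'
    unfolding closed_at_def
  proof (intro allI impI)
    fix P assume P: "P \<subseteq> {..<n}" "card P = q'"
    show "dop (\<lambda>P. 0) (dmat (\<lambda>P. 0) P) = 0"
    proof (cases q')
      case 0
      then have "P = {}" using P by (metis card_0_eq finite_lessThan finite_subset)
      then show ?thesis using dmat_empty[OF c] by (simp only: mat_op_zero)
    next
      case (Suc l)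
      then have "card P = Suc 0" using P that by simp
      then show ?thesis by (intro dop_ext_module_0[OF c] dmat_ext_module[OF c P(1)])
    qed
  qed
  then show ?case using c by blast
next
  case (Suc q)
  then obtain \<alpha> where "correction \<alpha>" "\<And>q'. q' \<le> Suc q \<Longrightarrow> closed_at q' \<alpha>" "\<And>P. card P > Suc q \<Longrightarrow> \<alpha> P = 0"
    by blast
  then show ?case by (rule correction_step)
qed

text \<open>A subset of \<open>{..<n}\<close> has at most \<open>n\<close> elements, so finitely
  many steps settle every degree.\<close>

lemma correction_exists: "\<exists>\<alpha>. correction \<alpha> \<and> (\<forall>q. closed_at q \<alpha>)"
proof -
  obtain \<alpha> where \<alpha>: "correction \<alpha>" "\<And>q'. q' \<le> Suc n \<Longrightarrow> closed_at q' \<alpha>"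
    using correction_upto[of n] by blast
  have "closed_at q \<alpha>" for q
  proof (cases "q \<le> Suc n")
    case False
    have "card P \<noteq> q" if "P \<subseteq> {..<n}" for P
      using False card_mono[OF finite_lessThan that] by simp
    then show ?thesis by (auto simp: closed_at_def)
  qed (rule \<alpha>(2))
  then show ?thesis using \<alpha>(1) by blast
qed

lemma resolution:
  assumes \<alpha>: "correction \<alpha>" "\<And>q. closed_at q \<alpha>"
  shows "resolution_of_trivial_module n \<epsilon> (\<lambda>q. dop \<alpha>)"
proof (rule resolution_of_trivial_moduleI[OF eps_add eps_mult])
  fix q v assume v: "v \<in> ext_module n q" "q > 0 \<Longrightarrow> dop \<alpha> v = 0" "q = 0 \<Longrightarrow> \<epsilon> (v {}) = 0"
  have "dop \<alpha> v = 0" using v(1,2) dop_ext_module_0[OF \<alpha>(1)] by (cases "q = 0") auto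
  then show "\<exists>w\<in>ext_module n (Suc q). v = dop \<alpha> w"
    using strict_exactness[OF \<alpha> v(1) _ v(3), of 0] ipow_0 by blast
qed (use eps_s in blast, rule dop_ext_module[OF \<alpha>(1)], assumption, rule dop_dop[OF \<alpha>(2)], assumption,
  rule eps_dop[OF \<alpha>(1)], assumption)

end

section \<open>Coefficients indexed by words\<close>

lemma finite_words [simp]: "finite (words n q)"
  unfolding words_def using finite_lists_length_eq[of "{..<n}" q] by simp

lemma inversions_sorted: "sorted_wrt (<) t \<Longrightarrow> inversions t = {}"
  by (auto simp: inversions_def sorted_wrt_iff_nth_less dest: order.asym)

text \<open>Each finite subset comes from exactly one strictly sorted word, and that word has no
  inversions and hence sign 1.\<close>

lemma sum_sorted_words:
  "(\<Sum>t\<in>words n q. wedge (if sorted_wrt (<) t then f (set t) else 0) t)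
     = (\<lambda>T. if T \<subseteq> {..<n} \<and> card T = q then f T else 0)"
proof
  fix T :: "nat set"
  let ?t = "sorted_list_of_set (T :: nat set)"
  have "wedge (if sorted_wrt (<) t then f (set t) else 0) t T
      = (if t = ?t then if T \<subseteq> {..<n} \<and> card T = q then f T else 0 else 0)" if "t \<in> words n q" for t
  proof (cases "sorted_wrt (<) t \<and> T = set t")
    case True
    then have t: "distinct t" "sorted t" by (auto simp: strict_sorted_iff)
    then have "t = ?t" using True by (simp add: sorted_list_of_set.idem_if_sorted_distinct)
    moreover have "T \<subseteq> {..<n} \<and> card T = q"
      using that True t(1) by (auto simp: words_def distinct_card)
    ultimately have "(if t = ?t then if T \<subseteq> {..<n} \<and> card T = q then f T else 0 else 0) = f T"
      by (rule trans[OF if_P if_P])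
    moreover have "wedge (if sorted_wrt (<) t then f (set t) else 0) t T = f T"
      using True t(1) by (simp add: wedge_def inversions_sorted)
    ultimately show ?thesis by (simp only:)
  next
    case False
    have "t \<noteq> ?t" if "T \<subseteq> {..<n}"
    proof -
      have "finite T" using that finite_subset by blast
      then show ?thesis using False by (metis set_sorted_list_of_set strict_sorted_list_of_set)
    qed
    then show ?thesis using False by (auto simp: wedge_def)
  qed
  then have "(\<Sum>t\<in>words n q. wedge (if sorted_wrt (<) t then f (set t) else 0) t) T
      = (\<Sum>t\<in>words n q. if t = ?t then if T \<subseteq> {..<n} \<and> card T = q then f T else 0 else 0)"
    unfolding sum_fun_apply by (intro sum.cong refl)
  also have "\<dots> = (if ?t \<in> words n q then if T \<subseteq> {..<n} \<and> card T = q then f T else 0 else 0)"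
    by simp
  also have "\<dots> = (if T \<subseteq> {..<n} \<and> card T = q then f T else 0)"
  proof -
    have "?t \<in> words n q" if "T \<subseteq> {..<n}" "card T = q"
    proof -
      have "finite T" using that finite_subset by blast
      then show ?thesis using that by (simp add: words_def)
    qed
    then show ?thesis by auto
  qed
  finally show "(\<Sum>t\<in>words n q. wedge (if sorted_wrt (<) t then f (set t) else 0) t) T
      = (if T \<subseteq> {..<n} \<and> card T = q then f T else 0)" .
qed

lemma wedge_unit_vec:
  "wedge 1 p = (if distinct p then act ((- 1) ^ card (inversions p)) (unit_vec (set p)) else 0)"
  by (auto simp: wedge_def act_def unit_vec_def fun_eq_iff)

lemma wedge_ext_module: "p \<in> words n q \<Longrightarrow> wedge a p \<in> ext_module n q"
  by (auto simp: wedge_def ext_module_iff words_def distinct_card)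

text \<open>Coefficients for arbitrary words: antisymmetric in the source word, and concentrated on sorted
  target words so that each target subset is counted once.\<close>

definition word_coeff :: "(nat set \<Rightarrow> nat set \<Rightarrow> 'a::ring_1) \<Rightarrow> nat list \<Rightarrow> nat list \<Rightarrow> 'a" where
  "word_coeff \<alpha> p t =
     (if distinct p \<and> sorted_wrt (<) t then (- 1) ^ card (inversions p) * \<alpha> (set p) (set t) else 0)"

lemma minus_one_power_cases: "(- 1 :: 'a::ring_1) ^ k = 1 \<or> (- 1 :: 'a) ^ k = - 1"
  by (cases "even k") simp_all

lemma sum_word_coeff:
  assumes p: "p \<in> words n (Suc q)"
    and \<alpha>: "\<And>P T. \<alpha> P T \<noteq> 0 \<Longrightarrow> T \<subseteq> {..<n} \<and> card P = Suc (card T)"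
  shows "(\<Sum>t\<in>words n q. wedge (a * word_coeff \<alpha> p t) t) = act a (mat_op n \<alpha> (wedge 1 p))"
proof -
  let ?s = "(- 1) ^ card (inversions p)"
  have "mat_op n \<alpha> (wedge 1 p) = (if distinct p then act ?s (\<alpha> (set p)) else 0)"
    using p by (simp add: wedge_unit_vec mat_op_act mat_op_unit_vec words_def del: zero_fun_apply)
  moreover have "(\<Sum>t\<in>words n q. wedge (a * word_coeff \<alpha> p t) t)
      = act a (if distinct p then act ?s (\<alpha> (set p)) else 0)"
  proof (cases "distinct p")
    case True
    have "(\<Sum>t\<in>words n q. wedge (a * word_coeff \<alpha> p t) t) =
       (\<Sum>t\<in>words n q. wedge (if sorted_wrt (<) t then a * (?s * \<alpha> (set p) (set t)) else 0) t)"
      using True by (intro sum.cong refl) (simp add: word_coeff_def)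
    also have "\<dots> = (\<lambda>T. if T \<subseteq> {..<n} \<and> card T = q then a * (?s * \<alpha> (set p) T) else 0)"
      by (rule sum_sorted_words)
    also have "\<dots> = act a (act ?s (\<alpha> (set p)))"
    proof
      fix T
      have "card (set p) = Suc q" using True p by (simp add: words_def distinct_card)
      then have "\<alpha> (set p) T = 0" if "\<not> (T \<subseteq> {..<n} \<and> card T = q)"
        using \<alpha>[of "set p" T] that by auto
      then show "(if T \<subseteq> {..<n} \<and> card T = q then a * (?s * \<alpha> (set p) T) else 0) = act a (act ?s (\<alpha> (set p))) T"
        by (auto simp: act_def)
    qed
    finally show ?thesis using True by simp
  next
    case False
    then have "(\<Sum>t\<in>words n q. wedge (a * word_coeff \<alpha> p t) t) = (\<Sum>t\<in>words n q. 0)"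
      by (intro sum.cong refl) (simp add: word_coeff_def del: zero_fun_apply)
    then show ?thesis using False by (simp del: zero_fun_apply)
  qed
  ultimately show ?thesis by (simp only:)
qed

text \<open>The formula is additive in its coefficients, up to signs, so additivity of
  \<open>\<theta>\<close> on a set that contains them is enough. It serves for division by
  \<open>h\<close>, which is additive on \<open>I\<close>, and for the identity, to exchange
  generators that agree only below \<open>n\<close>.\<close>

lemma koszul_formula_transfer:
  fixes \<theta> :: "'a::ring_1 \<Rightarrow> 'b::ring_1"
  assumes zero: "0 \<in> I" "\<theta> 0 = 0"
    and add: "\<And>a b. a \<in> I \<Longrightarrow> b \<in> I \<Longrightarrow> a + b \<in> I \<and> \<theta> (a + b) = \<theta> a + \<theta> b"
    and neg: "\<And>a. a \<in> I \<Longrightarrow> - a \<in> I \<and> \<theta> (- a) = - \<theta> a"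
    and y: "\<And>i. i < n \<Longrightarrow> y i \<in> I \<and> \<theta> (y i) = y' i"
    and c: "\<And>i l a. i < n \<Longrightarrow> l < n \<Longrightarrow> a < n \<Longrightarrow> c i l a \<in> I \<and> \<theta> (c i l a) = c' i l a"
    and \<beta>: "\<And>t. t \<in> words n (length p - 1) \<Longrightarrow> \<beta> p t \<in> I \<and> \<theta> (\<beta> p t) = \<beta>' p t"
    and p: "set p \<subseteq> {..<n}"
  shows "\<theta> (koszul_formula n y c \<beta> p T) = koszul_formula n y' c' \<beta>' p T"
proof -
  have sum: "(\<Sum>i\<in>A. f i) \<in> I \<and> \<theta> (\<Sum>i\<in>A. f i) = (\<Sum>i\<in>A. g i)"
    if "\<And>i. i \<in> A \<Longrightarrow> f i \<in> I \<and> \<theta> (f i) = g i" for A :: "'i set" and f g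
    using that
  proof (induction A rule: infinite_finite_induct)
    case (insert i A)
    then show ?case using add[of "f i" "sum f A"] by simp
  qed (simp_all add: zero)
  have sgn: "(- 1) ^ k * a \<in> I \<and> \<theta> ((- 1) ^ k * a) = (- 1) ^ k * b" if "a \<in> I \<and> \<theta> a = b" for k a b
    using that neg[of a] by (cases "even k") auto
  have wedge: "wedge a t T \<in> I \<and> \<theta> (wedge a t T) = wedge b t T" if "a \<in> I \<and> \<theta> a = b" for a b t
    using sgn[OF that] zero by (simp add: wedge_def)
  have nth: "p ! i < n" if "i < length p" for i using p that nth_mem by blast
  have 1: "(\<Sum>i<length p. wedge ((- 1) ^ i * y (p ! i)) (nths p (- {i})) T) \<in> I \<and>
     \<theta> (\<Sum>i<length p. wedge ((- 1) ^ i * y (p ! i)) (nths p (- {i})) T) =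
     (\<Sum>i<length p. wedge ((- 1) ^ i * y' (p ! i)) (nths p (- {i})) T)"
    by (intro sum wedge sgn y nth) simp
  have 2: "(\<Sum>s<length p. \<Sum>r<s. \<Sum>a<n. wedge ((- 1) ^ (r + s) * c (p ! r) (p ! s) a) (a # nths p (- {r, s})) T) \<in> I \<and>
     \<theta> (\<Sum>s<length p. \<Sum>r<s. \<Sum>a<n. wedge ((- 1) ^ (r + s) * c (p ! r) (p ! s) a) (a # nths p (- {r, s})) T) =
     (\<Sum>s<length p. \<Sum>r<s. \<Sum>a<n. wedge ((- 1) ^ (r + s) * c' (p ! r) (p ! s) a) (a # nths p (- {r, s})) T)"
    by (intro sum wedge sgn c nth) auto
  have 3: "(\<Sum>t\<in>words n (length p - 1). wedge (\<beta> p t) t T) \<in> I \<and>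
     \<theta> (\<Sum>t\<in>words n (length p - 1). wedge (\<beta> p t) t T) =
     (\<Sum>t\<in>words n (length p - 1). wedge (\<beta>' p t) t T)"
    by (intro sum wedge \<beta>)
  show ?thesis
    unfolding koszul_formula_def plus_fun_apply sum_fun_apply
    using 1 2 3 add by simp
qed

context quantum_lie
begin

lemma koszul_formula_dop:
  assumes \<alpha>: "correction \<alpha>" and p: "p \<in> words n (Suc q)"
  shows "dop \<alpha> (wedge 1 p) =
    koszul_formula n x (\<lambda>i l a. h * cc i l a) (\<lambda>p t. h * word_coeff \<alpha> p t) p"
proof -
  have pn: "set p \<subseteq> {..<n}" "length p - 1 = q" using p by (auto simp: words_def)
  have rh: "rmul e (h * b) = act h (rmul e b)" for e :: "nat set \<Rightarrow> 'a" and b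
    unfolding rmul_def act_def by (intro ext) (metis mult.assoc s_commute)
  have "act h (bracket_op n cc (wedge 1 p)) = bracket_op n (\<lambda>i l a. h * cc i l a) (wedge 1 p)"
    unfolding bracket_op_def by (simp only: act_sum rh contract_act wedge_op_act)
  also have "\<dots> = (\<Sum>s<length p. \<Sum>r<s. \<Sum>a<n.
        wedge ((- 1) ^ (r + s) * (h * cc (p ! r) (p ! s) a)) (a # nths p (- {r, s})))"
  proof (rule bracket_op_wedge[OF pn(1)])
    fix i l a assume "i < n" "l < n" "a < n"
    then have "C i l a = - C l i a" by (rule C_antisym)
    then show "h * cc i l a = - (h * cc l i a)" by (simp add: s.minus flip: fps_const_neg)
  next
    fix i a assume "i < n" "a < n"
    then show "h * cc i i a = 0" by (simp add: C_alternating)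
  qed
  finally have 2: "act h (bracket_op n cc (wedge 1 p)) = \<dots>" .
  have 3: "act h (mat_op n \<alpha> (wedge 1 p)) = (\<Sum>t\<in>words n (length p - 1). wedge (h * word_coeff \<alpha> p t) t)"
    unfolding pn(2) using \<alpha> by (intro sum_word_coeff[OF p, symmetric]) (auto simp: correction_def)
  show ?thesis
    unfolding dop_eq[OF wedge_ext_module[OF p]] koszul_formula_def koszul_op_wedge[OF pn(1)] 2 3 ..
qed

lemma aug_word_coeff: "correction \<alpha> \<Longrightarrow> aug (word_coeff \<alpha> p t)"
  using minus_one_power_cases[of "card (inversions p)", where 'a = 'a]
  by (auto simp: word_coeff_def correction_def eps.minus)

end

section \<open>Passing to the dual quantization\<close>

text \<open>\<open>\<tau> m b\<close> stands for the element \<open>h\<^sup>-\<^sup>m b\<close> of the dual quantization, for \<open>b\<close> in the \<open>m\<close>-th power of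
  the augmentation ideal.\<close>

locale quantum_pair = quantum_series s \<epsilon> \<psi> n x + U: h_adic_algebra sU
  for s :: "'k::field_char_0 fps \<Rightarrow> 'a::ring_1" and \<epsilon> \<psi> n x
    and sU :: "'k fps \<Rightarrow> 'u::ring_1" +
  fixes \<tau> :: "nat \<Rightarrow> 'a \<Rightarrow> 'u" and \<epsilon>U :: "'u \<Rightarrow> 'k fps"
  assumes tau_add: "ipow m a \<Longrightarrow> ipow m b \<Longrightarrow> \<tau> m (a + b) = \<tau> m a + \<tau> m b"
    and tau_mult: "ipow m a \<Longrightarrow> ipow l b \<Longrightarrow> \<tau> (m + l) (a * b) = \<tau> m a * \<tau> l b"
    and tau_h: "ipow m a \<Longrightarrow> \<tau> (Suc m) (h * a) = \<tau> m a"
    and tau_s: "\<tau> 0 (s c) = sU c"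
    and tau_dense: "\<exists>m a u'. ipow m a \<and> u = \<tau> m a + U.h * u'"
    and tau_divide: "ipow m b \<Longrightarrow> \<tau> m b = U.h * u \<Longrightarrow> ipow (Suc m) b"
    and tau_eps: "ipow m b \<Longrightarrow> fps_X ^ m * \<epsilon>U (\<tau> m b) = \<epsilon> b"
    and epsU_add: "\<epsilon>U (u + v) = \<epsilon>U u + \<epsilon>U v"
    and epsU_mult: "\<epsilon>U (u * v) = \<epsilon>U u * \<epsilon>U v"
    and epsU_s: "\<epsilon>U (sU c) = c"
begin

sublocale epsU: additive \<epsilon>U by unfold_locales (rule epsU_add)
declare epsU.zero [simp]

lemma tau_zero [simp]: "\<tau> m 0 = 0"
  using tau_add[of m 0 0] by simp
lemma tau_uminus: "ipow m a \<Longrightarrow> \<tau> m (- a) = - \<tau> m a"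
  using tau_add[of m a "- a"] ipow_uminus[of m a] by (simp add: eq_neg_iff_add_eq_0 add.commute)
lemma tau_diff: "ipow m a \<Longrightarrow> ipow m b \<Longrightarrow> \<tau> m (a - b) = \<tau> m a - \<tau> m b"
  using tau_add[of m a "- b"] ipow_uminus[of m b] tau_uminus[of m b] by simp
lemma tau_sum: "(\<And>i. i \<in> A \<Longrightarrow> ipow m (f i)) \<Longrightarrow> \<tau> m (\<Sum>i\<in>A. f i) = (\<Sum>i\<in>A. \<tau> m (f i))"
  by (induction A rule: infinite_finite_induct) (auto simp: tau_add ipow_sum)

lemma tau_scale: "ipow m a \<Longrightarrow> \<tau> m (s c * a) = sU c * \<tau> m a"
  using tau_mult[OF ipow_0, of m a "s c"] by (simp add: tau_s)

lemma tau_h_power: "ipow m a \<Longrightarrow> \<tau> (l + m) (h ^ l * a) = \<tau> m a"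
  by (induction l) (simp_all add: mult.assoc tau_h ipow_h_power)

lemma tau_Suc: "ipow (Suc m) a \<Longrightarrow> \<tau> m a = U.h * \<tau> (Suc m) a"
  using tau_h[of m a] tau_scale[of "Suc m" a fps_X] ipow_Suc_imp by metis

definition y :: "nat \<Rightarrow> 'u" where "y i = \<tau> (Suc 0) (x i)"

lemma ipow_x: "i < n \<Longrightarrow> ipow (Suc 0) (x i)"
  by (simp add: ipow_1 aug_x)

text \<open>In the dual, \<open>[y_i, y_l]\<close> is \<open>h^-1 z\<close> where
  \<open>[x_i, x_l] = h z\<close>. That its difference from the linear part is divisible by
  \<open>h\<close> becomes, by \<open>tau_divide\<close>, membership of \<open>w\<close> in
  \<open>I^2\<close>.\<close>

lemma bracket_from_structure_constants:
  assumes C: "\<And>i l. i < n \<Longrightarrow> l < n \<Longrightarrow>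
      \<exists>u. (y i * y l - y l * y i) - (\<Sum>a<n. sU (fps_const (C i l a)) * y a) = U.h * u"
  shows "quantum_lie s \<epsilon> \<psi> n x C"
proof unfold_locales
  fix i l assume il: "i < n" "l < n"
  obtain z where z: "x i * x l - x l * x i = h * z" "aug z" using commutator by blast
  define w where "w = z - (\<Sum>a<n. s (fps_const (C i l a)) * x a)"
  have ips: "ipow (Suc 0) (\<Sum>a<n. s (fps_const (C i l a)) * x a)"
    by (intro ipow_sum ipow_lmult ipow_x) simp
  have ts: "\<tau> (Suc 0) (\<Sum>a<n. s (fps_const (C i l a)) * x a) = (\<Sum>a<n. sU (fps_const (C i l a)) * y a)"
    by (subst tau_sum) (auto simp: y_def tau_scale ipow_x intro: ipow_lmult)
  have ipw: "ipow (Suc 0) w" unfolding w_def using z by (intro ipow_diff ips) (simp add: ipow_1)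
  have 2: "ipow (Suc (Suc 0)) (x i * x l)" "ipow (Suc (Suc 0)) (x l * x i)"
    using ipow_mult[OF ipow_x ipow_x] il by auto
  have "y i * y l - y l * y i = \<tau> (Suc (Suc 0)) (x i * x l - x l * x i)"
    using tau_mult[OF ipow_x ipow_x] il tau_diff[OF 2] by (simp add: y_def)
  also have "\<dots> = \<tau> (Suc 0) z" unfolding z(1) using z(2) by (simp add: tau_h ipow_1)
  finally have "(y i * y l - y l * y i) - (\<Sum>a<n. sU (fps_const (C i l a)) * y a) = \<tau> (Suc 0) w"
    unfolding w_def using z(2) ips by (subst tau_diff) (simp_all add: ts ipow_1)
  then obtain u where "\<tau> (Suc 0) w = U.h * u" using C[OF il] by metis
  then have "ipow (Suc (Suc 0)) w" by (rule tau_divide[OF ipw])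
  moreover have "z = (\<Sum>a<n. s (fps_const (C i l a)) * x a) + w" by (simp add: w_def)
  ultimately show "\<exists>w. x i * x l - x l * x i = h * ((\<Sum>a<n. s (fps_const (C i l a)) * x a) + w) \<and> ipow (Suc (Suc 0)) w"
    using z(1) by blast
qed

text \<open>The finitely many entries are brought to one denominator by powers of \<open>h\<close>.
  The exponent is kept positive so that strict exactness can lose one level.\<close>

lemma dense_vector:
  assumes v: "v \<in> ext_module n q"
  shows "\<exists>m b u. b \<in> ext_module n q \<and> vpow (Suc m) b \<and> v = (\<lambda>P. \<tau> (Suc m) (b P)) + act U.h u"
proof -
  \<comment> \<open>Zero entries get the zero representation, so that \<open>b\<close> keeps the
    degree of \<open>v\<close>.\<close>
  define good where "good P t \<longleftrightarrow> ipow (fst t) (fst (snd t)) \<and>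
      v P = \<tau> (fst t) (fst (snd t)) + U.h * snd (snd t) \<and> (v P = 0 \<longrightarrow> t = (0, 0, 0))" for P t
  have "\<forall>P. \<exists>t. good P t"
  proof
    fix P
    show "\<exists>t. good P t"
    proof (cases "v P = 0")
      case True
      then show ?thesis by (intro exI[of _ "(0, 0, 0)"]) (simp add: good_def)
    next
      case False
      then show ?thesis using tau_dense[of "v P"] by (auto simp: good_def)
    qed
  qed
  from choice[OF this] obtain t where t: "\<forall>P. good P (t P)" ..
  define M a u where "M P = fst (t P)" and "a P = fst (snd (t P))" and "u P = snd (snd (t P))" for P
  have Ma: "ipow (M P) (a P)" "v P = \<tau> (M P) (a P) + U.h * u P" for P
    using t unfolding good_def M_def a_def u_def by blast+
  have "t P = (0, 0, 0)" if "v P = 0" for P using t that unfolding good_def by blast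
  then have Ma0: "M P = 0" "a P = 0" if "v P = 0" for P
    using that by (simp_all add: M_def a_def)
  define m where "m = (\<Sum>P\<in>Pow {..<n}. M P)"
  have M_le: "M P \<le> m" for P
  proof (cases "P \<subseteq> {..<n}")
    case True
    then show ?thesis unfolding m_def by (intro member_le_sum) auto
  next
    case False
    then have "v P = 0" by (intro ext_module_outside[OF v]) simp
    then show ?thesis using Ma0(1) by simp
  qed
  define b where "b P = h ^ (Suc m - M P) * a P" for P
  have sum: "Suc m - M P + M P = Suc m" for P using M_le[of P] by simp
  have "ipow (Suc m) (b P)" and tb: "\<tau> (Suc m) (b P) = \<tau> (M P) (a P)" for P
    using ipow_h_power[OF Ma(1), of "Suc m - M P" P] tau_h_power[OF Ma(1), of "Suc m - M P" P]
    unfolding sum b_def by auto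
  moreover have "b \<in> ext_module n q"
    unfolding ext_module_iff
  proof (intro allI impI)
    fix P assume "\<not> (P \<subseteq> {..<n} \<and> card P = q)"
    then have "v P = 0" by (rule ext_module_outside[OF v])
    then show "b P = 0" using Ma0(2) by (simp add: b_def)
  qed
  moreover have "v = (\<lambda>P. \<tau> (Suc m) (b P)) + act U.h u"
  proof
    fix P show "v P = ((\<lambda>P. \<tau> (Suc m) (b P)) + act U.h u) P"
      unfolding plus_fun_apply act_def tb by (rule Ma(2))
  qed
  ultimately show ?thesis by blast
qed

section \<open>Ordered monomials and polynomial series\<close>

lemma prod_list_x:
  assumes "set is \<subseteq> {..<n}"
  shows "ipow (\<Sum>i\<leftarrow>is. k i) (prod_list (map (\<lambda>i. x i ^ k i) is)) \<and>
     \<tau> (\<Sum>i\<leftarrow>is. k i) (prod_list (map (\<lambda>i. x i ^ k i) is)) = prod_list (map (\<lambda>i. y i ^ k i) is) \<and>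
     \<psi> (prod_list (map (\<lambda>i. x i ^ k i) is)) = mps_monom (\<Sum>i\<leftarrow>is. replicate_mset (k i) i)"
  using assms
proof (induction "is")
  case Nil
  have "\<tau> 0 1 = 1" using tau_s[of 1] by (simp add: s_one U.s_one)
  moreover have "\<psi> 1 = mps_monom {#}" using psi_s[of 1] by (simp add: s_one mps_monom_def fun_eq_iff)
  ultimately show ?case by (simp add: ipow_0)
next
  case (Cons i "is")
  have i: "i < n" using Cons by simp
  have pow: "ipow r (x i ^ r) \<and> \<tau> r (x i ^ r) = y i ^ r" for r
  proof (induction r)
    case 0
    then show ?case using tau_s[of 1] by (simp add: s_one U.s_one ipow_0)
  next
    case (Suc r)
    then show ?case
      using ipow_mult[of r "x i ^ r" "Suc 0" "x i"] tau_mult[of "Suc 0" "x i" r "x i ^ r"] ipow_x[OF i]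
      by (simp add: y_def)
  qed
  have mon: "\<psi> (x i ^ r * a) = mps_monom (replicate_mset r i + B)" if "\<psi> a = mps_monom B" for r a B
  proof (induction r)
    case 0
    then show ?case using that by simp
  next
    case (Suc r)
    have "mps_shift i (mps_monom D) = (mps_monom (add_mset i D) :: _ \<Rightarrow> 'k)" for D
      by (auto simp: mps_shift_def mps_monom_def fun_eq_iff dest: multi_member_split)
    then show ?case using Suc i
      by (simp add: mult.assoc psi_mult[of "x i"] psi_x mps_mult_commute[of "mps_monom {#i#}"] mps_mult_monom)
  qed
  show ?case
    using Cons pow[of "k i"] mon[of _ _ "k i"]
      ipow_mult[of "\<Sum>i\<leftarrow>is. k i" "prod_list (map (\<lambda>i. x i ^ k i) is)" "k i" "x i ^ k i"]
      tau_mult[of "k i" "x i ^ k i" "\<Sum>i\<leftarrow>is. k i" "prod_list (map (\<lambda>i. x i ^ k i) is)"]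
    by simp
qed

lemma mset_eq_sum_replicate:
  assumes "set_mset A \<subseteq> {..<n}"
  shows "(\<Sum>i\<leftarrow>[0..<n]. replicate_mset (count A i) i) = A"
proof -
  have "(\<Sum>i\<leftarrow>[0..<n]. replicate_mset (count A i) i) = (\<Sum>i\<in>{0..<n}. replicate_mset (count A i) i)"
    by (simp add: sum_list_distinct_conv_sum_set)
  also have "\<dots> = A"
  proof (rule multiset_eqI)
    fix b
    have "count (\<Sum>i\<in>{0..<n}. replicate_mset (count A i) i) b = (\<Sum>i\<in>{0..<n}. if i = b then count A b else 0)"
      unfolding count_sum by (intro sum.cong refl) auto
    also have "\<dots> = count A b" using assms by (auto simp: count_eq_zero_iff)
    finally show "count (\<Sum>i\<in>{0..<n}. replicate_mset (count A i) i) b = count A b" .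
  qed
  finally show ?thesis .
qed

definition x_monom :: "nat multiset \<Rightarrow> 'a" where
  "x_monom A = prod_list (map (\<lambda>i. x i ^ count A i) [0..<n])"

lemma x_monom:
  assumes "set_mset A \<subseteq> {..<n}"
  shows "ipow (size A) (x_monom A)" "\<psi> (x_monom A) = mps_monom A"
    "\<tau> (size A) (x_monom A) = prod_list (map (\<lambda>i. y i ^ count A i) [0..<n])"
proof -
  have "(\<Sum>i\<leftarrow>[0..<n]. count A i) = (\<Sum>i\<in>{0..<n}. count A i)"
    by (simp add: sum_list_distinct_conv_sum_set)
  also have "\<dots> = (\<Sum>i\<in>set_mset A. count A i)"
    using assms by (intro sum.mono_neutral_right) (auto simp: count_eq_zero_iff)
  finally have "(\<Sum>i\<leftarrow>[0..<n]. count A i) = size A" by (simp add: size_multiset_overloaded_eq)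
  then show "ipow (size A) (x_monom A)" "\<psi> (x_monom A) = mps_monom A"
    "\<tau> (size A) (x_monom A) = prod_list (map (\<lambda>i. y i ^ count A i) [0..<n])"
    using prod_list_x[of "[0..<n]" "count A"] mset_eq_sum_replicate[OF assms]
    by (auto simp: x_monom_def atLeast0LessThan)
qed

definition polys :: "'u set" where
  "polys = {\<Sum>m\<in>M. sU (fps_const (c m)) * prod_list (map (\<lambda>i. y i ^ m i) [0..<n]) | M c. finite (M :: (nat \<Rightarrow> nat) set)}"

lemma polys_add: "p \<in> polys \<Longrightarrow> q \<in> polys \<Longrightarrow> p + q \<in> polys"
proof -
  assume "p \<in> polys" "q \<in> polys"
  then obtain M c M' c' where M: "finite (M :: (nat \<Rightarrow> nat) set)" "finite (M' :: (nat \<Rightarrow> nat) set)"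
    and p: "p = (\<Sum>m\<in>M. sU (fps_const (c m)) * prod_list (map (\<lambda>i. y i ^ m i) [0..<n]))"
    and q: "q = (\<Sum>m\<in>M'. sU (fps_const (c' m)) * prod_list (map (\<lambda>i. y i ^ m i) [0..<n]))"
    unfolding polys_def by blast
  let ?Y = "\<lambda>m. prod_list (map (\<lambda>i. y i ^ m i) [0..<n])"
  have "(\<Sum>m\<in>M \<union> M'. sU (fps_const ((if m \<in> M then c m else 0) + (if m \<in> M' then c' m else 0))) * ?Y m)
     = (\<Sum>m\<in>M \<union> M'. (if m \<in> M then sU (fps_const (c m)) * ?Y m else 0))
      + (\<Sum>m\<in>M \<union> M'. (if m \<in> M' then sU (fps_const (c' m)) * ?Y m else 0))"
    unfolding sum.distrib[symmetric]
    by (intro sum.cong refl) (auto simp: U.s_add distrib_right simp flip: fps_const_add)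
  also have "(\<Sum>m\<in>M \<union> M'. (if m \<in> M then sU (fps_const (c m)) * ?Y m else 0)) = p"
    unfolding p using M by (simp add: sum.inter_restrict[symmetric] Int_absorb1)
  also have "(\<Sum>m\<in>M \<union> M'. (if m \<in> M' then sU (fps_const (c' m)) * ?Y m else 0)) = q"
    unfolding q using M by (simp add: sum.inter_restrict[symmetric] Int_absorb1)
  finally have eq: "p + q = (\<Sum>m\<in>M \<union> M'. sU (fps_const ((if m \<in> M then c m else 0) + (if m \<in> M' then c' m else 0))) * ?Y m)"
    by (rule sym)
  show ?thesis unfolding polys_def
    by (rule CollectI, rule exI, rule exI, rule conjI, rule eq) (use M in simp)
qed

text \<open>The leading form of \<open>b\<close> modulo \<open>h\<close> is lifted to a combination of ordered monomials; what remains
  is a multiple of \<open>h\<close> plus a term of the previous filtration degree.\<close>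

lemma tau_in_polys: "ipow m b \<Longrightarrow> \<exists>p\<in>polys. \<exists>u. \<tau> m b = p + U.h * u"
proof (induction m arbitrary: b rule: less_induct)
  case (less m)
  define S where "S = {A. set_mset A \<subseteq> {..<n} \<and> size A = m}"
  have "S \<subseteq> mset ` {xs. set xs \<subseteq> {..<n} \<and> length xs = m}"
  proof
    fix A assume "A \<in> S"
    moreover obtain xs where "mset xs = A" using ex_mset by blast
    ultimately show "A \<in> mset ` {xs. set xs \<subseteq> {..<n} \<and> length xs = m}"
      by (auto simp: S_def intro!: image_eqI[of _ _ xs])
  qed
  then have S: "finite S" by (rule finite_subset) (intro finite_imageI finite_lists_length_eq finite_lessThan)
  define c where "c A = s (fps_const (\<psi> b A))" for A
  define g where "g = (\<Sum>A\<in>S. c A * x_monom A)"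
  have ipg: "ipow m g"
    unfolding g_def by (intro ipow_sum ipow_lmult) (use x_monom(1) in \<open>auto simp: S_def\<close>)
  have psi_g: "\<psi> g B = (if B \<in> S then \<psi> b B else 0)" for B
  proof -
    have "\<psi> (c A * x_monom A) B = (if A = B then \<psi> b B else 0)" if "A \<in> S" for A
    proof -
      have "\<psi> (c A * x_monom A) B = (\<Sum>D | D \<subseteq># B. if D = {#} then \<psi> b A * mps_monom A B else 0)"
        unfolding psi_mult x_monom(2)[of A, OF that[unfolded S_def, THEN CollectD, THEN conjunct1]] mps_mult_def c_def psi_s
        by (intro sum.cong refl) auto
      also have "\<dots> = \<psi> b A * mps_monom A B" by simp
      finally show ?thesis by (simp add: mps_monom_def)
    qed
    then have "\<psi> g B = (\<Sum>A\<in>S. if A = B then \<psi> b B else 0)"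
      unfolding g_def psi.sum sum_fun_apply by (intro sum.cong refl)
    then show ?thesis using S by simp
  qed
  have "mps_order_ge (Suc m) (\<psi> (b - g))"
    unfolding mps_order_ge_def
  proof (intro allI impI)
    fix A :: "nat multiset" assume "size A < Suc m"
    then have "size A < m \<or> size A = m" by auto
    then consider "size A < m" | "A \<in> S" | "size A = m" "\<not> set_mset A \<subseteq> {..<n}"
      unfolding S_def by blast
    then show "\<psi> (b - g) A = 0"
    proof cases
      case 1
      then show ?thesis using ipow_psi_order[OF less.prems] by (auto simp: psi.diff psi_g S_def mps_order_ge_def)
    next
      case 3
      then have "A \<notin> S" by (simp add: S_def)
      moreover have "\<psi> b A = 0" using psi_carrier[of b] 3 unfolding mps_carrier_def by blast
      ultimately show ?thesis by (simp add: psi.diff psi_g)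
    qed (simp add: psi.diff psi_g)
  qed
  \<comment> \<open>The part of order above \<open>m\<close> lifts to \<open>I^(m+1)\<close>, and
    \<open>\<tau> m\<close> of such a lift is a multiple of \<open>h\<close>.\<close>
  from ipow_lift[OF psi_carrier this] obtain e where e: "ipow (Suc m) e" "\<psi> e = \<psi> (b - g)" by blast
  have ipe: "ipow m e" using e(1) by (rule ipow_Suc_imp)
  have "\<psi> (b - g - e) = 0" unfolding psi.diff[of "b - g"] e(2) by (rule diff_self)
  moreover have ipr: "ipow m (b - g - e)" by (intro ipow_diff less.prems ipg ipe)
  \<comment> \<open>The remainder is divisible by \<open>h\<close>. For \<open>m = 0\<close> it maps
    to a multiple of \<open>h\<close> in the dual; otherwise the division lowers \<open>m\<close>
    and the induction hypothesis applies.\<close>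
  ultimately have rest: "\<exists>p\<in>polys. \<exists>u. \<tau> m (b - g - e) = p + U.h * u"
  proof (cases m)
    case 0
    obtain f where "b - g - e = h * f" using psi_ker[OF \<open>\<psi> (b - g - e) = 0\<close>] by blast
    then have "\<tau> m (b - g - e) = U.h * \<tau> 0 f" using tau_scale[OF ipow_0] 0 by simp
    moreover have "0 \<in> polys" unfolding polys_def by (auto intro!: exI[of _ "{}"])
    ultimately show ?thesis by (intro bexI[of _ 0] exI[of _ "\<tau> 0 f"]) simp_all
  next
    case (Suc m')
    obtain f where f: "b - g - e = h * f" "ipow m' f"
      using ipow_divide_h[of m' "b - g - e"] \<open>\<psi> (b - g - e) = 0\<close> ipr Suc by blast
    then have "\<tau> m (b - g - e) = \<tau> m' f" using Suc by (simp add: tau_h)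
    then show ?thesis using less.IH[of m' f] f Suc by simp
  qed
  then obtain p u where pu: "p \<in> polys" "\<tau> m (b - g - e) = p + U.h * u" by blast
  have "\<tau> m g = (\<Sum>A\<in>S. sU (fps_const (\<psi> b A)) * prod_list (map (\<lambda>i. y i ^ count A i) [0..<n]))"
    unfolding g_def
    by (subst tau_sum) (use x_monom in \<open>auto simp: S_def c_def tau_scale intro!: sum.cong ipow_lmult\<close>)
  also have "\<dots> = (\<Sum>k\<in>count ` S. sU (fps_const (\<psi> b (Abs_multiset k))) * prod_list (map (\<lambda>i. y i ^ k i) [0..<n]))"
    by (subst sum.reindex) (auto simp: inj_on_def count_inject count_inverse)
  finally have tg: "\<tau> m g = \<dots>" .
  have "\<tau> m g \<in> polys" unfolding polys_def
    by (rule CollectI, rule exI[of _ "count ` S"], rule exI[of _ "\<lambda>k. \<psi> b (Abs_multiset k)"])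
      (use tg S in simp)
  then have "\<tau> m g + p \<in> polys" using pu polys_add by blast
  moreover have "\<tau> m b = (\<tau> m g + p) + U.h * (u + \<tau> (Suc m) e)"
  proof -
    have "\<tau> m b = \<tau> m (g + ((b - g - e) + e))" by simp
    also have "\<dots> = \<tau> m g + (\<tau> m (b - g - e) + \<tau> m e)"
      by (simp only: tau_add ipow_add ipg ipr ipe)
    finally show ?thesis unfolding pu tau_Suc[OF e(1)] by (simp add: algebra_simps)
  qed
  ultimately show ?case by blast
qed

lemma poly_series:
  "\<exists>P. (\<forall>N. P N \<in> polys) \<and> (\<forall>M. \<exists>r. u - (\<Sum>N<M. U.h ^ N * P N) = U.h ^ M * r)"
proof -
  have "\<forall>u. \<exists>t. fst t \<in> polys \<and> u = fst t + U.h * snd t"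
  proof
    fix u
    obtain m a u' where "ipow m a" "u = \<tau> m a + U.h * u'" using tau_dense by blast
    moreover obtain p r where "p \<in> polys" "\<tau> m a = p + U.h * r" using tau_in_polys[OF \<open>ipow m a\<close>] by blast
    ultimately show "\<exists>t. fst t \<in> polys \<and> u = fst t + U.h * snd t"
      by (intro exI[of _ "(p, r + u')"]) (simp add: algebra_simps)
  qed
  from choice[OF this] obtain t where t: "\<forall>u. fst (t u) \<in> polys \<and> u = fst (t u) + U.h * snd (t u)" ..
  define r where "r N = ((\<lambda>u. snd (t u)) ^^ N) u" for N
  have step: "r N = fst (t (r N)) + U.h * r (Suc N)" for N using t[rule_format, of "r N"] by (simp add: r_def)
  have "u - (\<Sum>N<M. U.h ^ N * fst (t (r N))) = U.h ^ M * r M" for M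
  proof (induction M)
    case 0
    then show ?case by (simp add: r_def)
  next
    case (Suc M)
    have "U.h ^ M * r M = U.h ^ M * fst (t (r M)) + U.h ^ Suc M * r (Suc M)"
      by (subst step) (simp add: distrib_left mult.assoc U.h_power_commute)
    then show ?case using Suc by (simp add: algebra_simps)
  qed
  then show ?thesis using t by (intro exI[of _ "\<lambda>N. fst (t (r N))"]) auto
qed

end

section \<open>The complex over the dual\<close>

locale quantum_lie_pair = quantum_lie s \<epsilon> \<psi> n x C + quantum_pair s \<epsilon> \<psi> n x sU \<tau> \<epsilon>U
  for s :: "'k::field_char_0 fps \<Rightarrow> 'a::ring_1" and \<epsilon> \<psi> n x C
    and sU :: "'k fps \<Rightarrow> 'u::ring_1" and \<tau> \<epsilon>U
begin

definition umat :: "(nat set \<Rightarrow> nat set \<Rightarrow> 'a) \<Rightarrow> nat set \<Rightarrow> nat set \<Rightarrow> 'u" where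
  "umat \<alpha> P T = \<tau> (Suc 0) (dmat \<alpha> P T)"

abbreviation uop :: "(nat set \<Rightarrow> nat set \<Rightarrow> 'a) \<Rightarrow> (nat set \<Rightarrow> 'u) \<Rightarrow> nat set \<Rightarrow> 'u" where
  "uop \<alpha> \<equiv> mat_op n (umat \<alpha>)"

abbreviation tauv :: "nat \<Rightarrow> (nat set \<Rightarrow> 'a) \<Rightarrow> nat set \<Rightarrow> 'u" where
  "tauv m v \<equiv> (\<lambda>P. \<tau> m (v P))"

text \<open>The dictionary between the complexes: a chain \<open>h^-m v\<close> times the matrix
  \<open>h^-1 M\<close> is \<open>h^-(m+1)\<close> times the boundary of \<open>v\<close>.\<close>

lemma uop_tauv: "vpow m v \<Longrightarrow> uop \<alpha> (tauv m v) = tauv (Suc m) (dop \<alpha> v)"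
proof
  fix T assume v: "vpow m v"
  have M: "ipow (Suc 0) (dmat \<alpha> P T)" for P using vpow_dmat by blast
  have "uop \<alpha> (tauv m v) T = (\<Sum>P\<in>Pow {..<n}. \<tau> (Suc m) (v P * dmat \<alpha> P T))"
    unfolding mat_op_def umat_def using v tau_mult[OF _ M, of m] by (intro sum.cong refl) simp
  also have "\<dots> = \<tau> (Suc m) (dop \<alpha> v T)"
    unfolding mat_op_def using v ipow_mult[OF M, of m] by (intro tau_sum[symmetric]) simp
  finally show "uop \<alpha> (tauv m v) T = \<tau> (Suc m) (dop \<alpha> v T)" .
qed

lemma tauv_ext_module: "v \<in> ext_module n q \<Longrightarrow> tauv m v \<in> ext_module n q"
  by (simp add: ext_module_iff)

lemma tauv_add: "vpow m v \<Longrightarrow> vpow m w \<Longrightarrow> tauv m (v + w) = tauv m v + tauv m w"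
  by (intro ext) (simp add: tau_add)

lemma tauv_Suc: "vpow (Suc m) v \<Longrightarrow> tauv m v = act U.h (tauv (Suc m) v)"
  unfolding act_def by (intro ext) (simp add: tau_Suc)

lemma umat_unit_vec:
  assumes "P \<subseteq> {..<n}" shows "umat \<alpha> P = tauv (Suc 0) (dop \<alpha> (unit_vec P))"
  unfolding mat_op_unit_vec[OF assms] by (intro ext) (rule umat_def)

lemma uop_ext_module:
  assumes \<alpha>: "correction \<alpha>" and v: "v \<in> ext_module n (Suc q)" shows "uop \<alpha> v \<in> ext_module n q"
proof (rule mat_op_ext_module[OF _ v])
  fix P T assume P: "P \<subseteq> {..<n}" and "umat \<alpha> P T \<noteq> 0"
  then have "dmat \<alpha> P T \<noteq> 0" by (auto simp: umat_def)
  then show "T \<subseteq> {..<n} \<and> card P = Suc (card T)" by (rule dmat_degree[OF \<alpha> P])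
qed

lemma uop_uop:
  assumes \<alpha>: "closed_at q \<alpha>" and v: "v \<in> ext_module n q" shows "uop \<alpha> (uop \<alpha> v) = 0"
proof (rule mat_op_mat_op[OF _ v])
  fix P assume P: "P \<subseteq> {..<n}" "card P = q"
  have "vpow 0 (unit_vec P)" "vpow (Suc 0) (dop \<alpha> (unit_vec P))"
    using vpow_dop[of 0] ipow_0 by auto
  then have "uop \<alpha> (umat \<alpha> P) = tauv (Suc (Suc 0)) (dop \<alpha> (dop \<alpha> (unit_vec P)))"
    unfolding umat_unit_vec[OF P(1)] by (intro uop_tauv)
  also have "\<dots> = 0"
    unfolding dop_dop[OF \<alpha> unit_vec_ext[OF P]] by (intro ext) simp
  finally show "uop \<alpha> (umat \<alpha> P) = 0" .
qed

lemma epsU_tau_zero: "ipow m b \<Longrightarrow> \<epsilon> b = 0 \<Longrightarrow> \<epsilon>U (\<tau> m b) = 0"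
  using tau_eps[of m b] by simp

lemma epsU_uop:
  assumes \<alpha>: "correction \<alpha>" and v: "v \<in> ext_module n (Suc 0)" shows "\<epsilon>U (uop \<alpha> v T) = 0"
  unfolding mat_op_def epsU.sum epsU_mult
proof (intro sum.neutral ballI)
  fix P assume "P \<in> Pow {..<n}"
  then have P: "P \<subseteq> {..<n}" by simp
  show "\<epsilon>U (v P) * \<epsilon>U (umat \<alpha> P T) = 0"
  proof (cases "card P = Suc 0")
    case True
    have "vpow (Suc 0) (dop \<alpha> (unit_vec P))" using vpow_dop[of 0] ipow_0 by auto
    then have "\<epsilon>U (umat \<alpha> P T) = 0"
      unfolding umat_unit_vec[OF P] using eps_dop[OF \<alpha> unit_vec_ext[OF P True], of T]
      by (intro epsU_tau_zero) blast+
    then show ?thesis by simp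
  next
    case False
    then have "v P = 0" by (intro ext_module_outside[OF v]) simp
    then show ?thesis by simp
  qed
qed

text \<open>Clearing denominators turns a cycle over the dual quantization, modulo \<open>h\<close>, into a cycle of the
  original complex in a power of the augmentation ideal; strict exactness there gives the bound
  on the denominators of a primitive.\<close>

lemma uop_exact_mod_h:
  assumes \<alpha>: "correction \<alpha>" "\<And>q. closed_at q \<alpha>"
    and v: "v \<in> ext_module n q" "q > 0 \<Longrightarrow> uop \<alpha> v = 0" "q = 0 \<Longrightarrow> \<epsilon>U (v {}) = 0"
  shows "\<exists>w v'. w \<in> ext_module n (Suc q) \<and> v = uop \<alpha> w + act U.h v'"
proof -
  obtain m b u where b: "b \<in> ext_module n q" "vpow (Suc m) b" and vb: "v = tauv (Suc m) b + act U.h u"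
    using dense_vector[OF v(1)] by blast
  \<comment> \<open>\<open>b\<close> is a cycle only up to an error. The chain \<open>c\<close>
    removes the error and lies one level above \<open>b\<close>, so that
    \<open>tauv (Suc m) c\<close> is a multiple of \<open>h\<close>.\<close>
  have "\<exists>c\<in>ext_module n q. vpow (Suc (Suc m)) c \<and> dop \<alpha> (b - c) = 0 \<and> (q = 0 \<longrightarrow> \<epsilon> ((b - c) {}) = 0)"
  proof (cases q)
    case 0
    \<comment> \<open>Solving \<open>\<epsilon>U (v {}) = 0\<close> for the counit of
      \<open>b {}\<close> gives \<open>h^(m+2) a\<close>; a constant chain with this counit lies in
      \<open>I^(m+2)\<close>.\<close>
    define a where "a = - \<epsilon>U (u {})"
    define c where "c = act (s (fps_X ^ Suc (Suc m) * a)) (unit_vec {})"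
    have c: "c \<in> ext_module n q" unfolding c_def 0 by (intro ext_module_act unit_vec_ext) auto
    have "\<epsilon>U (v {}) = 0" by (rule v(3)[OF 0])
    then have "\<epsilon>U (\<tau> (Suc m) (b {})) = fps_X * a"
      unfolding vb a_def by (simp add: act_def epsU_add epsU_mult epsU_s eq_neg_iff_add_eq_0)
    then have "\<epsilon> (b {}) = fps_X ^ Suc m * (fps_X * a)"
      using tau_eps[of "Suc m" "b {}"] b(2) by simp
    moreover have "\<epsilon> (c {}) = fps_X ^ Suc (Suc m) * a"
      by (simp add: c_def act_def unit_vec_def eps_s)
    ultimately have "\<epsilon> ((b - c) {}) = 0" by (simp add: eps.diff algebra_simps)
    moreover have "vpow (Suc (Suc m)) c"
    proof
      fix P
      have "c P = h ^ Suc (Suc m) * (s a * unit_vec {} P)"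
        by (simp add: c_def act_def s_mult s_power mult.assoc)
      then show "ipow (Suc (Suc m)) (c P)"
        using ipow_h_power[OF ipow_0, of "Suc (Suc m)" "s a * unit_vec {} P"] by simp
    qed
    moreover have "dop \<alpha> (b - c) = 0"
      using b(1) c 0 by (intro dop_ext_module_0[OF \<alpha>(1)] ext_module_diff) simp_all
    ultimately show ?thesis using c by blast
  next
    case (Suc q')
    have "vpow (Suc (Suc m)) (dop \<alpha> b)" by (rule vpow_dop[OF b(2)])
    have "uop \<alpha> (tauv (Suc m) b) + act U.h (uop \<alpha> u) = 0"
      using v(2) Suc unfolding vb mat_op_add mat_op_act by simp
    then have "tauv (Suc (Suc m)) (dop \<alpha> b) + act U.h (uop \<alpha> u) = 0"
      unfolding uop_tauv[OF b(2)] .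
    then have "\<tau> (Suc (Suc m)) (dop \<alpha> b T) + U.h * uop \<alpha> u T = 0" for T
      unfolding act_def by (auto simp: fun_eq_iff)
    then have "\<tau> (Suc (Suc m)) (dop \<alpha> b T) = U.h * - uop \<alpha> u T" for T
      by (simp add: eq_neg_iff_add_eq_0)
    \<comment> \<open>Divisibility by \<open>h\<close> in the dual raises the level of the boundary
      from \<open>m + 2\<close> to \<open>m + 3\<close>, so its new primitive \<open>c\<close> lands
      in \<open>I^(m+2)\<close>.\<close>
    then have pow: "vpow (Suc (Suc (Suc m))) (dop \<alpha> b)"
      using tau_divide \<open>vpow (Suc (Suc m)) (dop \<alpha> b)\<close> by blast
    have db: "dop \<alpha> b \<in> ext_module n q'" using dop_ext_module[OF \<alpha>(1)] b(1) Suc by blast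
    have eps: "\<epsilon> (dop \<alpha> b {}) = 0" if "q' = 0" using eps_dop[OF \<alpha>(1)] b(1) Suc that by simp
    obtain c where c: "c \<in> ext_module n (Suc q')" "vpow (Suc (Suc (Suc m)) - 1) c" "dop \<alpha> b = dop \<alpha> c"
      using strict_exactness[OF \<alpha> db dop_dop[OF \<alpha>(2) b(1)] eps pow] by blast
    show ?thesis
    proof (intro bexI conjI)
      show "c \<in> ext_module n q" using c(1) Suc by simp
      show "vpow (Suc (Suc m)) c" using c(2) by simp
      show "dop \<alpha> (b - c) = 0" unfolding mat_op_diff c(3) by (rule diff_self)
    qed (simp add: Suc)
  qed
  then obtain c where c: "c \<in> ext_module n q" "vpow (Suc (Suc m)) c" "dop \<alpha> (b - c) = 0"
      "q = 0 \<Longrightarrow> \<epsilon> ((b - c) {}) = 0"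
    by blast
  have bc: "b - c \<in> ext_module n q" by (intro ext_module_diff b c)
  have "vpow (Suc m) c" using c(2) ipow_Suc_imp by blast
  then have "vpow (Suc m) (b - c)" by (rule vpow_diff[OF b(2)])
  \<comment> \<open>The primitive lies in \<open>I^m\<close>, so \<open>tauv m e\<close> represents
    a chain over the dual.\<close>
  from strict_exactness[OF \<alpha> bc c(3,4) this, unfolded diff_Suc_1]
  obtain e where e: "e \<in> ext_module n (Suc q)" "vpow m e" "b - c = dop \<alpha> e" by blast
  have "tauv (Suc m) b = tauv (Suc m) (dop \<alpha> e + c)" unfolding e(3)[symmetric] by simp
  also have "\<dots> = tauv (Suc m) (dop \<alpha> e) + tauv (Suc m) c"
    by (rule tauv_add[OF vpow_dop[OF e(2)] \<open>vpow (Suc m) c\<close>])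
  also have "\<dots> = uop \<alpha> (tauv m e) + act U.h (tauv (Suc (Suc m)) c)"
    unfolding uop_tauv[OF e(2)] tauv_Suc[OF c(2)] ..
  finally have "v = uop \<alpha> (tauv m e) + act U.h (tauv (Suc (Suc m)) c + u)"
    unfolding vb act_add by (simp only: add.assoc)
  then show ?thesis using tauv_ext_module[OF e(1)] by blast
qed

text \<open>Lifting with the trivial filtration: after division by \<open>h\<close> the remainder is
  again a cycle, or has counit 0 in degree 0, so solvability modulo \<open>h\<close> can be
  iterated.\<close>

lemma uop_exact:
  assumes \<alpha>: "correction \<alpha>" "\<And>q. closed_at q \<alpha>"
    and v: "v \<in> ext_module n q" "q > 0 \<Longrightarrow> uop \<alpha> v = 0" "q = 0 \<Longrightarrow> \<epsilon>U (v {}) = 0"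
  shows "\<exists>w\<in>ext_module n (Suc q). v = uop \<alpha> w"
proof -
  define Z where "Z r = {v \<in> ext_module n q. (q > 0 \<longrightarrow> uop \<alpha> v = 0) \<and> (q = 0 \<longrightarrow> \<epsilon>U (v {}) = 0)}" for r :: nat
  have "\<exists>w\<in>ext_module n (Suc q). (\<forall>P :: nat set. True) \<and> v = uop \<alpha> w"
  proof (rule U.h_adic_lifting[where Z = Z and J = "\<lambda>_ _. True" and r = 0])
    fix r v assume "v \<in> Z r"
    then have v: "v \<in> ext_module n q" "q > 0 \<Longrightarrow> uop \<alpha> v = 0" "q = 0 \<Longrightarrow> \<epsilon>U (v {}) = 0"
      by (auto simp: Z_def)
    obtain w v' where w: "w \<in> ext_module n (Suc q)" "v = uop \<alpha> w + act U.h v'"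
      using uop_exact_mod_h[OF \<alpha> v] by blast
    have hv': "act U.h v' = v - uop \<alpha> w" using w(2) by (simp only: add_diff_cancel_left')
    have "act U.h v' \<in> ext_module n q" unfolding hv' by (intro ext_module_diff v uop_ext_module \<alpha> w)
    then have v'_ext: "v' \<in> ext_module n q" unfolding U.act_h_ext_module .
    have "uop \<alpha> v' = 0" if "q > 0"
    proof -
      have "act U.h (uop \<alpha> v') = act U.h 0"
        unfolding mat_op_act[symmetric] hv' mat_op_diff v(2)[OF that] uop_uop[OF \<alpha>(2) w(1)] act_zero
        by (rule diff_self)
      then show ?thesis unfolding U.act_h_cancel .
    qed
    moreover have "\<epsilon>U (v' {}) = 0" if "q = 0"
    proof -
      have "\<epsilon>U (v {}) = \<epsilon>U (uop \<alpha> w {}) + fps_X * \<epsilon>U (v' {})"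
        by (subst w(2)) (simp add: epsU_add act_def epsU_mult epsU_s)
      moreover have "\<epsilon>U (uop \<alpha> w {}) = 0" using epsU_uop[OF \<alpha>(1)] w(1) that by simp
      ultimately show ?thesis using v(3)[OF that] by simp
    qed
    ultimately have "v' \<in> Z (r - 1)" using v'_ext by (simp add: Z_def)
    then show "\<exists>w v'. w \<in> ext_module n (Suc q) \<and> (\<forall>P :: nat set. True) \<and> v' \<in> Z (r - 1) \<and> v = uop \<alpha> w + act U.h v'"
      using w by blast
  next
    show "v \<in> Z 0" using v by (simp add: Z_def)
  qed simp_all
  then show ?thesis by blast
qed

lemma resolutionU:
  assumes \<alpha>: "correction \<alpha>" "\<And>q. closed_at q \<alpha>"
  shows "resolution_of_trivial_module n \<epsilon>U (\<lambda>q. uop \<alpha>)"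
  by (rule resolution_of_trivial_moduleI[OF epsU_add epsU_mult])
    (use epsU_s in blast, rule uop_ext_module[OF \<alpha>(1)], assumption, rule uop_uop[OF \<alpha>(2)], assumption,
      rule epsU_uop[OF \<alpha>(1)], assumption, rule uop_exact[OF \<alpha>])

lemma koszul_formula_uop:
  assumes \<alpha>: "correction \<alpha>" and p: "p \<in> words n (Suc q)"
  shows "uop \<alpha> (wedge 1 p) =
    koszul_formula n y (\<lambda>i l a. sU (fps_const (C i l a))) (\<lambda>p t. \<tau> 0 (word_coeff \<alpha> p t)) p"
proof
  fix T
  have pn: "set p \<subseteq> {..<n}" using p by (auto simp: words_def)
  have "tauv 0 (wedge 1 p) = wedge 1 p"
    using tau_s[of 1] tau_s[of "- 1"] minus_one_power_cases[of "card (inversions p)", where 'a = 'a]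
      minus_one_power_cases[of "card (inversions p)", where 'a = 'u]
    by (cases "even (card (inversions p))") (auto simp: wedge_def fun_eq_iff s_one U.s_one s.minus U.s.minus)
  then have "uop \<alpha> (wedge 1 p) = tauv (Suc 0) (dop \<alpha> (wedge 1 p))"
    using uop_tauv[of 0 "wedge 1 p" \<alpha>] ipow_0 by simp
  then have "uop \<alpha> (wedge 1 p) T = \<tau> (Suc 0) (koszul_formula n x (\<lambda>i l a. h * cc i l a) (\<lambda>p t. h * word_coeff \<alpha> p t) p T)"
    unfolding koszul_formula_dop[OF \<alpha> p] by simp
  also have "\<dots> = koszul_formula n y (\<lambda>i l a. sU (fps_const (C i l a))) (\<lambda>p t. \<tau> 0 (word_coeff \<alpha> p t)) p T"
  proof (rule koszul_formula_transfer[where I = "{a. ipow (Suc 0) a}", OF _ _ _ _ _ _ _ pn])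
    show "h * cc i l a \<in> {a. ipow (Suc 0) a} \<and> \<tau> (Suc 0) (h * cc i l a) = sU (fps_const (C i l a))" for i l a
      using ipow_h[OF ipow_0] tau_h[OF ipow_0] by (simp add: tau_s)
    show "h * word_coeff \<alpha> p t \<in> {a. ipow (Suc 0) a} \<and> \<tau> (Suc 0) (h * word_coeff \<alpha> p t) = \<tau> 0 (word_coeff \<alpha> p t)" for t
      using ipow_h[OF ipow_0] tau_h[OF ipow_0] by simp
  qed (auto simp: y_def ipow_x intro: ipow_add tau_add ipow_uminus tau_uminus)
  finally show "uop \<alpha> (wedge 1 p) T =
     koszul_formula n y (\<lambda>i l a. sU (fps_const (C i l a))) (\<lambda>p t. \<tau> 0 (word_coeff \<alpha> p t)) p T" .
qed

text \<open>The corrections lie in \<open>I\<close>, so \<open>h^-1\<close> times them belongs to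
  the dual; this yields the divisibility of the transformed coefficients by
  \<open>h\<close>.\<close>

lemma tau_word_coeff:
  assumes "correction \<alpha>" shows "\<tau> 0 (word_coeff \<alpha> p t) = U.h * \<tau> (Suc 0) (word_coeff \<alpha> p t)"
  using aug_word_coeff[OF assms] by (intro tau_Suc) (simp add: ipow_1)

end

section \<open>Quantum formal series Hopf algebras and their duals\<close>

lemma algebra_over_scale:
  assumes "algebra_over sc"
  shows "sc c 1 * a = sc c a" "a * sc c 1 = sc c a"
  using assms unfolding algebra_over_def by (metis mult_1_left, metis mult_1_right)

lemma algebra_over_scale_power:
  assumes "algebra_over sc"
  shows "sc c 1 ^ N * a = sc (c ^ N) a"
proof -
  interpret module sc using assms by (simp add: algebra_over_def)
  show ?thesis
  proof (induction N arbitrary: a)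
    case (Suc N)
    show ?case
      by (simp only: power_Suc mult.assoc) (simp only: Suc algebra_over_scale[OF assms] scale_scale)
  qed simp
qed

lemma fps_X_power_dvd_complete:
  fixes f :: "nat \<Rightarrow> 'k::field fps"
  shows "\<exists>g. \<forall>N. fps_X ^ N dvd g - (\<Sum>i<N. fps_X ^ i * f i)"
proof (intro exI allI)
  fix N
  \<comment> \<open>Terms with \<open>i > k\<close> do not reach the coefficient of
    \<open>h^k\<close>, so a partial sum determines it.\<close>
  let ?g = "Abs_fps (\<lambda>k. fps_nth (\<Sum>i<Suc k. fps_X ^ i * f i) k)"
  have "fps_nth (?g - (\<Sum>i<N. fps_X ^ i * f i)) k = 0" if "k < N" for k
  proof -
    have "(\<Sum>i<N. fps_nth (fps_X ^ i * f i) k) = (\<Sum>i<Suc k. fps_nth (fps_X ^ i * f i) k)"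
      by (rule sum.mono_neutral_right) (use that in \<open>auto simp: fps_X_power_mult_nth\<close>)
    then show ?thesis by (simp add: fps_sum_nth)
  qed
  then have eq: "fps_shift N (?g - (\<Sum>i<N. fps_X ^ i * f i)) * fps_X ^ N = ?g - (\<Sum>i<N. fps_X ^ i * f i)"
    by (intro fps_ext) (simp add: fps_X_power_mult_right_nth)
  show "fps_X ^ N dvd ?g - (\<Sum>i<N. fps_X ^ i * f i)"
    by (subst eq[symmetric]) (rule dvd_triv_right)
qed

lemma fps_X_power_dvd_all: "(\<And>N. fps_X ^ N dvd (g :: 'k::field fps)) \<Longrightarrow> g = 0"
proof (rule fps_ext)
  fix k assume "\<And>N. fps_X ^ N dvd g"
  then obtain d where "g = fps_X ^ Suc k * d" by (meson dvdE)
  then show "fps_nth g k = fps_nth 0 k" using fps_X_power_mult_nth[of "Suc k" d k] by simp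
qed

text \<open>\<open>\<phi>\<close> is a linear bijection onto a product of copies of
  \<open>k[[h]]\<close>, where torsion, completeness and separation are checked
  coordinatewise.\<close>

lemma h_adic_algebra_top_free:
  fixes sc :: "'k::field_char_0 fps \<Rightarrow> 'f::{ring_1,topological_space} \<Rightarrow> 'f"
  assumes alg: "algebra_over sc" and tf: "top_free sc \<phi>"
  shows "h_adic_algebra (\<lambda>c. sc c 1)"
proof -
  interpret m: module sc using alg by (simp add: algebra_over_def)
  interpret hom: module_hom sc pscale \<phi> using tf by (simp add: top_free_def)
  note sc1 = algebra_over_scale[OF alg]
  have inj: "inj \<phi>" and surj: "surj \<phi>"
    using tf homeomorphic_imp_injective_map[of euclidean euclidean \<phi>]
      homeomorphic_imp_surjective_map[of euclidean euclidean \<phi>] by (auto simp: top_free_def)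
  note pow = algebra_over_scale_power[OF alg]
  have dvd: "\<exists>r. u = sc (fps_X ^ N) r" if "\<And>e. fps_X ^ N dvd \<phi> u e" for u N
  proof -
    have "\<forall>e. \<exists>d. \<phi> u e = fps_X ^ N * d" using that by (meson dvdE)
    from choice[OF this] obtain d where d: "\<forall>e. \<phi> u e = fps_X ^ N * d e" ..
    obtain r where "\<phi> r = d" using surj by (metis surj_def)
    then have "\<phi> u = \<phi> (sc (fps_X ^ N) r)" using d by (auto simp: hom.scale pscale_def)
    then show ?thesis using inj by (auto dest: injD)
  qed
  show ?thesis
  proof
    show "sc (c + d) 1 = sc c 1 + sc d 1" for c d by (rule m.scale_left_distrib)
    show "sc (c * d) 1 = sc c 1 * sc d 1" for c d by (simp add: sc1 mult.commute)
    show "sc 1 1 = 1" by simp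
    show "sc c 1 * a = a * sc c 1" for c a by (simp add: sc1)
    show "a = 0" if "sc fps_X 1 * a = 0" for a
    proof -
      have "pscale fps_X (\<phi> a) = \<phi> 0" using that by (simp add: sc1 hom.scale[symmetric])
      then have "\<phi> a = \<phi> 0" unfolding hom.zero by (auto simp: pscale_def fun_eq_iff)
      then show ?thesis by (rule injD[OF inj])
    qed
    show "\<exists>u. \<forall>N. \<exists>r. u - (\<Sum>i<N. sc fps_X 1 ^ i * f i) = sc fps_X 1 ^ N * r" for f
    proof -
      have "\<forall>e. \<exists>g. \<forall>N. fps_X ^ N dvd g - (\<Sum>i<N. fps_X ^ i * \<phi> (f i) e)"
        by (intro allI fps_X_power_dvd_complete)
      from choice[OF this] obtain g where g: "\<forall>e N. fps_X ^ N dvd g e - (\<Sum>i<N. fps_X ^ i * \<phi> (f i) e)" by blast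
      obtain u where u: "\<phi> u = g" using surj by (metis surj_def)
      have "\<phi> (u - (\<Sum>i<N. sc (fps_X ^ i) (f i))) e = g e - (\<Sum>i<N. fps_X ^ i * \<phi> (f i) e)" for N e
        by (simp add: hom.diff hom.sum u hom.scale pscale_def sum_fun_apply)
      then show ?thesis unfolding pow using g dvd by (intro exI[of _ u]) auto
    qed
    show "u = 0" if all: "\<And>N. \<exists>r. u = sc fps_X 1 ^ N * r" for u
    proof -
      have "\<phi> u e = 0" for e
      proof (rule fps_X_power_dvd_all)
        fix N
        obtain r where "u = sc (fps_X ^ N) r" using all unfolding pow by blast
        then show "fps_X ^ N dvd \<phi> u e" by (simp add: hom.scale pscale_def)
      qed
      then have "\<phi> u = \<phi> 0" unfolding hom.zero by (auto simp: fun_eq_iff)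
      then show ?thesis by (rule injD[OF inj])
    qed
  qed
qed

lemma mps_mult_carrier:
  assumes "f \<in> mps_carrier n" "g \<in> mps_carrier n" shows "mps_mult f g \<in> mps_carrier n"
  unfolding mps_carrier_def
proof (intro CollectI allI impI)
  fix A assume A: "\<not> set_mset A \<subseteq> {..<n}"
  show "mps_mult f g A = 0"
    unfolding mps_mult_def
  proof (intro sum.neutral ballI)
    fix B assume "B \<in> {B. B \<subseteq># A}"
    then have "A = B + (A - B)" by simp
    then have "set_mset A = set_mset B \<union> set_mset (A - B)" by (metis set_mset_union)
    then have "\<not> set_mset B \<subseteq> {..<n} \<or> \<not> set_mset (A - B) \<subseteq> {..<n}" using A by auto
    then show "f B * g (A - B) = 0" using assms unfolding mps_carrier_def by auto
  qed
qed

lemma mps_monom_carrier: "set_mset A \<subseteq> {..<n} \<Longrightarrow> mps_monom A \<in> mps_carrier n"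
  by (auto simp: mps_monom_def mps_carrier_def)

lemma topspace_dual_topology: "topspace (dual_topology sg br) = enveloping_dual sg br"
  by (simp add: dual_topology_def pointwise_topology_def)

text \<open>\<open>\<psi>\<close> is \<open>\<pi>\<close> followed by the inverse of the coordinate
  isomorphism \<open>\<Phi>\<close>; the two maps \<open>\<pi>\<close> and \<open>\<Phi>\<close>
  have the same image.\<close>

lemma quantum_series_qfsha:
  fixes sg :: "'k::field_char_0 \<Rightarrow> 'g::ab_group_add \<Rightarrow> 'g"
    and sc :: "'k fps \<Rightarrow> 'f::{ring_1,topological_space} \<Rightarrow> 'f"
  assumes qf: "qfsha sg br \<delta> sc \<phi> \<Delta> \<epsilon> S \<pi>"
    and coord: "formal_coordinates sg br n xbar"
    and x: "\<And>i. i < n \<Longrightarrow> \<pi> (x i) = xbar i" "\<And>i. i < n \<Longrightarrow> \<epsilon> (x i) = 0"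
  shows "\<exists>\<psi>. quantum_series (\<lambda>c. sc c 1) \<epsilon> \<psi> n x"
proof -
  interpret Q: qfsha sg br \<delta> sc \<phi> \<Delta> \<epsilon> S \<pi> by (rule qf)
  note sc1 = algebra_over_scale[OF Q.algebra]
  interpret eps: module_hom sc "(*)" \<epsilon> by (rule Q.counit_linear)
  obtain \<Phi> where hom: "homeomorphic_map (subtopology pointwise_topology (mps_carrier n)) (dual_topology sg br) \<Phi>"
    and add: "\<And>f g. f \<in> mps_carrier n \<Longrightarrow> g \<in> mps_carrier n \<Longrightarrow> \<Phi> (f + g) = \<Phi> f + \<Phi> g"
    and mult: "\<And>f g. f \<in> mps_carrier n \<Longrightarrow> g \<in> mps_carrier n \<Longrightarrow> \<Phi> (mps_mult f g) = dual_mult (\<Phi> f) (\<Phi> g)"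
    and scale: "\<And>c f. f \<in> mps_carrier n \<Longrightarrow> \<Phi> (\<lambda>A. c * f A) = (\<lambda>w. c * \<Phi> f w)"
    and one: "\<Phi> (mps_monom {#}) = dual_one"
    and var: "\<And>i. i < n \<Longrightarrow> \<Phi> (mps_monom {#i#}) = xbar i"
    using coord unfolding formal_coordinates_def by blast
  have top: "topspace (subtopology pointwise_topology (mps_carrier n)) = mps_carrier n"
    by (simp add: pointwise_topology_def)
  have inj: "inj_on \<Phi> (mps_carrier n)" and img: "\<Phi> ` mps_carrier n = enveloping_dual sg br"
    using homeomorphic_imp_injective_map[OF hom] homeomorphic_imp_surjective_map[OF hom]
    unfolding top topspace_dual_topology by auto
  have surj: "range \<pi> = enveloping_dual sg br"
    using quotient_imp_surjective_map[OF Q.proj_quotient_map] unfolding topspace_dual_topology by simp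
  define \<psi> where "\<psi> a = inv_into (mps_carrier n) \<Phi> (\<pi> a)" for a
  have mem: "\<pi> a \<in> \<Phi> ` mps_carrier n" for a using surj img by blast
  have psi: "\<psi> a \<in> mps_carrier n" "\<Phi> (\<psi> a) = \<pi> a" for a
    unfolding \<psi>_def by (rule inv_into_into[OF mem], rule f_inv_into_f[OF mem])
  have psi_eq: "\<psi> a = f" if "f \<in> mps_carrier n" "\<Phi> f = \<pi> a" for a f
    using inj psi that by (metis inj_onD)
  have zero: "(0 :: nat multiset \<Rightarrow> 'k) \<in> mps_carrier n" by (simp add: mps_carrier_def)
  have Phi_0: "\<Phi> 0 = 0" using scale[OF zero, of 0] by (simp add: fun_eq_iff zero_fun_def)
  have h: "h_adic_algebra (\<lambda>c. sc c 1)"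
    by (rule h_adic_algebra_top_free[OF Q.algebra Q.topologically_free])
  have "quantum_series (\<lambda>c. sc c 1) \<epsilon> \<psi> n x"
    unfolding quantum_series_def quantum_series_axioms_def
  proof (intro conjI allI impI h)
    show "\<epsilon> (a + b) = \<epsilon> a + \<epsilon> b" "\<epsilon> (a * b) = \<epsilon> a * \<epsilon> b" for a b
      by (rule eps.add, rule Q.counit_mult)
    show "\<epsilon> (sc c 1) = c" for c by (simp add: eps.scale Q.counit_one)
    show "\<psi> a \<in> mps_carrier n" for a by (rule psi)
    show "\<psi> (a + b) = \<psi> a + \<psi> b" for a b
      by (intro psi_eq mps_carrier_add psi) (simp only: add psi Q.proj_add)
    show "\<psi> (a * b) = mps_mult (\<psi> a) (\<psi> b)" for a b
      by (intro psi_eq mps_mult_carrier psi) (simp only: mult psi Q.proj_mult)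
    show "\<psi> (sc c 1) = (\<lambda>A. if A = {#} then fps_nth c 0 else 0)" for c
    proof (rule psi_eq)
      have m: "(mps_monom {#} :: nat multiset \<Rightarrow> 'k) \<in> mps_carrier n" by (rule mps_monom_carrier) simp
      have e: "(\<lambda>A. if A = {#} then fps_nth c 0 else 0) = (\<lambda>A. fps_nth c 0 * mps_monom {#} A)"
        by (auto simp: mps_monom_def)
      show "\<Phi> (\<lambda>A. if A = {#} then fps_nth c 0 else 0) = \<pi> (sc c 1)"
        unfolding e scale[OF m] one Q.proj_scale Q.proj_one ..
      show "(\<lambda>A. if A = {#} then fps_nth c 0 else 0) \<in> mps_carrier n" by (auto simp: mps_carrier_def)
    qed
    show "\<exists>a. \<psi> a = f" if "f \<in> mps_carrier n" for f
    proof -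
      have "\<Phi> f \<in> range \<pi>" using surj img that by blast
      then obtain a where "\<Phi> f = \<pi> a" by blast
      then show ?thesis using psi_eq[OF that] by blast
    qed
    show "\<exists>b. a = sc fps_X 1 * b" if "\<psi> a = 0" for a
    proof -
      have "\<pi> a = 0" using psi(2)[of a] unfolding that Phi_0 by (rule sym)
      then show ?thesis unfolding sc1 Q.proj_kernel .
    qed
    show "\<psi> (x i) = mps_monom {#i#}" if "i < n" for i
      by (rule psi_eq) (use that var x in \<open>auto intro: mps_monom_carrier\<close>)
    show "\<epsilon> (x i) = 0" if "i < n" for i by (rule x(2)[OF that])
  qed
  then show ?thesis by blast
qed

section \<open>Denominators, the generated subalgebra and its completion\<close>

locale quantum_series_dual = quantum_series "\<lambda>c. sc c 1" \<epsilon> \<psi> n x + quantum_dual sc \<epsilon> scL \<iota> scU j \<epsilon>U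
  for sc :: "'k::field_char_0 fps \<Rightarrow> 'f::ring_1 \<Rightarrow> 'f" and \<epsilon> \<psi> n x
    and scL :: "'k fls \<Rightarrow> 'l::ring_1 \<Rightarrow> 'l" and \<iota> and scU :: "'k fps \<Rightarrow> 'u::ring_1 \<Rightarrow> 'u" and j \<epsilon>U +
  assumes alg: "algebra_over sc"
begin

lemmas sc1 = algebra_over_scale[OF alg]

lemma algL: "algebra_over scL" using laurent by (simp add: laurent_extension_def)
lemma algU: "algebra_over scU" using completion by (simp add: h_adic_completion_def)

sublocale L: module scL using algL by (simp add: algebra_over_def)
sublocale U: module scU using algU by (simp add: algebra_over_def)
sublocale epsU: module_hom scU "(*)" \<epsilon>U by (rule dual_counit_linear)

lemma iota_one: "\<iota> 1 = 1" and iota_add: "\<iota> (a + b) = \<iota> a + \<iota> b" and iota_mult: "\<iota> (a * b) = \<iota> a * \<iota> b"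
  and iota_scale: "\<iota> (sc c a) = scL (fps_to_fls c) (\<iota> a)"
  and iota_zero_iff: "\<iota> a = 0 \<longleftrightarrow> (\<exists>m. sc (fps_X ^ m) a = 0)"
  using laurent by (simp_all add: laurent_extension_def)

text \<open>The kernel of the localization is the \<open>h\<close>-torsion, which is zero.\<close>

lemma iota_inj: "\<iota> a = \<iota> b \<Longrightarrow> a = b"
proof -
  assume a: "\<iota> a = \<iota> b"
  have "\<iota> ((a - b) + b) = \<iota> (a - b) + \<iota> b" by (rule iota_add)
  then have "\<iota> (a - b) = 0" using a by simp
  then obtain m where "sc (fps_X ^ m) (a - b) = 0" using iota_zero_iff by blast
  then have "h ^ m * (a - b) = h ^ m * 0" by (simp add: s_power[symmetric] sc1)
  then have "a - b = 0" unfolding h_power_cancel .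
  then show ?thesis by simp
qed

definition lau :: "nat \<Rightarrow> 'f \<Rightarrow> 'l" where "lau m b = scL (fls_X_inv ^ m) (\<iota> b)"

abbreviation FT :: "'l set" where "FT \<equiv> F_times scL \<iota> \<epsilon>"
abbreviation scA :: "'k fps \<Rightarrow> 'l \<Rightarrow> 'l" where "scA c \<equiv> scL (fps_to_fls c)"

lemma scL_mult: "scL c a * scL d b = scL (c * d) (a * b)"
  using algL unfolding algebra_over_def by (metis module.scale_scale)

lemma lau_add: "lau m (a + b) = lau m a + lau m b"
  by (simp add: lau_def iota_add L.scale_right_distrib)
lemma lau_mult: "lau m a * lau l b = lau (m + l) (a * b)"
  by (simp add: lau_def scL_mult iota_mult power_add)
lemma X_X_inv: "fls_X_inv ^ m * (fls_X ^ m :: 'k fls) = 1"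
  by (simp add: power_mult_distrib[symmetric] fls_X_inv_times_conv_shift)
lemma lau_h_power: "lau (l + m) (h ^ l * a) = lau m a"
proof -
  have "\<iota> (h ^ l * a) = scL (fls_X ^ l) (\<iota> a)"
    by (simp add: s_power[symmetric] sc1 iota_scale fps_to_fls_power)
  then have "lau (l + m) (h ^ l * a) = scL (fls_X_inv ^ m * (fls_X_inv ^ l * fls_X ^ l)) (\<iota> a)"
    by (simp add: lau_def power_add mult_ac)
  then show ?thesis by (simp add: X_X_inv lau_def)
qed
lemma lau_scale: "lau m (sc c a) = scA c (lau m a)"
  by (simp add: lau_def iota_scale mult.commute)
lemma lau_one: "lau 0 1 = 1" by (simp add: lau_def iota_one)

lemma aug_iff: "a \<in> counit_ideal \<epsilon> \<longleftrightarrow> aug a"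
proof -
  have "fps_X dvd f \<longleftrightarrow> fps_nth f 0 = 0" for f :: "'k fps"
  proof
    assume "fps_nth f 0 = 0"
    then have "f = fps_X * fps_shift 1 f" by (intro fps_ext) auto
    then show "fps_X dvd f" by (metis dvd_triv_left)
  qed (auto simp: dvd_def)
  then show ?thesis by (simp add: counit_ideal_def)
qed

lemma FT_gen: "aug a \<Longrightarrow> lau (Suc 0) a \<in> FT"
  unfolding F_times_def lau_def by (rule generated_subalgebra.intros(1)) (auto simp: aug_iff)
lemma FT_one: "1 \<in> FT" unfolding F_times_def by (rule generated_subalgebra.intros)
lemma FT_add: "a \<in> FT \<Longrightarrow> b \<in> FT \<Longrightarrow> a + b \<in> FT" unfolding F_times_def by (rule generated_subalgebra.intros)
lemma FT_mult: "a \<in> FT \<Longrightarrow> b \<in> FT \<Longrightarrow> a * b \<in> FT" unfolding F_times_def by (rule generated_subalgebra.intros)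
lemma FT_scale: "a \<in> FT \<Longrightarrow> scA c a \<in> FT" unfolding F_times_def by (rule generated_subalgebra.intros)
lemma FT_zero: "0 \<in> FT" using FT_scale[OF FT_one, of 0] by simp

lemma lau_in_FT: "ipow m b \<Longrightarrow> lau m b \<in> FT"
proof (induction rule: ipow.induct)
  case (ipow_0 b)
  \<comment> \<open>An element of level 0 is a scalar plus an element of \<open>I\<close>, and the
    latter is \<open>h\<close> times a generator.\<close>
  define c where "c = fps_const (fps_nth (\<epsilon> b) 0)"
  have "aug (b - sc c 1)" by (simp add: eps.diff eps_s c_def)
  then have "lau (Suc 0) (b - sc c 1) \<in> FT" by (rule FT_gen)
  then have "scA fps_X (lau (Suc 0) (b - sc c 1)) + scA c (lau 0 1) \<in> FT"
    unfolding lau_one by (intro FT_add FT_scale FT_one)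
  moreover have "scA fps_X (lau (Suc 0) (b - sc c 1)) = lau 0 (b - sc c 1)"
    using lau_h_power[of "Suc 0" 0 "b - sc c 1"] by (simp add: sc1 lau_scale)
  ultimately have "lau 0 (b - sc c 1) + lau 0 (sc c 1) \<in> FT" by (simp only: lau_scale)
  then show ?case unfolding lau_add[symmetric] by simp
next
  case (ipow_zero r)
  have "lau (Suc r) 0 = 0" using lau_add[of "Suc r" 0 0] by simp
  then show ?case using FT_zero by simp
next
  case (ipow_step r a b c)
  then have "lau r a * lau (Suc 0) b + lau (Suc r) c \<in> FT" by (intro FT_add FT_mult FT_gen)
  then show ?case by (simp add: lau_mult lau_add)
qed

lemma FT_imp_lau: "a \<in> FT \<Longrightarrow> \<exists>m b. ipow m b \<and> a = lau m b"
  unfolding F_times_def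
proof (induction rule: generated_subalgebra.induct)
  case (1 a)
  then show ?case using ipow_1 aug_iff by (force simp: lau_def)
next
  case 2
  then show ?case using lau_one ipow_0 by metis
next
  case (3 a b)
  then obtain m a' l b' where "ipow m a'" "a = lau m a'" "ipow l b'" "b = lau l b'" by blast
  \<comment> \<open>Addition over the common denominator \<open>h^(l+m)\<close>.\<close>
  then have "a + b = lau (l + m) (h ^ l * a' + h ^ m * b')" "ipow (l + m) (h ^ l * a' + h ^ m * b')"
    using lau_h_power[of l m a'] lau_h_power[of m l b'] ipow_h_power[of m a' l] ipow_h_power[of l b' m]
    by (auto simp: lau_add add.commute intro!: ipow_add)
  then show ?case by blast
next
  case (4 a b)
  then obtain m a' l b' where "ipow m a'" "a = lau m a'" "ipow l b'" "b = lau l b'" by blast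
  then have "a * b = lau (m + l) (a' * b')" "ipow (m + l) (a' * b')" by (auto simp: lau_mult ipow_mult)
  then show ?case by blast
next
  case (5 a c)
  then obtain m a' where "ipow m a'" "a = lau m a'" by blast
  then have "scA c a = lau m (sc c a')" "ipow m (sc c a')" using ipow_lmult[of m a' "sc c 1"] by (auto simp: lau_scale sc1)
  then show ?case by blast
qed

lemma j_one: "j 1 = 1"
  by (rule completion[unfolded h_adic_completion_def, THEN conjunct2, THEN conjunct1])
lemma j_add: "a \<in> FT \<Longrightarrow> b \<in> FT \<Longrightarrow> j (a + b) = j a + j b"
  and j_mult: "a \<in> FT \<Longrightarrow> b \<in> FT \<Longrightarrow> j (a * b) = j a * j b"
  using completion[unfolded h_adic_completion_def, THEN conjunct2, THEN conjunct2, THEN conjunct1] by blast+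
lemma j_scale: "a \<in> FT \<Longrightarrow> j (scA c a) = scU c (j a)"
  using completion[unfolded h_adic_completion_def, THEN conjunct2, THEN conjunct2, THEN conjunct2, THEN conjunct1] by blast
lemma U_separated: "(\<And>N. u \<in> range (scU (fps_X ^ N))) \<Longrightarrow> u = 0"
  using completion[unfolded h_adic_completion_def, THEN conjunct2, THEN conjunct2, THEN conjunct2, THEN conjunct2, THEN conjunct1] by blast
lemma U_complete:
  "(\<And>N. t (Suc N) - t N \<in> range (scU (fps_X ^ N))) \<Longrightarrow> \<exists>u. \<forall>N. u - t N \<in> range (scU (fps_X ^ N))"
  using completion[unfolded h_adic_completion_def, THEN conjunct2, THEN conjunct2, THEN conjunct2, THEN conjunct2, THEN conjunct2, THEN conjunct1] by blast
lemma j_dense: "\<exists>a\<in>FT. u - j a \<in> range (scU (fps_X ^ N))"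
  using completion[unfolded h_adic_completion_def, THEN conjunct2, THEN conjunct2, THEN conjunct2, THEN conjunct2, THEN conjunct2, THEN conjunct2, THEN conjunct1] by blast
lemma j_divide: "a \<in> FT \<Longrightarrow> j a \<in> range (scU (fps_X ^ N)) \<longleftrightarrow> a \<in> scA (fps_X ^ N) ` FT"
  using completion[unfolded h_adic_completion_def, THEN conjunct2, THEN conjunct2, THEN conjunct2, THEN conjunct2, THEN conjunct2, THEN conjunct2, THEN conjunct2] by blast

lemmas scU1 = algebra_over_scale[OF algU]

lemma scA_cancel: "scA fps_X a = scA fps_X b \<Longrightarrow> a = b"
proof -
  assume "scA fps_X a = scA fps_X b"
  then have "scL fls_X_inv (scA fps_X a) = scL fls_X_inv (scA fps_X b)" by simp
  then show ?thesis using X_X_inv[of 1] by simp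
qed

text \<open>Modulo \<open>h^N\<close> the element \<open>u\<close> is some \<open>j a\<close>. Then
  \<open>h j a\<close> lies in \<open>h^(N+1) U\<close>, so \<open>h a\<close> lies in
  \<open>h^(N+1)\<close> times the subalgebra; cancelling \<open>h\<close> in the Laurent extension
  puts \<open>a\<close>, and with it \<open>u\<close>, into \<open>h^N\<close>. Separatedness
  concludes.\<close>

lemma U_torsion_free: assumes "scU fps_X u = 0" shows "u = 0"
proof (rule U_separated)
  fix N
  obtain a r where a: "a \<in> FT" "u - j a = scU (fps_X ^ N) r" using j_dense by blast
  have "j (scA fps_X a) = scU fps_X (j a)" by (rule j_scale[OF a(1)])
  also have "j a = u - scU (fps_X ^ N) r" unfolding a(2)[symmetric] by simp
  also have "scU fps_X (u - scU (fps_X ^ N) r) = scU (fps_X ^ Suc N) (- r)" using assms by (simp add: U.scale_right_diff_distrib U.scale_minus_right)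
  finally have "scA fps_X a \<in> scA (fps_X ^ Suc N) ` FT"
    using j_divide[OF FT_scale[OF a(1)]] by blast
  then obtain b where b: "b \<in> FT" "scA fps_X a = scA (fps_X ^ Suc N) b" by blast
  then have "scA fps_X a = scA fps_X (scA (fps_X ^ N) b)"
    by (simp only: power_Suc fls_times_fps_to_fls L.scale_scale)
  then have "a = scA (fps_X ^ N) b" by (rule scA_cancel)
  then have "j a = scU (fps_X ^ N) (j b)" using j_scale[OF b(1)] by (simp only:)
  then have "u = scU (fps_X ^ N) (j b + r)"
    unfolding U.scale_right_distrib a(2)[symmetric] by simp
  then show "u \<in> range (scU (fps_X ^ N))" by blast
qed

lemmas scU_power = algebra_over_scale_power[OF algU]

lemma h_adic_algebra_U: "h_adic_algebra (\<lambda>c. scU c 1)"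
proof
  show "scU (c + d) 1 = scU c 1 + scU d 1" for c d by (rule U.scale_left_distrib)
  show "scU (c * d) 1 = scU c 1 * scU d 1" for c d by (simp add: scU1 mult.commute)
  show "scU 1 1 = 1" by simp
  show "scU c 1 * a = a * scU c 1" for c a by (simp add: scU1)
  show "a = 0" if "scU fps_X 1 * a = 0" for a using that U_torsion_free by (simp add: scU1)
  show "\<exists>u. \<forall>N. \<exists>r. u - (\<Sum>i<N. scU fps_X 1 ^ i * f i) = scU fps_X 1 ^ N * r" for f
    using U_complete[of "\<lambda>N. \<Sum>i<N. scU (fps_X ^ i) (f i)"] unfolding scU_power by (auto simp: image_iff)
  show "u = 0" if "\<And>N. \<exists>r. u = scU fps_X 1 ^ N * r" for u
    using that U_separated[of u] unfolding scU_power by auto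
qed

definition tau :: "nat \<Rightarrow> 'f \<Rightarrow> 'u" where "tau m b = j (lau m b)"

lemma quantum_pair: "quantum_pair (\<lambda>c. sc c 1) \<epsilon> \<psi> n x (\<lambda>c. scU c 1) tau \<epsilon>U"
  unfolding quantum_pair_def quantum_pair_axioms_def
proof (intro conjI allI impI h_adic_algebra_U quantum_series_axioms)
  show "tau m (a + b) = tau m a + tau m b" if "ipow m a" "ipow m b" for m a b
    using that by (simp add: tau_def lau_add j_add lau_in_FT)
  show "tau (m + l) (a * b) = tau m a * tau l b" if "ipow m a" "ipow l b" for m a l b
    using that by (simp add: tau_def lau_mult[symmetric] j_mult lau_in_FT)
  show "tau (Suc m) (h * a) = tau m a" for m a
    using lau_h_power[of "Suc 0" m a] by (simp add: tau_def)
  show "tau 0 (sc c 1) = scU c 1" for c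
    by (simp add: tau_def lau_scale lau_one j_scale FT_one j_one)
  show "\<exists>m a u'. ipow m a \<and> u = tau m a + scU fps_X 1 * u'" for u
  proof -
    obtain a r where "a \<in> FT" "u - j a = scU (fps_X ^ 1) r" using j_dense by blast
    moreover obtain m b where "ipow m b" "a = lau m b" using FT_imp_lau \<open>a \<in> FT\<close> by blast
    ultimately show ?thesis by (intro exI[of _ m] exI[of _ b] exI[of _ r]) (simp add: tau_def scU1 algebra_simps)
  qed
  show "ipow (Suc m) b" if b: "ipow m b" "tau m b = scU fps_X 1 * u" for m b u
  proof -
    have "j (lau m b) \<in> range (scU (fps_X ^ 1))" using b(2) by (auto simp: tau_def scU1)
    then obtain a where "a \<in> FT" "lau m b = scA (fps_X ^ 1) a" using j_divide[OF lau_in_FT[OF b(1)]] by blast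
    moreover obtain l c where c: "ipow l c" "a = lau l c" using FT_imp_lau \<open>a \<in> FT\<close> by blast
    ultimately have "lau m b = lau l (h * c)" by (simp add: lau_scale sc1)
    \<comment> \<open>Over a common denominator the identity descends to the original algebra; there
      strictness cancels \<open>h^l\<close> and leaves \<open>b\<close> in
      \<open>I^(m+1)\<close>.\<close>
    then have "lau (m + l) (h ^ l * b) = lau (m + l) (h ^ m * (h * c))"
      using lau_h_power[of l m b] lau_h_power[of m l "h * c"] by (simp add: add.commute)
    then have "scL (fls_X ^ (m + l)) (lau (m + l) (h ^ l * b)) = scL (fls_X ^ (m + l)) (lau (m + l) (h ^ m * (h * c)))"
      by simp
    then have "\<iota> (h ^ l * b) = \<iota> (h ^ m * (h * c))"
      unfolding lau_def using X_X_inv[of "m + l"] by (simp add: mult.commute)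
    then have "h ^ l * b = h ^ Suc m * c"
      using iota_inj by (simp add: mult.assoc power_commutes[symmetric])
    moreover have "ipow (Suc m + l) (h ^ Suc m * c)" by (rule ipow_h_power[OF c(1)])
    ultimately have "ipow (l + Suc m) (h ^ l * b)" by (simp add: add.commute)
    then show ?thesis unfolding ipow_h_power_iff .
  qed
  show "fps_X ^ m * \<epsilon>U (tau m b) = \<epsilon> b" if "ipow m b" for m b
  proof -
    have "fps_X ^ m * \<epsilon>U (tau m b) = \<epsilon>U (j (scA (fps_X ^ m) (lau m b)))"
      using that by (simp add: tau_def epsU.scale[symmetric] j_scale lau_in_FT)
    also have "scA (fps_X ^ m) (lau m b) = \<iota> b"
      unfolding lau_def using X_X_inv[of m] by (simp add: mult.commute fps_to_fls_power)
    finally show ?thesis by (simp add: dual_counit_extends)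
  qed
  show "\<epsilon>U (u + v) = \<epsilon>U u + \<epsilon>U v" "\<epsilon>U (u * v) = \<epsilon>U u * \<epsilon>U v" for u v
    by (rule epsU.add, rule dual_counit_mult)
  show "\<epsilon>U (scU c 1) = c" for c by (simp add: epsU.scale dual_counit_one)
qed

end

section \<open>Both resolutions from one correction\<close>

theorem theorem6p3p1:
  fixes sg :: "'k::field_char_0 \<Rightarrow> 'g::ab_group_add \<Rightarrow> 'g"
    and br :: "'g \<Rightarrow> 'g \<Rightarrow> 'g"
    and \<delta> :: "'g \<Rightarrow> ('g \<Rightarrow> 'k) \<Rightarrow> ('g \<Rightarrow> 'k) \<Rightarrow> 'k"
    and sc :: "'k fps \<Rightarrow> 'f::{ring_1,topological_space} \<Rightarrow> 'f"
    and \<phi> :: "'f \<Rightarrow> 'e \<Rightarrow> 'k fps"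
    and \<Delta> :: "'f \<Rightarrow> 'e \<times> 'e \<Rightarrow> 'k fps"
    and \<epsilon> :: "'f \<Rightarrow> 'k fps"
    and S :: "'f \<Rightarrow> 'f"
    and \<pi> :: "'f \<Rightarrow> 'g list \<Rightarrow> 'k"
    and scL :: "'k fls \<Rightarrow> 'l::ring_1 \<Rightarrow> 'l"
    and \<iota> :: "'f \<Rightarrow> 'l"
    and scU :: "'k fps \<Rightarrow> 'u::ring_1 \<Rightarrow> 'u"
    and j :: "'l \<Rightarrow> 'u"
    and \<epsilon>U :: "'u \<Rightarrow> 'k fps"
    and n :: nat
    and xbar :: "nat \<Rightarrow> 'g list \<Rightarrow> 'k"
    and x :: "nat \<Rightarrow> 'f"
    and xcheck :: "nat \<Rightarrow> 'u"
    and C :: "nat \<Rightarrow> nat \<Rightarrow> nat \<Rightarrow> 'k"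
  assumes "qfsha sg br \<delta> sc \<phi> \<Delta> \<epsilon> S \<pi>"
    and "quantum_dual sc \<epsilon> scL \<iota> scU j \<epsilon>U"
    and "formal_coordinates sg br n xbar"
    and "\<And>i. i < n \<Longrightarrow> \<pi> (x i) = xbar i"
    and "\<And>i. i < n \<Longrightarrow> \<epsilon> (x i) = 0"
    and "\<And>i. i < n \<Longrightarrow> xcheck i = j (scL fls_X_inv (\<iota> (x i)))"
    and "structure_constants_mod_h scU n xcheck C"
  shows "\<exists>\<alpha> d.
      (\<forall>q. \<forall>p\<in>words n (Suc q). \<forall>t\<in>words n q. \<alpha> p t \<in> counit_ideal \<epsilon>) \<and>
      (\<forall>q. \<forall>p\<in>words n (Suc q).
         d (Suc q) (wedge 1 p) =
           koszul_formula n x (\<lambda>i l a. sc (fps_X * fps_const (C i l a)) 1)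
             (\<lambda>p t. sc fps_X (\<alpha> p t)) p) \<and>
      resolution_of_trivial_module n \<epsilon> d \<and>
      (\<forall>q. \<forall>p\<in>words n (Suc q). \<forall>t\<in>words n q.
         j (\<iota> (\<alpha> p t)) \<in> scU fps_X ` ordered_poly_series scU n xcheck) \<and>
      (\<exists>dcheck.
        (\<forall>q. \<forall>p\<in>words n (Suc q).
           dcheck (Suc q) (wedge 1 p) =
             koszul_formula n xcheck (\<lambda>i l a. scU (fps_const (C i l a)) 1)
               (\<lambda>p t. j (\<iota> (\<alpha> p t))) p) \<and>
        resolution_of_trivial_module n \<epsilon>U dcheck)"
proof -
  interpret Q: qfsha sg br \<delta> sc \<phi> \<Delta> \<epsilon> S \<pi> by (rule assms(1))
  obtain \<psi> where "quantum_series (\<lambda>c. sc c 1) \<epsilon> \<psi> n x"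
    using quantum_series_qfsha[OF assms(1,3,4,5)] by blast
  then interpret D: quantum_series_dual sc \<epsilon> \<psi> n x scL \<iota> scU j \<epsilon>U
    by (intro quantum_series_dual.intro assms(2) quantum_series_dual_axioms.intro Q.algebra)
  interpret P: quantum_pair "\<lambda>c. sc c 1" \<epsilon> \<psi> n x "\<lambda>c. scU c 1" D.tau \<epsilon>U
    by (rule D.quantum_pair)
  have y: "P.y i = xcheck i" if "i < n" for i
    using assms(6)[OF that] by (simp add: P.y_def D.tau_def D.lau_def)
  have lie: "quantum_lie (\<lambda>c. sc c 1) \<epsilon> \<psi> n x C"
  proof (rule P.bracket_from_structure_constants)
    fix i l assume il: "i < n" "l < n"
    have "(\<Sum>a<n. scU (fps_const (C i l a)) 1 * P.y a) = (\<Sum>a<n. scU (fps_const (C i l a)) (xcheck a))"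
      by (intro sum.cong refl) (simp add: D.scU1 y)
    then show "\<exists>u. (P.y i * P.y l - P.y l * P.y i) - (\<Sum>a<n. scU (fps_const (C i l a)) 1 * P.y a) = scU fps_X 1 * u"
      using assms(7) il unfolding structure_constants_mod_h_def by (auto simp: y D.scU1)
  qed
  interpret R: quantum_lie_pair "\<lambda>c. sc c 1" \<epsilon> \<psi> n x C "\<lambda>c. scU c 1" D.tau \<epsilon>U
    by (intro quantum_lie_pair.intro lie D.quantum_pair)
  obtain \<alpha> where \<alpha>: "R.correction \<alpha>" "\<And>q. R.closed_at q \<alpha>" using R.correction_exists by blast
  have tau_0: "D.tau 0 a = j (\<iota> a)" for a by (simp add: D.tau_def D.lau_def)
  have polys: "P.polys \<subseteq> ordered_polys scU n xcheck"
  proof -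
    have eq: "map (\<lambda>i. P.y i ^ m i) [0..<n] = map (\<lambda>i. xcheck i ^ m i) [0..<n]" for m
      by (rule map_cong) (simp_all add: y)
    show ?thesis unfolding P.polys_def ordered_polys_def D.scU1 eq ..
  qed
  \<comment> \<open>Every element of the dual is such a series, so divisibility by \<open>h\<close>
    is all that remains to be shown for the transformed coefficients.\<close>
  have series: "u \<in> ordered_poly_series scU n xcheck" for u
  proof -
    obtain p where p: "\<And>N. p N \<in> P.polys"
      "\<And>M. \<exists>r. u - (\<Sum>N<M. scU fps_X 1 ^ N * p N) = scU fps_X 1 ^ M * r"
      using P.poly_series by blast
    have "u - (\<Sum>N<M. scU (fps_X ^ N) (p N)) \<in> range (scU (fps_X ^ M))" for M
      using p(2)[of M] unfolding D.scU_power by blast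
    then show ?thesis using p(1) polys unfolding ordered_poly_series_def by blast
  qed
  have F_form: "R.dop \<alpha> (wedge 1 p) = koszul_formula n x (\<lambda>i l a. sc (fps_X * fps_const (C i l a)) 1)
      (\<lambda>p t. sc fps_X (word_coeff \<alpha> p t)) p" if "p \<in> words n (Suc q)" for p q
    using R.koszul_formula_dop[OF \<alpha>(1) that] unfolding D.s_mult[symmetric] unfolding D.sc1 .
  have U_form: "R.uop \<alpha> (wedge 1 p) = koszul_formula n xcheck (\<lambda>i l a. scU (fps_const (C i l a)) 1)
      (\<lambda>p t. j (\<iota> (word_coeff \<alpha> p t))) p" if p: "p \<in> words n (Suc q)" for p q
  proof
    fix T
    have "set p \<subseteq> {..<n}" using p by (simp add: words_def)
    \<comment> \<open>\<open>P.y\<close> and \<open>xcheck\<close> are known to agree for indices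
      below \<open>n\<close>, hence a transfer along the identity in place of a rewrite.\<close>
    then have "koszul_formula n P.y (\<lambda>i l a. scU (fps_const (C i l a)) 1) (\<lambda>p t. D.tau 0 (word_coeff \<alpha> p t)) p T
       = koszul_formula n xcheck (\<lambda>i l a. scU (fps_const (C i l a)) 1) (\<lambda>p t. j (\<iota> (word_coeff \<alpha> p t))) p T"
      by (intro koszul_formula_transfer[where \<theta> = "\<lambda>a. a" and I = UNIV]) (simp_all add: y tau_0)
    then show "R.uop \<alpha> (wedge 1 p) T = koszul_formula n xcheck (\<lambda>i l a. scU (fps_const (C i l a)) 1)
      (\<lambda>p t. j (\<iota> (word_coeff \<alpha> p t))) p T"
      unfolding R.koszul_formula_uop[OF \<alpha>(1) p] .
  qed
  have "j (\<iota> (word_coeff \<alpha> p t)) = scU fps_X (D.tau (Suc 0) (word_coeff \<alpha> p t))" for p t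
    using R.tau_word_coeff[OF \<alpha>(1), of p t] by (simp add: tau_0 D.scU1)
  then have small: "j (\<iota> (word_coeff \<alpha> p t)) \<in> scU fps_X ` ordered_poly_series scU n xcheck" for p t
    using series by blast
  show ?thesis
  proof (intro exI conjI)
    show "\<forall>q. \<forall>p\<in>words n (Suc q). \<forall>t\<in>words n q. word_coeff \<alpha> p t \<in> counit_ideal \<epsilon>"
      using R.aug_word_coeff[OF \<alpha>(1)] by (simp add: D.aug_iff)
    show "\<forall>q. \<forall>p\<in>words n (Suc q). R.dop \<alpha> (wedge 1 p) =
           koszul_formula n x (\<lambda>i l a. sc (fps_X * fps_const (C i l a)) 1)
             (\<lambda>p t. sc fps_X (word_coeff \<alpha> p t)) p"
      using F_form by blast
    show "resolution_of_trivial_module n \<epsilon> (\<lambda>q. R.dop \<alpha>)" by (rule R.resolution[OF \<alpha>])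
    show "\<forall>q. \<forall>p\<in>words n (Suc q). \<forall>t\<in>words n q.
         j (\<iota> (word_coeff \<alpha> p t)) \<in> scU fps_X ` ordered_poly_series scU n xcheck"
      using small by blast
    show "\<forall>q. \<forall>p\<in>words n (Suc q). R.uop \<alpha> (wedge 1 p) =
             koszul_formula n xcheck (\<lambda>i l a. scU (fps_const (C i l a)) 1)
               (\<lambda>p t. j (\<iota> (word_coeff \<alpha> p t))) p"
      using U_form by blast
    show "resolution_of_trivial_module n \<epsilon>U (\<lambda>q. R.uop \<alpha>)" by (rule R.resolutionU[OF \<alpha>])
  qed
qed

end
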